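(* Let $V\in\mathcal U\mathcal M(\hat C\otimes A)$ be a bicharacter from a quantum group $C$ to a quantum group $A$ and let $\mathbb V\in\mathcal U(\mathcal H_C\otimes\mathcal H_A)$ be the corresponding concrete bicharacter. Then $$\hat V:=\sigma(V^* )\in\mathcal U\mathcal M(A\otimes\hat C)\quad\text{and}\quad\hat{\mathbb V}:=\Sigma\mathbb V^*\Sigma\in\mathcal U(\mathcal H_A\otimes\mathcal H_C)$$ are a bicharacter from $\hat A$ to $\hat C$ and the corresponding concrete bicharacter. Here the double dual of $(A,\Delta_A)$ is identified with $(A,\Delta_A)$. This duality ($C\mapsto\hat C$, $V\mapsto\hat V$) is a contravariant functor on the bicharacter category.
   Context: Tensor products of $C^*$-algebras are spatial; $\mathcal M(A)$ is the multiplier algebra, $\mathcal U\mathcal M(A)$ its unitary group; leg numbering notation is used. $\sigma$ denotes the flip of tensor factors of $C^*$-algebras (extended to multipliers) and $\Sigma$ the flip of tensor factors of Hilbert spaces. A unitary $\mathbb W$ on $\mathcal H\otimes\mathcal H$ is multiplicative if $\mathbb W_{23}\mathbb W_{12}=\mathbb W_{12}\mathbb W_{13}\mathbb W_{23}$. It is modular if there are positive self-adjoint operators $\hat Q,Q$ on $\mathcal H$ with trivial kernels and a unitary $\widetilde{\mathbb W}$ on $\overline{\mathcal H}\otimes\mathcal H$ ($\overline{\mathcal H}$ the complex-conjugate Hilbert space) such that $\mathbb W^*(\hat Q\otimes Q)\mathbb W=\hat Q\otimes Q$ and $(x\otimes y\mid\mathbb W\mid z\otimes u)=(\overline z\otimes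 Qy\mid\widetilde{\mathbb W}\mid\overline x\otimes Q^{-1}u)$ for all $x,z\in\mathcal H$, $y\in\mathrm{dom}(Q)$, $u\in\mathrm{dom}(Q^{-1})$, where $(x\mid T\mid y):=(x\mid Ty)$. A quantum group is a pair $(C,\Delta_C)$ obtained from some modular multiplicative unitary $\mathbb W^C$ on $\mathcal H_C\otimes\mathcal H_C$: $C\subseteq\mathbb B(\mathcal H_C)$ is the norm closure of $\{(\omega\otimes\mathrm{id})(\mathbb W^C):\omega\in\mathbb B(\mathcal H_C)_*\}$ and $\Delta_C(x)=\mathbb W^C(x\otimes1)(\mathbb W^C)^*$. Its dual $(\hat C,\Delta_{\hat C})$ is the quantum group obtained in the same way from the (again modular) multiplicative unitary $\hat{\mathbb W}=\Sigma(\mathbb W^C)^*\Sigma$ on the same Hilbert space, so $\hat C$ is the norm closure of $\{(\mathrm{id}\otimes\omega)((\mathbb W^C)^* )\}$ and $\Delta_{\hat C}(y)=\Sigma(\mathbb W^C)^*(1\otimes y)\mathbb W^C\Sigma$; the double dual of $C$ is $C$. It is known that $\mathbb W^C$ is the image of a unitary $\mathrm W^C\in\mathcal U\mathcal M(\hat C\otimes C)$, the reduced bicharacter, which depends only on $(C,\Delta_C)$. A generating modular multiplicative unitary is fixed for each quantum group, with that of $\hat C$ being the dual of that of $C$. A bicharacter from $C$ to $A$ is a unitary $V\in\mathcal U\mathcal M(\hat C\otimes A)$ with $(\Delta_{\hat C}\otimes\mathrm{id}_A)V=V_{23}V_{13}$ and $(\mathrm{id}_{\hat C}\otimes\Delta_A)V=V_{12}V_{13}$;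 its image $\mathbb V\in\mathcal U(\mathcal H_C\otimes\mathcal H_A)$ is the corresponding concrete bicharacter. The composition $V^{C\to B}=V^{A\to B}*V^{C\to A}$ is the unique bicharacter in $\mathcal U\mathcal M(\hat C\otimes B)$ with $\mathbb V^{A\to B}_{23}\mathbb V^{C\to A}_{12}=\mathbb V^{C\to A}_{12}\mathbb V^{C\to B}_{13}\mathbb V^{A\to B}_{23}$ on $\mathcal H_C\otimes\mathcal H_A\otimes\mathcal H_B$. The bicharacter category has quantum groups as objects, bicharacters from $C$ to $A$ as arrows $C\to A$, composition $*$, and identities $\mathrm W^C$. *)

theory Defs
  imports "HOL-Analysis.Analysis"
begin

section \<open>Complex Hilbert spaces\<close>

text \<open>Inner products are antilinear in the first variable.\<close>

class chilbert_space = banach + real_inner +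
  fixes scaleC :: "complex \<Rightarrow> 'a \<Rightarrow> 'a" (infixr "*\<^sub>C" 75)
    and cinner :: "'a \<Rightarrow> 'a \<Rightarrow> complex"
  assumes scaleC_add_right: "c *\<^sub>C (x + y) = c *\<^sub>C x + c *\<^sub>C y"
    and scaleC_add_left: "(c + d) *\<^sub>C x = c *\<^sub>C x + d *\<^sub>C x"
    and scaleC_scaleC: "c *\<^sub>C d *\<^sub>C x = (c * d) *\<^sub>C x"
    and scaleR_scaleC: "r *\<^sub>R x = complex_of_real r *\<^sub>C x"
    and cinner_commute: "cinner x y = cnj (cinner y x)"
    and cinner_add_right: "cinner x (y + z) = cinner x y + cinner x z"
    and cinner_scaleC_right: "cinner x (c *\<^sub>C y) = c * cinner x y"
    and inner_eq_Re_cinner: "x \<bullet> y = Re (cinner x y)"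

lemma cinner_add_left: "cinner (x + y) z = cinner x z + cinner y z"
  by (metis cinner_add_right cinner_commute complex_cnj_add)

lemma cinner_scaleC_left: "cinner (c *\<^sub>C x) y = cnj c * cinner x y"
  by (metis cinner_scaleC_right cinner_commute complex_cnj_mult)

lemma cinner_zero_right [simp]: "cinner x 0 = 0"
  using cinner_add_right[of x 0 0] by simp

lemma cinner_zero_left [simp]: "cinner 0 x = 0"
  using cinner_add_left[of 0 0 x] by simp

lemma cinner_minus_right: "cinner x (- y) = - cinner x y"
  using cinner_add_right[of x y "- y"] by (simp add: eq_neg_iff_add_eq_0 add.commute)

lemma cinner_diff_right: "cinner x (y - z) = cinner x y - cinner x z"
  using cinner_add_right[of x y "- z"] by (simp add: cinner_minus_right)

lemma cinner_diff_left: "cinner (x - y) z = cinner x z - cinner y z"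
  by (metis cinner_diff_right cinner_commute complex_cnj_diff)

lemma cinner_sum_right: "cinner x (\<Sum>i\<in>I. f i) = (\<Sum>i\<in>I. cinner x (f i))"
  by (induction I rule: infinite_finite_induct) (auto simp: cinner_add_right)

lemma cinner_sum_left: "cinner (\<Sum>i\<in>I. f i) x = (\<Sum>i\<in>I. cinner (f i) x)"
  by (induction I rule: infinite_finite_induct) (auto simp: cinner_add_left)

lemma cinner_self: "cinner x x = complex_of_real ((norm x)\<^sup>2)"
proof -
  have "Im (cinner x x) = 0"
    using cinner_commute[of x x] by (metis Reals_cnj_iff complex_is_Real_iff)
  moreover have "Re (cinner x x) = (norm x)\<^sup>2"
    by (simp add: norm_eq_sqrt_inner inner_eq_Re_cinner[symmetric])
  ultimately show ?thesis by (simp add: complex_eq_iff)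
qed

lemma scaleC_one [simp]: "1 *\<^sub>C x = x"
  by (metis scaleR_scaleC of_real_1 scaleR_one)

lemma norm_scaleC: "norm (c *\<^sub>C x) = cmod c * norm x"
proof -
  have "complex_of_real ((norm (c *\<^sub>C x))\<^sup>2) = cnj c * c * complex_of_real ((norm x)\<^sup>2)"
    unfolding cinner_self[symmetric] cinner_scaleC_left cinner_scaleC_right by (simp only: mult_ac)
  also have "\<dots> = complex_of_real ((cmod c * norm x)\<^sup>2)"
    unfolding power_mult_distrib of_real_mult complex_norm_square by (simp only: mult_ac)
  finally have "(norm (c *\<^sub>C x))\<^sup>2 = (cmod c * norm x)\<^sup>2"
    by (simp only: of_real_eq_iff)
  then show ?thesis
    by (simp add: power2_eq_iff_nonneg)
qed

lemma norm_cinner_le: "cmod (cinner x y) \<le> norm x * norm y"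
proof (cases "cinner x y = 0")
  case False
  let ?c = "cnj (sgn (cinner x y))"
  have "?c * cinner x y = complex_of_real (cmod (cinner x y))"
    using False by (simp add: sgn_div_norm scaleR_conv_of_real complex_norm_square[symmetric]
        field_simps power2_eq_square)
  then have "cmod (cinner x y) = x \<bullet> (?c *\<^sub>C y)"
    by (simp add: inner_eq_Re_cinner cinner_scaleC_right)
  also have "\<dots> \<le> norm x * norm (?c *\<^sub>C y)"
    by (rule norm_cauchy_schwarz)
  also have "\<dots> = norm x * norm y"
    using False by (simp add: norm_scaleC norm_sgn)
  finally show ?thesis .
qed simp

lemma bounded_bilinear_cinner: "bounded_bilinear cinner"
proof
  fix x y z :: 'a and r :: real
  show "cinner (x + y) z = cinner x z + cinner y z" by (rule cinner_add_left)
  show "cinner x (y + z) = cinner x y + cinner x z" by (rule cinner_add_right)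
  show "cinner (r *\<^sub>R x) y = r *\<^sub>R cinner x y"
    by (simp add: scaleR_scaleC cinner_scaleC_left scaleR_conv_of_real)
  show "cinner x (r *\<^sub>R y) = r *\<^sub>R cinner x y"
    by (simp add: scaleR_scaleC cinner_scaleC_right scaleR_conv_of_real)
  show "\<exists>K. \<forall>x y. norm (cinner x y) \<le> norm x * norm y * K"
    by (rule exI[of _ 1]) (simp add: norm_cinner_le)
qed

subsection \<open>The complex-conjugate Hilbert space\<close>

typedef 'a conj = "UNIV :: 'a set" morphisms unconj conj ..

setup_lifting type_definition_conj

instantiation conj :: (chilbert_space) real_inner
begin

lift_definition zero_conj :: "'a conj" is 0 .
lift_definition plus_conj :: "'a conj \<Rightarrow> 'a conj \<Rightarrow> 'a conj" is "(+)" .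
lift_definition minus_conj :: "'a conj \<Rightarrow> 'a conj \<Rightarrow> 'a conj" is "(-)" .
lift_definition uminus_conj :: "'a conj \<Rightarrow> 'a conj" is uminus .
lift_definition scaleR_conj :: "real \<Rightarrow> 'a conj \<Rightarrow> 'a conj" is scaleR .
lift_definition inner_conj :: "'a conj \<Rightarrow> 'a conj \<Rightarrow> real" is inner .
lift_definition norm_conj :: "'a conj \<Rightarrow> real" is norm .
lift_definition sgn_conj :: "'a conj \<Rightarrow> 'a conj" is sgn .
lift_definition dist_conj :: "'a conj \<Rightarrow> 'a conj \<Rightarrow> real" is dist .

definition uniformity_conj :: "('a conj \<times> 'a conj) filter"
  where "uniformity_conj = (INF e\<in>{0<..}. principal {(x, y). dist x y < e})"

definition open_conj :: "'a conj set \<Rightarrow> bool"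
  where "open_conj U \<longleftrightarrow> (\<forall>x\<in>U. \<forall>\<^sub>F (x', y) in uniformity. x' = x \<longrightarrow> y \<in> U)"

instance
proof
  show "uniformity = (INF e\<in>{0<..}. principal {(x::'a conj, y). dist x y < e})"
    by (fact uniformity_conj_def)
  show "open U \<longleftrightarrow> (\<forall>x\<in>U. \<forall>\<^sub>F (x', y) in uniformity. x' = x \<longrightarrow> y \<in> U)" for U :: "'a conj set"
    by (fact open_conj_def)
  fix x y z :: "'a conj" and r s :: real
  show "x + y + z = x + (y + z)" "x + y = y + x" "0 + x = x" "- x + x = 0" "x - y = x + - y"
    by (transfer; simp)+
  show "r *\<^sub>R (x + y) = r *\<^sub>R x + r *\<^sub>R y" "(r + s) *\<^sub>R x = r *\<^sub>R x + s *\<^sub>R x"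
    "r *\<^sub>R s *\<^sub>R x = (r * s) *\<^sub>R x" "1 *\<^sub>R x = x"
    by (transfer; simp add: scaleR_add_right scaleR_add_left)+
  show "dist x y = norm (x - y)" by transfer (rule dist_norm)
  show "sgn x = inverse (norm x) *\<^sub>R x" by transfer (rule sgn_div_norm)
  show "x \<bullet> y = y \<bullet> x" by transfer (rule inner_commute)
  show "(x + y) \<bullet> z = x \<bullet> z + y \<bullet> z" by transfer (rule inner_add_left)
  show "r *\<^sub>R x \<bullet> y = r * (x \<bullet> y)" by transfer simp
  show "0 \<le> x \<bullet> x" by transfer simp
  show "x \<bullet> x = 0 \<longleftrightarrow> x = 0" by transfer simp
  show "norm x = sqrt (x \<bullet> x)" by transfer (rule norm_eq_sqrt_inner)
qed

end

instantiation conj :: (chilbert_space) chilbert_space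
begin

lift_definition scaleC_conj :: "complex \<Rightarrow> 'a conj \<Rightarrow> 'a conj" is "\<lambda>c x. cnj c *\<^sub>C x" .
lift_definition cinner_conj :: "'a conj \<Rightarrow> 'a conj \<Rightarrow> complex" is "\<lambda>x y. cinner y x" .

instance
proof
  fix x y z :: "'a conj" and c d :: complex and r :: real
  show "c *\<^sub>C (x + y) = c *\<^sub>C x + c *\<^sub>C y" by transfer (rule scaleC_add_right)
  show "(c + d) *\<^sub>C x = c *\<^sub>C x + d *\<^sub>C x" by transfer (simp add: scaleC_add_left)
  show "c *\<^sub>C d *\<^sub>C x = (c * d) *\<^sub>C x" by transfer (simp add: scaleC_scaleC)
  show "r *\<^sub>R x = complex_of_real r *\<^sub>C x" by transfer (simp add: scaleR_scaleC)
  show "cinner x y = cnj (cinner y x)" by transfer (rule cinner_commute)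
  show "cinner x (y + z) = cinner x y + cinner x z" by transfer (rule cinner_add_left)
  show "cinner x (c *\<^sub>C y) = c * cinner x y" by transfer (simp add: cinner_scaleC_left)
  show "x \<bullet> y = Re (cinner x y)" by transfer (simp add: inner_eq_Re_cinner[symmetric] inner_commute)
next
  fix X :: "nat \<Rightarrow> 'a conj"
  assume "Cauchy X"
  then have "Cauchy (\<lambda>n. unconj (X n))"
    unfolding Cauchy_def by transfer
  then obtain l where "(\<lambda>n. unconj (X n)) \<longlonglongrightarrow> l"
    using Cauchy_convergent convergent_def by blast
  then have "(\<lambda>n. dist (X n) (conj l)) \<longlonglongrightarrow> 0"
    using tendsto_dist_iff[of "\<lambda>n. unconj (X n)" l sequentially]
    by (simp only: dist_conj.rep_eq conj_inverse[OF UNIV_I])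
  then show "convergent X"
    using tendsto_dist_iff[of X "conj l" sequentially] unfolding convergent_def by blast
qed

end

subsection \<open>Orthonormal bases\<close>

definition orthonormal :: "'a::chilbert_space set \<Rightarrow> bool"
  where "orthonormal E \<longleftrightarrow> (\<forall>e\<in>E. \<forall>f\<in>E. cinner e f = (if e = f then 1 else 0))"

definition onb :: "'a::chilbert_space set"
  where "onb = (SOME E. orthonormal E \<and> (\<forall>x. (\<forall>e\<in>E. cinner e x = 0) \<longrightarrow> x = 0))"

lemma onb: "orthonormal (onb :: 'a::chilbert_space set)"
  and onb_total: "(\<And>e. e \<in> onb \<Longrightarrow> cinner e x = 0) \<Longrightarrow> x = (0 :: 'a::chilbert_space)"
proof -
  let ?\<A> = "{E :: 'a set. orthonormal E}"
  have "\<exists>E\<in>?\<A>. \<forall>F\<in>?\<A>. E \<subseteq> F \<longrightarrow> F = E"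
  proof (rule subset_Zorn')
    fix \<C> assume "subset.chain ?\<A> \<C>"
    then have *: "\<And>E. E \<in> \<C> \<Longrightarrow> orthonormal E" "\<And>E F. E \<in> \<C> \<Longrightarrow> F \<in> \<C> \<Longrightarrow> E \<subseteq> F \<or> F \<subseteq> E"
      unfolding subset.chain_def by auto
    have "cinner e f = (if e = f then 1 else 0)" if "e \<in> E" "E \<in> \<C>" "f \<in> F" "F \<in> \<C>" for e f E F
      using *(2)[OF that(2,4)] *(1)[OF that(2)] *(1)[OF that(4)] that
      unfolding orthonormal_def by blast
    then show "\<Union>\<C> \<in> ?\<A>"
      unfolding orthonormal_def mem_Collect_eq by blast
  qed
  then obtain E :: "'a set" where E: "orthonormal E"
    and max: "\<And>F. orthonormal F \<Longrightarrow> E \<subseteq> F \<Longrightarrow> F = E"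
    by blast
  have total: "x = 0" if x: "\<forall>e\<in>E. cinner e x = 0" for x
  proof (rule ccontr)
    assume "x \<noteq> 0"
    define y where "y = complex_of_real (inverse (norm x)) *\<^sub>C x"
    have norm_y: "norm y = 1"
      using \<open>x \<noteq> 0\<close> by (simp add: y_def norm_scaleC norm_inverse)
    have y: "cinner e y = 0" "cinner y e = 0" if "e \<in> E" for e
      using x that cinner_commute[of y e] by (simp_all add: y_def cinner_scaleC_right)
    have yy: "cinner y y = 1" using norm_y by (simp add: cinner_self)
    then have "y \<notin> E" using y(1)[of y] by auto
    then have "orthonormal (insert y E)"
      using E yy y unfolding orthonormal_def by (metis insertE)
    then show False using max \<open>y \<notin> E\<close> by blast
  qed
  have "orthonormal (onb :: 'a set) \<and> (\<forall>x::'a. (\<forall>e\<in>onb. cinner e x = 0) \<longrightarrow> x = 0)"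
    unfolding onb_def by (rule someI[of _ E]) (use E total in blast)
  then show "orthonormal (onb :: 'a set)" "(\<And>e. e \<in> onb \<Longrightarrow> cinner e x = 0) \<Longrightarrow> x = 0"
    by auto
qed

lemma norm_sum_orthonormal:
  assumes "finite F" "F \<subseteq> (onb :: 'a::chilbert_space set)"
  shows "(norm (\<Sum>e\<in>F. c e *\<^sub>C e))\<^sup>2 = (\<Sum>e\<in>F. (cmod (c e))\<^sup>2)"
proof -
  let ?v = "\<Sum>e\<in>F. c e *\<^sub>C e"
  have coord: "cinner e ?v = c e" if "e \<in> F" for e
  proof -
    have "cinner e ?v = (\<Sum>f\<in>F. if e = f then c f else 0)"
      unfolding cinner_sum_right cinner_scaleC_right
      using onb[where 'a = 'a] assms that by (intro sum.cong) (auto simp: orthonormal_def subset_iff)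
    then show ?thesis using assms that by simp
  qed
  have "complex_of_real ((norm ?v)\<^sup>2) = (\<Sum>e\<in>F. cnj (c e) * cinner e ?v)"
    unfolding cinner_self[symmetric] cinner_sum_left cinner_scaleC_left ..
  also have "\<dots> = (\<Sum>e\<in>F. complex_of_real ((cmod (c e))\<^sup>2))"
    by (intro sum.cong refl) (simp only: coord complex_norm_square mult_ac)
  finally show ?thesis by (simp only: of_real_sum[symmetric] of_real_eq_iff)
qed

lemma bessel_finite:
  assumes "finite F" "F \<subseteq> (onb :: 'a::chilbert_space set)"
  shows "(norm (x - (\<Sum>e\<in>F. cinner e x *\<^sub>C e)))\<^sup>2 = (norm x)\<^sup>2 - (\<Sum>e\<in>F. (cmod (cinner e x))\<^sup>2)"
proof -
  let ?v = "\<Sum>e\<in>F. cinner e x *\<^sub>C e"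
  have vx: "cinner ?v x = complex_of_real (\<Sum>e\<in>F. (cmod (cinner e x))\<^sup>2)"
    unfolding cinner_sum_left cinner_scaleC_left of_real_sum
    by (intro sum.cong refl) (simp only: complex_norm_square mult_ac)
  have xv: "cinner x ?v = complex_of_real (\<Sum>e\<in>F. (cmod (cinner e x))\<^sup>2)"
    using vx cinner_commute[of x ?v] by simp
  have "complex_of_real ((norm (x - ?v))\<^sup>2) = cinner x x - cinner x ?v - cinner ?v x + cinner ?v ?v"
    unfolding cinner_self[symmetric] cinner_diff_left cinner_diff_right by simp
  also have "\<dots> = complex_of_real ((norm x)\<^sup>2 - (\<Sum>e\<in>F. (cmod (cinner e x))\<^sup>2))"
    unfolding vx xv cinner_self norm_sum_orthonormal[OF assms] by simp
  finally show ?thesis by (simp only: of_real_eq_iff)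
qed

lemma has_sum_onb_norm:
  "((\<lambda>e. (cmod (cinner e x))\<^sup>2) has_sum (norm x)\<^sup>2) (onb :: 'a::chilbert_space set)"
proof -
  let ?c = "\<lambda>e. (cmod (cinner e x))\<^sup>2"
  have le: "sum ?c F \<le> (norm x)\<^sup>2" if "finite F" "F \<subseteq> onb" for F
    using bessel_finite[OF that, of x] zero_le_power2[of "norm (x - (\<Sum>e\<in>F. cinner e x *\<^sub>C e))"] by linarith
  have summ: "?c summable_on onb"
    by (rule nonneg_bdd_above_summable_on) (auto intro!: bdd_aboveI[of _ "(norm x)\<^sup>2"] le)
  define S where "S = infsum ?c onb"
  have S: "(?c has_sum S) onb"
    using summ by (simp add: S_def)
  have le_S: "sum ?c F \<le> S" if "finite F" "F \<subseteq> onb" for F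
    using finite_sum_le_has_sum[OF S that] by simp
  have "\<exists>F. finite F \<and> F \<subseteq> onb \<and> sum ?c F > S - 1 / real (Suc n)" for n
  proof -
    have "\<exists>F. finite F \<and> F \<subseteq> onb \<and> dist (sum ?c F) S \<le> 1 / real (Suc (Suc n))"
      using has_sum_finite_approximation[OF S, of "1 / real (Suc (Suc n))"] by auto
    then obtain F where "finite F" "F \<subseteq> onb" "dist (sum ?c F) S \<le> 1 / real (Suc (Suc n))" by blast
    moreover have "1 / real (Suc (Suc n)) < 1 / real (Suc n)" by (simp add: field_simps)
    ultimately show ?thesis
      by (intro exI[of _ F]) (auto simp: dist_real_def abs_le_iff simp del: of_nat_Suc)
  qed
  then obtain G where G: "\<And>n. finite (G n)" "\<And>n. G n \<subseteq> onb" "\<And>n. sum ?c (G n) > S - 1 / real (Suc n)"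
    by metis
  define F where "F n = (\<Union>i\<le>n. G i)" for n
  have F: "finite (F n)" "F n \<subseteq> onb" for n
    using G by (auto simp: F_def)
  have F_mono: "F m \<subseteq> F n" if "m \<le> n" for m n
    using that by (force simp: F_def)
  have F_big: "sum ?c (F n) > S - 1 / real (Suc n)" for n
  proof -
    have "sum ?c (G n) \<le> sum ?c (F n)"
      by (rule sum_mono2) (use F in \<open>auto simp: F_def\<close>)
    then show ?thesis using G(3)[of n] by linarith
  qed
  define v where "v n = (\<Sum>e\<in>F n. cinner e x *\<^sub>C e)" for n
  have v_diff: "(norm (v n - v m))\<^sup>2 < 1 / real (Suc m)" if "m \<le> n" for m n
  proof -
    have "v n - v m = (\<Sum>e\<in>F n - F m. cinner e x *\<^sub>C e)"
      unfolding v_def using F_mono[OF that] F by (simp add: sum_diff)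
    then have "(norm (v n - v m))\<^sup>2 = sum ?c (F n - F m)"
      using norm_sum_orthonormal[of "F n - F m" "\<lambda>e. cinner e x"] F by auto
    also have "\<dots> = sum ?c (F n) - sum ?c (F m)"
      using F_mono[OF that] F by (simp add: sum_diff)
    also have "\<dots> < 1 / real (Suc m)"
      using le_S[OF F(1)[of n] F(2)[of n]] F_big[of m] by linarith
    finally show ?thesis .
  qed
  have "Cauchy v"
  proof (rule metric_CauchyI)
    fix \<epsilon> :: real assume "\<epsilon> > 0"
    then obtain N where N: "inverse (real (Suc N)) < (\<epsilon> / 2)\<^sup>2"
      using reals_Archimedean[of "(\<epsilon> / 2)\<^sup>2"] by auto
    have "norm (v n - v N) < \<epsilon> / 2" if "n \<ge> N" for n
    proof (rule power2_less_imp_less)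
      show "(norm (v n - v N))\<^sup>2 < (\<epsilon> / 2)\<^sup>2"
        using v_diff[OF that] N by (simp only: inverse_eq_divide)
    qed (use \<open>\<epsilon> > 0\<close> in simp)
    then show "\<exists>N. \<forall>m\<ge>N. \<forall>n\<ge>N. dist (v m) (v n) < \<epsilon>"
      by (intro exI[of _ N] allI impI) (metis dist_norm dist_triangle_half_l)
  qed
  then obtain l where l: "v \<longlonglongrightarrow> l"
    using Cauchy_convergent convergent_def by blast
  have "x - l = 0"
  proof (rule onb_total)
    fix e :: 'a assume e: "e \<in> onb"
    have coord: "cinner e (v n) = (if e \<in> F n then cinner e x else 0)" for n
    proof -
      have "cinner e (v n) = (\<Sum>f\<in>F n. if e = f then cinner e x else 0)"
        unfolding v_def cinner_sum_right cinner_scaleC_right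
        using onb[where 'a = 'a] F e by (intro sum.cong) (auto simp: orthonormal_def subset_iff)
      then show ?thesis using F by simp
    qed
    have "cinner e x = 0" if "\<And>n. e \<notin> F n"
    proof -
      have "?c e < 1 / real (Suc n)" for n
        using le_S[of "insert e (F n)"] F e that[of n] F_big[of n] by simp
      then have "?c e \<le> 0"
        using LIMSEQ_le_const[OF LIMSEQ_inverse_real_of_nat, of "?c e"]
        by (auto simp: inverse_eq_divide intro: less_imp_le)
      then show ?thesis by simp
    qed
    then have "\<exists>N. \<forall>n\<ge>N. cinner e (v n) = cinner e x"
      unfolding coord using F_mono by (metis subset_iff)
    then have "(\<lambda>n. cinner e (v n)) \<longlonglongrightarrow> cinner e x"
      by (intro tendsto_eventually) (simp add: eventually_sequentially)
    moreover have "(\<lambda>n. cinner e (v n)) \<longlonglongrightarrow> cinner e l"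
      by (intro bounded_bilinear.tendsto[OF bounded_bilinear_cinner] tendsto_const l)
    ultimately show "cinner e (x - l) = 0"
      using LIMSEQ_unique by (simp add: cinner_diff_right) blast
  qed
  then have "(\<lambda>n. (norm (v n))\<^sup>2) \<longlonglongrightarrow> (norm x)\<^sup>2"
    using l by (intro tendsto_intros) simp
  moreover have "(\<lambda>n. (norm (v n))\<^sup>2) \<longlonglongrightarrow> S"
  proof (rule real_tendsto_sandwich)
    have eq: "(norm (v n))\<^sup>2 = sum ?c (F n)" for n
      unfolding v_def using norm_sum_orthonormal[of "F n" "\<lambda>e. cinner e x"] F by simp
    show "\<forall>\<^sub>F n in sequentially. S - 1 / real (Suc n) \<le> (norm (v n))\<^sup>2"
      using F_big by (simp only: eq) (auto intro: always_eventually less_imp_le)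
    show "\<forall>\<^sub>F n in sequentially. (norm (v n))\<^sup>2 \<le> S"
      using le_S[OF F] by (simp add: eq)
    show "(\<lambda>n. S - 1 / real (Suc n)) \<longlonglongrightarrow> S"
      using tendsto_diff[OF tendsto_const LIMSEQ_inverse_real_of_nat, of S]
      by (simp add: inverse_eq_divide)
  qed simp
  ultimately show ?thesis
    using S LIMSEQ_unique by metis
qed

lemma has_sum_minus:
  fixes f g :: "'c \<Rightarrow> complex"
  assumes "(f has_sum a) A" "(g has_sum b) A"
  shows "((\<lambda>x. f x - g x) has_sum (a - b)) A"
  using has_sum_add[of f A a "\<lambda>x. - g x" "- b"] assms by (simp add: has_sum_uminus)

lemma has_sum_times:
  fixes f :: "'c \<Rightarrow> complex" and g :: "'d \<Rightarrow> complex"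
  assumes "(f has_sum a) A" "(g has_sum b) B"
  shows "((\<lambda>p. f (fst p) * g (snd p)) has_sum a * b) (A \<times> B)"
proof (rule has_sum_SigmaI)
  show "((\<lambda>y. f (fst (x, y)) * g (snd (x, y))) has_sum f x * b) B" for x
    using has_sum_cmult_right[OF assms(2)] by simp
  show "((\<lambda>x. f x * b) has_sum a * b) A"
    using has_sum_cmult_left[OF assms(1)] by simp
  have "(\<lambda>x. norm (f x)) summable_on A" "(\<lambda>x. norm (g x)) summable_on B"
    using assms summable_on_iff_abs_summable_on_complex summable_on_def by blast+
  then have "(\<lambda>p. norm (f (fst p) * g (snd p))) summable_on A \<times> B"
    unfolding Infinite_Sum.abs_summable_on_Sigma_iff
    using summable_on_cmult_left[of "\<lambda>x. norm (f x)" A "\<Sum>\<^sub>\<infinity>y\<in>B. norm (g y)"]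
      summable_on_cmult_right[of "\<lambda>y. norm (g y)" B]
    by (simp add: norm_mult infsum_cmult_right' abs_mult infsum_nonneg)
  then show "(\<lambda>p. f (fst p) * g (snd p)) summable_on A \<times> B"
    by (rule abs_summable_summable)
qed

lemma has_sum_onb:
  "((\<lambda>e. cnj (cinner e x) * cinner e y) has_sum cinner x y) (onb :: 'a::chilbert_space set)"
proof -
  have polar: "cnj a * b = complex_of_real ((cmod (a + b))\<^sup>2 - (cmod (a - b))\<^sup>2) / 4
      - \<i> * complex_of_real ((cmod (a + \<i> * b))\<^sup>2 - (cmod (a - \<i> * b))\<^sup>2) / 4" for a b
    unfolding of_real_diff complex_norm_square by (simp add: field_simps)
  have cpolar: "cinner x y = complex_of_real ((norm (x + y))\<^sup>2 - (norm (x - y))\<^sup>2) / 4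
      - \<i> * complex_of_real ((norm (x + \<i> *\<^sub>C y))\<^sup>2 - (norm (x - \<i> *\<^sub>C y))\<^sup>2) / 4"
    unfolding of_real_diff cinner_self[symmetric]
    by (simp add: cinner_add_left cinner_add_right cinner_diff_left cinner_diff_right
        cinner_scaleC_left cinner_scaleC_right field_simps)
  have *: "((\<lambda>e. complex_of_real ((cmod (cinner e z))\<^sup>2 - (cmod (cinner e w))\<^sup>2))
      has_sum complex_of_real ((norm z)\<^sup>2 - (norm w)\<^sup>2)) onb" for z w :: 'a
    unfolding of_real_diff
    using has_sum_onb_norm[of z] has_sum_onb_norm[of w]
    by (intro has_sum_minus has_sum_of_real)
  have "((\<lambda>e. complex_of_real ((cmod (cinner e (x + y)))\<^sup>2 - (cmod (cinner e (x - y)))\<^sup>2) * (1 / 4)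
      - complex_of_real ((cmod (cinner e (x + \<i> *\<^sub>C y)))\<^sup>2 - (cmod (cinner e (x - \<i> *\<^sub>C y)))\<^sup>2) * (\<i> / 4))
     has_sum (complex_of_real ((norm (x + y))\<^sup>2 - (norm (x - y))\<^sup>2) * (1 / 4)
      - complex_of_real ((norm (x + \<i> *\<^sub>C y))\<^sup>2 - (norm (x - \<i> *\<^sub>C y))\<^sup>2) * (\<i> / 4))) onb"
    by (intro has_sum_minus has_sum_cmult_left *)
  moreover have "complex_of_real ((norm (x + y))\<^sup>2 - (norm (x - y))\<^sup>2) * (1 / 4)
      - complex_of_real ((norm (x + \<i> *\<^sub>C y))\<^sup>2 - (norm (x - \<i> *\<^sub>C y))\<^sup>2) * (\<i> / 4) = cinner x y"
    by (subst cpolar) simp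
  moreover have "complex_of_real ((cmod (cinner e (x + y)))\<^sup>2 - (cmod (cinner e (x - y)))\<^sup>2) * (1 / 4)
      - complex_of_real ((cmod (cinner e (x + \<i> *\<^sub>C y)))\<^sup>2 - (cmod (cinner e (x - \<i> *\<^sub>C y)))\<^sup>2) * (\<i> / 4)
      = cnj (cinner e x) * cinner e y" for e
    unfolding cinner_add_right cinner_diff_right cinner_scaleC_right by (subst polar) simp
  ultimately show ?thesis by simp
qed

subsection \<open>Tensor products of Hilbert spaces\<close>

text \<open>
  The Hilbert tensor product is realised on square-summable coefficient families with respect to
  chosen orthonormal bases of the factors.  The lemmas \<open>cinner_tens\<close> and \<open>closure_span_tens\<close>
  below are its characteristic properties, and determine it up to a unique unitary that is compatible
  with elementary tensors.
\<close>

typedef (overloaded) ('a, 'b) tensor =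
  "{f :: 'a::chilbert_space \<times> 'b::chilbert_space \<Rightarrow> complex.
     (\<forall>p. p \<notin> onb \<times> onb \<longrightarrow> f p = 0) \<and> (\<lambda>p. (cmod (f p))\<^sup>2) summable_on UNIV}"
  morphisms coords tensor
  by (rule exI[of _ "\<lambda>_. 0"]) simp

setup_lifting type_definition_tensor

lemma l2_mult_summable:
  fixes f g :: "'c \<Rightarrow> complex"
  assumes "(\<lambda>p. (cmod (f p))\<^sup>2) summable_on UNIV" "(\<lambda>p. (cmod (g p))\<^sup>2) summable_on UNIV"
  shows "(\<lambda>p. cnj (f p) * g p) summable_on UNIV"
proof (rule abs_summable_summable, rule summable_on_comparison_test)
  show "(\<lambda>p. (cmod (f p))\<^sup>2 + (cmod (g p))\<^sup>2) summable_on UNIV"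
    using assms by (rule summable_on_add)
  fix p
  have "2 * (cmod (f p) * cmod (g p)) \<le> (cmod (f p))\<^sup>2 + (cmod (g p))\<^sup>2"
    using sum_squares_bound[of "cmod (f p)" "cmod (g p)"] by simp
  then show "cmod (cnj (f p) * g p) \<le> (cmod (f p))\<^sup>2 + (cmod (g p))\<^sup>2"
    using zero_le_mult_iff[of "cmod (f p)" "cmod (g p)"]
    unfolding norm_mult complex_mod_cnj by (smt (verit) norm_ge_zero)
qed simp

lemma l2_add_summable:
  fixes f g :: "'c \<Rightarrow> complex"
  assumes "(\<lambda>p. (cmod (f p))\<^sup>2) summable_on UNIV" "(\<lambda>p. (cmod (g p))\<^sup>2) summable_on UNIV"
  shows "(\<lambda>p. (cmod (f p + g p))\<^sup>2) summable_on UNIV"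
proof (rule summable_on_comparison_test)
  show "(\<lambda>p. 2 * (cmod (f p))\<^sup>2 + 2 * (cmod (g p))\<^sup>2) summable_on UNIV"
    using assms by (intro summable_on_add summable_on_cmult_right)
  fix p
  have "(cmod (f p + g p))\<^sup>2 \<le> (cmod (f p) + cmod (g p))\<^sup>2"
    by (intro power_mono norm_triangle_ineq) simp
  also have "\<dots> \<le> 2 * (cmod (f p))\<^sup>2 + 2 * (cmod (g p))\<^sup>2"
    using sum_squares_bound[of "cmod (f p)" "cmod (g p)"] by (simp add: power2_sum)
  finally show "(cmod (f p + g p))\<^sup>2 \<le> 2 * (cmod (f p))\<^sup>2 + 2 * (cmod (g p))\<^sup>2" .
qed simp

lemma l2_scale_summable:
  fixes f :: "'c \<Rightarrow> complex"
  assumes "(\<lambda>p. (cmod (f p))\<^sup>2) summable_on UNIV"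
  shows "(\<lambda>p. (cmod (c * f p))\<^sup>2) summable_on UNIV"
  using summable_on_cmult_right[OF assms, of "(cmod c)\<^sup>2"] by (simp only: norm_mult power_mult_distrib)

lemma coords_summable: "(\<lambda>p. (cmod (coords x p))\<^sup>2) summable_on UNIV"
  using coords[of x] by simp

lemma coords_mult_summable: "(\<lambda>p. cnj (coords x p) * coords y p) summable_on UNIV"
  by (intro l2_mult_summable coords_summable)

instantiation tensor :: (chilbert_space, chilbert_space) real_inner
begin

lift_definition zero_tensor :: "('a, 'b) tensor" is "\<lambda>_. 0" by simp
lift_definition plus_tensor :: "('a, 'b) tensor \<Rightarrow> ('a, 'b) tensor \<Rightarrow> ('a, 'b) tensor"
  is "\<lambda>f g p. f p + g p" by (simp add: l2_add_summable)
lift_definition uminus_tensor :: "('a, 'b) tensor \<Rightarrow> ('a, 'b) tensor"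
  is "\<lambda>f p. - f p" by simp
lift_definition minus_tensor :: "('a, 'b) tensor \<Rightarrow> ('a, 'b) tensor \<Rightarrow> ('a, 'b) tensor"
  is "\<lambda>f g p. f p - g p"
  subgoal for f g using l2_add_summable[of f "\<lambda>p. - g p"] by simp
  done
lift_definition scaleR_tensor :: "real \<Rightarrow> ('a, 'b) tensor \<Rightarrow> ('a, 'b) tensor"
  is "\<lambda>r f p. complex_of_real r * f p" by (simp add: l2_scale_summable)

definition inner_tensor :: "('a, 'b) tensor \<Rightarrow> ('a, 'b) tensor \<Rightarrow> real"
  where "inner_tensor x y = Re (\<Sum>\<^sub>\<infinity>p. cnj (coords x p) * coords y p)"
definition norm_tensor :: "('a, 'b) tensor \<Rightarrow> real"
  where "norm_tensor x = sqrt (x \<bullet> x)"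
definition sgn_tensor :: "('a, 'b) tensor \<Rightarrow> ('a, 'b) tensor"
  where "sgn_tensor x = inverse (norm x) *\<^sub>R x"
definition dist_tensor :: "('a, 'b) tensor \<Rightarrow> ('a, 'b) tensor \<Rightarrow> real"
  where "dist_tensor x y = norm (x - y)"
definition uniformity_tensor :: "(('a, 'b) tensor \<times> ('a, 'b) tensor) filter"
  where "uniformity_tensor = (INF e\<in>{0<..}. principal {(x, y). dist x y < e})"
definition open_tensor :: "('a, 'b) tensor set \<Rightarrow> bool"
  where "open_tensor U \<longleftrightarrow> (\<forall>x\<in>U. \<forall>\<^sub>F (x', y) in uniformity. x' = x \<longrightarrow> y \<in> U)"

lemma inner_tensor_self: "x \<bullet> x = (\<Sum>\<^sub>\<infinity>p. (cmod (coords x p))\<^sup>2)" for x :: "('a, 'b) tensor"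
proof -
  have "x \<bullet> x = (\<Sum>\<^sub>\<infinity>p. Re (cnj (coords x p) * coords x p))"
    unfolding inner_tensor_def by (rule infsum_Re[symmetric]) (rule coords_mult_summable)
  moreover have "Re (cnj (coords x p) * coords x p) = (cmod (coords x p))\<^sup>2" for p
    by (metis Re_complex_of_real complex_norm_square mult.commute)
  ultimately show ?thesis by simp
qed

instance
proof
  show "uniformity = (INF e\<in>{0<..}. principal {(x::('a, 'b) tensor, y). dist x y < e})"
    by (fact uniformity_tensor_def)
  show "open U \<longleftrightarrow> (\<forall>x\<in>U. \<forall>\<^sub>F (x', y) in uniformity. x' = x \<longrightarrow> y \<in> U)"
    for U :: "('a, 'b) tensor set"
    by (fact open_tensor_def)
  fix x y z :: "('a, 'b) tensor" and r s :: real
  show "x + y + z = x + (y + z)" "x + y = y + x" "0 + x = x" "- x + x = 0" "x - y = x + - y"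
    by (transfer; simp add: fun_eq_iff)+
  show "r *\<^sub>R (x + y) = r *\<^sub>R x + r *\<^sub>R y" "(r + s) *\<^sub>R x = r *\<^sub>R x + s *\<^sub>R x"
    "r *\<^sub>R s *\<^sub>R x = (r * s) *\<^sub>R x" "1 *\<^sub>R x = x"
    by (transfer; simp add: fun_eq_iff algebra_simps)+
  show "dist x y = norm (x - y)" by (rule dist_tensor_def)
  show "sgn x = inverse (norm x) *\<^sub>R x" by (rule sgn_tensor_def)
  show "norm x = sqrt (x \<bullet> x)" by (rule norm_tensor_def)
  show "x \<bullet> y = y \<bullet> x"
  proof -
    have "(\<Sum>\<^sub>\<infinity>p. cnj (coords x p) * coords y p) = cnj (\<Sum>\<^sub>\<infinity>p. cnj (coords y p) * coords x p)"
      unfolding infsum_cnj[symmetric] by (simp add: mult.commute)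
    then show ?thesis by (simp add: inner_tensor_def)
  qed
  show "(x + y) \<bullet> z = x \<bullet> z + y \<bullet> z"
    unfolding inner_tensor_def plus_tensor.rep_eq
    by (simp add: distrib_right infsum_add coords_mult_summable)
  show "r *\<^sub>R x \<bullet> y = r * (x \<bullet> y)"
    unfolding inner_tensor_def scaleR_tensor.rep_eq
    by (simp add: mult.assoc infsum_cmult_right coords_mult_summable)
  show "0 \<le> x \<bullet> x"
    unfolding inner_tensor_self by (rule infsum_nonneg) simp
  show "x \<bullet> x = 0 \<longleftrightarrow> x = 0"
  proof
    assume "x \<bullet> x = 0"
    then have "(cmod (coords x p))\<^sup>2 = 0" for p
      unfolding inner_tensor_self by (intro nonneg_infsum_le_0D[OF _ coords_summable]) auto
    then show "x = 0"
      by (simp add: coords_inject[symmetric] zero_tensor.rep_eq fun_eq_iff)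
  qed (simp add: inner_tensor_self zero_tensor.rep_eq)
qed

end

lemma norm_tensor_power2: "(norm x)\<^sup>2 = (\<Sum>\<^sub>\<infinity>p. (cmod (coords x p))\<^sup>2)"
  unfolding norm_eq_sqrt_inner inner_tensor_self by (simp add: infsum_nonneg)

lemma sum_coords_le: "finite F \<Longrightarrow> (\<Sum>p\<in>F. (cmod (coords x p))\<^sup>2) \<le> (norm x)\<^sup>2"
  unfolding norm_tensor_power2 by (intro finite_sum_le_infsum coords_summable) auto

lemma coords_le: "cmod (coords x p) \<le> norm x"
  by (rule power2_le_imp_le) (use sum_coords_le[of "{p}" x] in simp_all)

instantiation tensor :: (chilbert_space, chilbert_space) chilbert_space
begin

lift_definition scaleC_tensor :: "complex \<Rightarrow> ('a, 'b) tensor \<Rightarrow> ('a, 'b) tensor"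
  is "\<lambda>c f p. c * f p" by (simp add: l2_scale_summable)

definition cinner_tensor :: "('a, 'b) tensor \<Rightarrow> ('a, 'b) tensor \<Rightarrow> complex"
  where "cinner_tensor x y = (\<Sum>\<^sub>\<infinity>p. cnj (coords x p) * coords y p)"

instance
proof
  fix x y z :: "('a, 'b) tensor" and c d :: complex and r :: real
  show "c *\<^sub>C (x + y) = c *\<^sub>C x + c *\<^sub>C y" "(c + d) *\<^sub>C x = c *\<^sub>C x + d *\<^sub>C x"
    "c *\<^sub>C d *\<^sub>C x = (c * d) *\<^sub>C x" "r *\<^sub>R x = complex_of_real r *\<^sub>C x"
    by (transfer; simp add: fun_eq_iff algebra_simps)+
  show "cinner x y = cnj (cinner y x)"
    unfolding cinner_tensor_def infsum_cnj[symmetric] by (simp add: mult.commute)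
  show "cinner x (y + z) = cinner x y + cinner x z"
    unfolding cinner_tensor_def plus_tensor.rep_eq
    by (simp add: distrib_left infsum_add coords_mult_summable)
  show "cinner x (c *\<^sub>C y) = c * cinner x y"
    unfolding cinner_tensor_def scaleC_tensor.rep_eq
    by (simp add: mult.left_commute infsum_cmult_right coords_mult_summable)
  show "x \<bullet> y = Re (cinner x y)"
    by (simp add: inner_tensor_def cinner_tensor_def)
next
  fix X :: "nat \<Rightarrow> ('a, 'b) tensor"
  assume "Cauchy X"
  have "\<exists>l. (\<lambda>n. coords (X n) p) \<longlonglongrightarrow> l" for p
  proof -
    have "Cauchy (\<lambda>n. coords (X n) p)"
    proof (rule metric_CauchyI)
      fix \<epsilon> :: real assume "\<epsilon> > 0"
      then obtain N where N: "\<And>m n. m \<ge> N \<Longrightarrow> n \<ge> N \<Longrightarrow> dist (X m) (X n) < \<epsilon>"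
        using metric_CauchyD[OF \<open>Cauchy X\<close>] by blast
      have "dist (coords (X m) p) (coords (X n) p) < \<epsilon>" if "m \<ge> N" "n \<ge> N" for m n
        using N[OF that] coords_le[of "X m - X n" p] by (simp add: dist_norm minus_tensor.rep_eq)
      then show "\<exists>N. \<forall>m\<ge>N. \<forall>n\<ge>N. dist (coords (X m) p) (coords (X n) p) < \<epsilon>" by blast
    qed
    then show ?thesis using Cauchy_convergent convergent_def by blast
  qed
  then obtain l where l: "\<And>p. (\<lambda>n. coords (X n) p) \<longlonglongrightarrow> l p" by metis
  have close: "\<exists>N. \<forall>n\<ge>N. \<forall>F. finite F \<longrightarrow> (\<Sum>p\<in>F. (cmod (l p - coords (X n) p))\<^sup>2) \<le> \<epsilon>\<^sup>2"
    if "\<epsilon> > 0" for \<epsilon> :: real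
  proof -
    obtain N where N: "\<And>m n. m \<ge> N \<Longrightarrow> n \<ge> N \<Longrightarrow> dist (X m) (X n) < \<epsilon>"
      using metric_CauchyD[OF \<open>Cauchy X\<close> \<open>\<epsilon> > 0\<close>] by blast
    have "(\<Sum>p\<in>F. (cmod (l p - coords (X n) p))\<^sup>2) \<le> \<epsilon>\<^sup>2" if "n \<ge> N" "finite F" for n F
    proof (rule LIMSEQ_le_const2)
      show "(\<lambda>m. \<Sum>p\<in>F. (cmod (coords (X m) p - coords (X n) p))\<^sup>2)
          \<longlonglongrightarrow> (\<Sum>p\<in>F. (cmod (l p - coords (X n) p))\<^sup>2)"
        by (intro tendsto_intros l)
      show "\<exists>M. \<forall>m\<ge>M. (\<Sum>p\<in>F. (cmod (coords (X m) p - coords (X n) p))\<^sup>2) \<le> \<epsilon>\<^sup>2"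
      proof (intro exI[of _ N] allI impI)
        fix m assume "m \<ge> N"
        have "(\<Sum>p\<in>F. (cmod (coords (X m) p - coords (X n) p))\<^sup>2) \<le> (norm (X m - X n))\<^sup>2"
          using sum_coords_le[OF \<open>finite F\<close>, of "X m - X n"] by (simp add: minus_tensor.rep_eq)
        also have "\<dots> \<le> \<epsilon>\<^sup>2"
          using N[OF \<open>m \<ge> N\<close> \<open>n \<ge> N\<close>] by (intro power_mono) (auto simp: dist_norm)
        finally show "(\<Sum>p\<in>F. (cmod (coords (X m) p - coords (X n) p))\<^sup>2) \<le> \<epsilon>\<^sup>2" .
      qed
    qed
    then show ?thesis by blast
  qed
  have summ: "(\<lambda>p. (cmod (l p - coords (X n) p))\<^sup>2) summable_on UNIV"
    if "\<forall>F. finite F \<longrightarrow> (\<Sum>p\<in>F. (cmod (l p - coords (X n) p))\<^sup>2) \<le> K" for n K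
    using that by (intro nonneg_bdd_above_summable_on bdd_aboveI[of _ K]) auto
  obtain N where "\<forall>F. finite F \<longrightarrow> (\<Sum>p\<in>F. (cmod (l p - coords (X N) p))\<^sup>2) \<le> 1\<^sup>2"
    using close[of 1] by auto
  then have "(\<lambda>p. (cmod (l p))\<^sup>2) summable_on UNIV"
    using l2_add_summable[OF summ[of N "1\<^sup>2"] coords_summable[of "X N"]] by simp
  moreover have "l p = 0" if "p \<notin> onb \<times> onb" for p
  proof -
    have "coords (X n) p = 0" for n using coords[of "X n"] that by blast
    then show ?thesis using l[of p] by (simp add: LIMSEQ_const_iff)
  qed
  ultimately have coords_l: "coords (tensor l) = l"
    by (intro tensor_inverse) auto
  have "X \<longlonglongrightarrow> tensor l"
  proof (rule metric_LIMSEQ_I)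
    fix \<epsilon> :: real assume "\<epsilon> > 0"
    then obtain N where N: "\<And>n F. n \<ge> N \<Longrightarrow> finite F \<Longrightarrow> (\<Sum>p\<in>F. (cmod (l p - coords (X n) p))\<^sup>2) \<le> (\<epsilon> / 2)\<^sup>2"
      using close[of "\<epsilon> / 2"] by auto
    have "dist (X n) (tensor l) < \<epsilon>" if "n \<ge> N" for n
    proof -
      have "(norm (tensor l - X n))\<^sup>2 \<le> (\<epsilon> / 2)\<^sup>2"
        unfolding norm_tensor_power2
        using coords_summable[of "tensor l - X n"] N[OF that]
        by (intro infsum_le_finite_sums) (auto simp: minus_tensor.rep_eq coords_l)
      then have "norm (tensor l - X n) \<le> \<epsilon> / 2"
        by (rule power2_le_imp_le) (use \<open>\<epsilon> > 0\<close> in simp)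
      then show ?thesis using \<open>\<epsilon> > 0\<close> by (simp add: dist_norm norm_minus_commute)
    qed
    then show "\<exists>N. \<forall>n\<ge>N. dist (X n) (tensor l) < \<epsilon>" by blast
  qed
  then show "convergent X" by (auto simp: convergent_def)
qed

end

lift_definition tens :: "'a::chilbert_space \<Rightarrow> 'b::chilbert_space \<Rightarrow> ('a, 'b) tensor" (infixr "\<otimes>" 72)
  is "\<lambda>x y p. if p \<in> onb \<times> onb then cinner (fst p) x * cinner (snd p) y else 0"
proof (intro CollectI conjI)
  fix x :: 'a and y :: 'b
  have "((\<lambda>p. (cnj (cinner (fst p) x) * cinner (fst p) x) * (cnj (cinner (snd p) y) * cinner (snd p) y))
      has_sum cinner x x * cinner y y) (onb \<times> onb)"
    by (rule has_sum_times[OF has_sum_onb has_sum_onb])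
  then have "((\<lambda>p. Re ((cnj (cinner (fst p) x) * cinner (fst p) x) * (cnj (cinner (snd p) y) * cinner (snd p) y)))
      has_sum Re (cinner x x * cinner y y)) (onb \<times> onb)"
    by (rule has_sum_Re)
  moreover have "Re ((cnj a * a) * (cnj b * b)) = (cmod (a * b))\<^sup>2" for a b
  proof -
    have "(cnj a * a) * (cnj b * b) = complex_of_real ((cmod (a * b))\<^sup>2)"
      unfolding complex_norm_square by simp
    then show ?thesis by (simp only: Re_complex_of_real)
  qed
  ultimately have "((\<lambda>p. (cmod (if p \<in> onb \<times> onb then cinner (fst p) x * cinner (snd p) y else 0))\<^sup>2)
      has_sum Re (cinner x x * cinner y y)) UNIV"
    by (subst has_sum_cong_neutral[where T = "onb \<times> onb"]) auto
  then show "(\<lambda>p. (cmod (if p \<in> onb \<times> onb then cinner (fst p) x * cinner (snd p) y else 0))\<^sup>2) summable_on UNIV"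
    by (rule has_sum_imp_summable)
qed auto

lemma cinner_tens: "cinner (x \<otimes> y) (z \<otimes> u) = cinner x z * cinner y u"
proof -
  have "((\<lambda>p. (cnj (cinner (fst p) x) * cinner (fst p) z) * (cnj (cinner (snd p) y) * cinner (snd p) u))
      has_sum cinner x z * cinner y u) (onb \<times> onb)"
    by (rule has_sum_times[OF has_sum_onb has_sum_onb])
  then have "((\<lambda>p. cnj (coords (x \<otimes> y) p) * coords (z \<otimes> u) p) has_sum cinner x z * cinner y u) UNIV"
    by (subst has_sum_cong_neutral[where T = "onb \<times> onb"]) (auto simp: tens.rep_eq mult_ac)
  then show ?thesis
    unfolding cinner_tensor_def by (rule infsumI)
qed

lemma tens_add_left: "(x + y) \<otimes> z = x \<otimes> z + y \<otimes> z"
  by transfer (auto simp: fun_eq_iff cinner_add_right distrib_right)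

lemma tens_add_right: "x \<otimes> (y + z) = x \<otimes> y + x \<otimes> z"
  by transfer (auto simp: fun_eq_iff cinner_add_right distrib_left)

lemma tens_scaleC_left: "(c *\<^sub>C x) \<otimes> y = c *\<^sub>C (x \<otimes> y)"
  by transfer (auto simp: fun_eq_iff cinner_scaleC_right)

lemma tens_scaleC_right: "x \<otimes> (c *\<^sub>C y) = c *\<^sub>C (x \<otimes> y)"
  by transfer (auto simp: fun_eq_iff cinner_scaleC_right)

lemma coords_sum: "finite F \<Longrightarrow> coords (\<Sum>i\<in>F. f i) p = (\<Sum>i\<in>F. coords (f i) p)"
  by (induction F rule: finite_induct) (auto simp: zero_tensor.rep_eq plus_tensor.rep_eq)

lemma closure_span_tens: "closure (span {x \<otimes> y |x y. True}) = (UNIV :: ('a::chilbert_space, 'b::chilbert_space) tensor set)"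
proof (intro set_eqI iffI UNIV_I)
  fix v :: "('a, 'b) tensor"
  show "v \<in> closure (span {x \<otimes> y |x y. True})"
    unfolding closure_approachable
  proof (intro allI impI)
    fix \<epsilon> :: real assume "\<epsilon> > 0"
    have "((\<lambda>p. (cmod (coords v p))\<^sup>2) has_sum (norm v)\<^sup>2) UNIV"
      unfolding norm_tensor_power2 by (rule has_sum_infsum[OF coords_summable])
    from has_sum_finite_approximation[OF this, of "(\<epsilon> / 2)\<^sup>2"] \<open>\<epsilon> > 0\<close>
    obtain F where F: "finite F" "(norm v)\<^sup>2 - (\<Sum>p\<in>F. (cmod (coords v p))\<^sup>2) \<le> (\<epsilon> / 2)\<^sup>2"
      by (auto simp: dist_real_def abs_le_iff)
    define w where "w = (\<Sum>p\<in>F. (coords v p *\<^sub>C fst p) \<otimes> snd p)"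
    have unit: "coords (fst q \<otimes> snd q) p = (if p = q then 1 else 0)"
      if "q \<in> onb \<times> onb" for p q :: "'a \<times> 'b"
      using that onb[where 'a = 'a] onb[where 'a = 'b] unfolding orthonormal_def
      by (cases p; cases q) (auto simp: tens.rep_eq)
    have w: "coords w p = (if p \<in> F then coords v p else 0)" for p
    proof -
      have "coords w p = (\<Sum>q\<in>F. coords v q * coords (fst q \<otimes> snd q) p)"
        by (simp add: w_def coords_sum F(1) tens_scaleC_left scaleC_tensor.rep_eq)
      also have "\<dots> = (\<Sum>q\<in>F. if p = q then coords v q else 0)"
      proof (intro sum.cong refl)
        fix q
        show "coords v q * coords (fst q \<otimes> snd q) p = (if p = q then coords v q else 0)"
        proof (cases "q \<in> onb \<times> onb")
          case False
          then have "coords v q = 0" using coords[of v] by blast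
          then show ?thesis by simp
        qed (simp add: unit)
      qed
      finally show ?thesis using F(1) by simp
    qed
    have "w \<in> span {x \<otimes> y |x y. True}"
      unfolding w_def by (intro span_sum span_base) blast
    moreover have "dist w v < \<epsilon>"
    proof -
      have "(\<Sum>p\<in>G. (cmod (coords (v - w) p))\<^sup>2) \<le> (\<epsilon> / 2)\<^sup>2" if "finite G" for G
      proof -
        have "(\<Sum>p\<in>G. (cmod (coords (v - w) p))\<^sup>2) = (\<Sum>p\<in>G - F. (cmod (coords v p))\<^sup>2)"
          using that by (intro sum.mono_neutral_cong_right) (auto simp: minus_tensor.rep_eq w)
        also have "\<dots> = (\<Sum>p\<in>G \<union> F. (cmod (coords v p))\<^sup>2) - (\<Sum>p\<in>F. (cmod (coords v p))\<^sup>2)"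
          using that F(1) sum_diff[of "G \<union> F" F "\<lambda>p. (cmod (coords v p))\<^sup>2"] by (simp add: Un_Diff)
        also have "\<dots> \<le> (\<epsilon> / 2)\<^sup>2"
          using sum_coords_le[of "G \<union> F" v] F that by simp
        finally show ?thesis .
      qed
      then have "(norm (v - w))\<^sup>2 \<le> (\<epsilon> / 2)\<^sup>2"
        unfolding norm_tensor_power2 by (intro infsum_le_finite_sums coords_summable) auto
      then have "norm (v - w) \<le> \<epsilon> / 2"
        by (rule power2_le_imp_le) (use \<open>\<epsilon> > 0\<close> in simp)
      then show ?thesis using \<open>\<epsilon> > 0\<close> by (simp add: dist_norm norm_minus_commute)
    qed
    ultimately show "\<exists>w\<in>span {x \<otimes> y |x y. True}. dist w v < \<epsilon>" by blast
  qed
qed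

section \<open>Operators on Hilbert spaces\<close>

text \<open>
  Bounded operators are elements of the library type of bounded real-linear maps, whose norm topology
  restricts to the one of \<open>\<bbbB>(\<H>)\<close>; complex linearity is the predicate \<open>complex_op\<close>.
  The operators specified by definite descriptions below are determined by the stated equations
  since elementary tensors span a dense subspace.
\<close>

definition complex_op :: "('a::chilbert_space \<Rightarrow>\<^sub>L 'b::chilbert_space) \<Rightarrow> bool"
  where "complex_op T \<longleftrightarrow> (\<forall>c x. T (c *\<^sub>C x) = c *\<^sub>C T x)"

definition adj :: "('a::chilbert_space \<Rightarrow>\<^sub>L 'b::chilbert_space) \<Rightarrow> 'b \<Rightarrow>\<^sub>L 'a"
  where "adj T = (THE S :: 'b \<Rightarrow>\<^sub>L 'a. \<forall>x y. cinner (S y) x = cinner y (T x))"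

definition unitary_op :: "('a::chilbert_space \<Rightarrow>\<^sub>L 'b::chilbert_space) \<Rightarrow> bool"
  where "unitary_op U \<longleftrightarrow> complex_op U \<and> adj U o\<^sub>L U = id_blinfun \<and> U o\<^sub>L adj U = id_blinfun"

definition op_tens :: "('a::chilbert_space \<Rightarrow>\<^sub>L 'c::chilbert_space) \<Rightarrow>
    ('b::chilbert_space \<Rightarrow>\<^sub>L 'd::chilbert_space) \<Rightarrow> ('a, 'b) tensor \<Rightarrow>\<^sub>L ('c, 'd) tensor"
    (infixr "\<otimes>\<^sub>o" 72)
  where "S \<otimes>\<^sub>o T = (THE R :: ('a, 'b) tensor \<Rightarrow>\<^sub>L ('c, 'd) tensor. \<forall>x y. R (x \<otimes> y) = S x \<otimes> T y)"

text \<open>The flip \<open>\<Sigma>\<close>.\<close>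

definition flip :: "('a::chilbert_space, 'b::chilbert_space) tensor \<Rightarrow>\<^sub>L ('b, 'a) tensor"
  where "flip = (THE R :: ('a, 'b) tensor \<Rightarrow>\<^sub>L ('b, 'a) tensor. \<forall>x y. R (x \<otimes> y) = y \<otimes> x)"

definition assoc :: "(('a::chilbert_space, 'b::chilbert_space) tensor, 'c::chilbert_space) tensor
    \<Rightarrow>\<^sub>L ('a, ('b, 'c) tensor) tensor"
  where "assoc = (THE R :: (('a, 'b) tensor, 'c) tensor \<Rightarrow>\<^sub>L ('a, ('b, 'c) tensor) tensor.
    \<forall>x y z. R ((x \<otimes> y) \<otimes> z) = x \<otimes> (y \<otimes> z))"

text \<open>Leg numbering on triple tensor products.\<close>

definition leg12 :: "(('a::chilbert_space, 'b::chilbert_space) tensor \<Rightarrow>\<^sub>L ('a, 'b) tensor) \<Rightarrow>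
    ('a, ('b, 'c::chilbert_space) tensor) tensor \<Rightarrow>\<^sub>L ('a, ('b, 'c) tensor) tensor"
  where "leg12 T = assoc o\<^sub>L (T \<otimes>\<^sub>o id_blinfun) o\<^sub>L adj assoc"

definition leg23 :: "(('b::chilbert_space, 'c::chilbert_space) tensor \<Rightarrow>\<^sub>L ('b, 'c) tensor) \<Rightarrow>
    ('a::chilbert_space, ('b, 'c) tensor) tensor \<Rightarrow>\<^sub>L ('a, ('b, 'c) tensor) tensor"
  where "leg23 T = id_blinfun \<otimes>\<^sub>o T"

definition leg13 :: "(('a::chilbert_space, 'c::chilbert_space) tensor \<Rightarrow>\<^sub>L ('a, 'c) tensor) \<Rightarrow>
    ('a, ('b::chilbert_space, 'c) tensor) tensor \<Rightarrow>\<^sub>L ('a, ('b, 'c) tensor) tensor"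
  where "leg13 T = (id_blinfun \<otimes>\<^sub>o flip) o\<^sub>L leg12 T o\<^sub>L (id_blinfun \<otimes>\<^sub>o flip)"

subsection \<open>Unbounded operators\<close>

text \<open>
  An unbounded operator is given by its graph.  A densely defined graph that equals its adjoint
  \<open>{(y, z). \<forall>(x, w)\<in>G. (y | w) = (z | x)}\<close> is automatically single-valued and complex linear, and
  \<open>(x | G x)\<close> is then real.
\<close>

definition positive_selfadjoint :: "('a::chilbert_space \<times> 'a) set \<Rightarrow> bool"
  where "positive_selfadjoint G \<longleftrightarrow>
    closure (Domain G) = UNIV \<and>
    G = {(y, z). \<forall>(x, w)\<in>G. cinner y w = cinner z x} \<and>
    (\<forall>(x, w)\<in>G. 0 \<le> Re (cinner x w))"

definition trivial_kernel :: "('a::chilbert_space \<times> 'a) set \<Rightarrow> bool"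
  where "trivial_kernel G \<longleftrightarrow> (\<forall>x. (x, 0) \<in> G \<longrightarrow> x = 0)"

text \<open>
  The tensor product of self-adjoint operators is the closure of the algebraic tensor product.
  Here and for \<open>alg_tens\<close> below, the real span is already a complex subspace because the factors
  are complex subspaces.
\<close>

definition graph_tens :: "('a::chilbert_space \<times> 'a) set \<Rightarrow> ('b::chilbert_space \<times> 'b) set \<Rightarrow>
    (('a, 'b) tensor \<times> ('a, 'b) tensor) set"
  where "graph_tens G H = closure (span {(x \<otimes> y, x' \<otimes> y') |x x' y y'. (x, x') \<in> G \<and> (y, y') \<in> H})"

section \<open>Modular multiplicative unitaries and quantum groups\<close>

type_synonym 'h op2 = "('h, 'h) tensor \<Rightarrow>\<^sub>L ('h, 'h) tensor"

definition multiplicative_unitary :: "'h::chilbert_space op2 \<Rightarrow> bool"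
  where "multiplicative_unitary W \<longleftrightarrow>
    unitary_op W \<and> leg23 W o\<^sub>L leg12 W = leg12 W o\<^sub>L leg13 W o\<^sub>L leg23 W"

definition modular_multiplicative_unitary :: "'h::chilbert_space op2 \<Rightarrow> bool"
  where "modular_multiplicative_unitary W \<longleftrightarrow> multiplicative_unitary W \<and>
    (\<exists>Q' Q. \<exists>W' :: ('h conj, 'h) tensor \<Rightarrow>\<^sub>L ('h conj, 'h) tensor.
      positive_selfadjoint Q' \<and> trivial_kernel Q' \<and>
      positive_selfadjoint Q \<and> trivial_kernel Q \<and>
      unitary_op W' \<and>
      {(adj W \<xi>, adj W \<eta>) |\<xi> \<eta>. (\<xi>, \<eta>) \<in> graph_tens Q' Q} = graph_tens Q' Q \<and>
      (\<forall>x z y Qy u Qinv_u. (y, Qy) \<in> Q \<longrightarrow> (Qinv_u, u) \<in> Q \<longrightarrow>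
        cinner (x \<otimes> y) (W (z \<otimes> u)) = cinner (conj z \<otimes> Qy) (W' (conj x \<otimes> Qinv_u))))"

text \<open>The predual \<open>\<bbbB>(\<H>)\<^sub>*\<close>.\<close>

definition normal_functional :: "(('a::chilbert_space \<Rightarrow>\<^sub>L 'a) \<Rightarrow> complex) \<Rightarrow> bool"
  where "normal_functional \<omega> \<longleftrightarrow> (\<exists>x y :: nat \<Rightarrow> 'a.
    summable (\<lambda>n. (norm (x n))\<^sup>2) \<and> summable (\<lambda>n. (norm (y n))\<^sup>2) \<and>
    \<omega> = (\<lambda>T. \<Sum>n. cinner (x n) (T (y n))))"

definition tens_right :: "'b::chilbert_space \<Rightarrow> 'a::chilbert_space \<Rightarrow>\<^sub>L ('a, 'b) tensor"
  where "tens_right \<eta> = Blinfun (\<lambda>x. x \<otimes> \<eta>)"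

text \<open>
  \<open>slice \<omega> T\<close> is \<open>(\<omega> \<otimes> id)(T)\<close>; in its definition \<open>adj (tens_right \<xi>) o\<^sub>L T o\<^sub>L tens_right \<eta>\<close> is
  \<open>(id \<otimes> \<omega>')(T)\<close> for the functional \<open>\<omega>'(S) = (\<xi> | S | \<eta>)\<close>.
\<close>

definition slice :: "(('a::chilbert_space \<Rightarrow>\<^sub>L 'a) \<Rightarrow> complex) \<Rightarrow>
    (('a, 'b::chilbert_space) tensor \<Rightarrow>\<^sub>L ('a, 'b) tensor) \<Rightarrow> 'b \<Rightarrow>\<^sub>L 'b"
  where "slice \<omega> T = (THE S :: 'b \<Rightarrow>\<^sub>L 'b.
    \<forall>\<xi> \<eta>. cinner \<xi> (S \<eta>) = \<omega> (adj (tens_right \<xi>) o\<^sub>L T o\<^sub>L tens_right \<eta>))"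

text \<open>
  A quantum group \<open>(C, \<Delta>\<^sub>C)\<close> is represented by its fixed generating modular multiplicative unitary
  \<open>W\<close>: then \<open>C = qg_algebra W\<close> and \<open>\<Delta>\<^sub>C = comult W\<close>, and the dual quantum group is represented by
  \<open>dual W\<close>.
\<close>

definition qg_algebra :: "'h::chilbert_space op2 \<Rightarrow> ('h \<Rightarrow>\<^sub>L 'h) set"
  where "qg_algebra W = closure {slice \<omega> W |\<omega>. normal_functional \<omega>}"

definition comult :: "'h::chilbert_space op2 \<Rightarrow> ('h \<Rightarrow>\<^sub>L 'h) \<Rightarrow> 'h op2"
  where "comult W x = W o\<^sub>L (x \<otimes>\<^sub>o id_blinfun) o\<^sub>L adj W"

definition dual :: "'h::chilbert_space op2 \<Rightarrow> 'h op2"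
  where "dual W = flip o\<^sub>L adj W o\<^sub>L flip"

section \<open>Multipliers\<close>

text \<open>The spatial tensor product of concrete \<open>C\<^sup>*\<close>-algebras.\<close>

definition alg_tens :: "('a::chilbert_space \<Rightarrow>\<^sub>L 'a) set \<Rightarrow> ('b::chilbert_space \<Rightarrow>\<^sub>L 'b) set \<Rightarrow>
    (('a, 'b) tensor \<Rightarrow>\<^sub>L ('a, 'b) tensor) set"
  where "alg_tens C A = closure (span {c \<otimes>\<^sub>o a |c a. c \<in> C \<and> a \<in> A})"

text \<open>
  The multiplier algebra of a \<open>C\<^sup>*\<close>-algebra \<open>D\<close> is the algebra of adjointable operators of the
  Hilbert \<open>D\<close>-module \<open>D\<close> with inner product \<open>\<langle>a, b\<rangle> = a\<^sup>* b\<close>.  Multipliers are made extensional to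
  have equality of multipliers as equality of functions.
\<close>

definition adjoint_pair :: "('a::chilbert_space \<Rightarrow>\<^sub>L 'a) set \<Rightarrow> (('a \<Rightarrow>\<^sub>L 'a) \<Rightarrow> 'a \<Rightarrow>\<^sub>L 'a) \<Rightarrow>
    (('a \<Rightarrow>\<^sub>L 'a) \<Rightarrow> 'a \<Rightarrow>\<^sub>L 'a) \<Rightarrow> bool"
  where "adjoint_pair D m n \<longleftrightarrow> m \<in> D \<rightarrow>\<^sub>E D \<and> n \<in> D \<rightarrow>\<^sub>E D \<and>
    (\<forall>a\<in>D. \<forall>b\<in>D. adj (m a) o\<^sub>L b = adj a o\<^sub>L n b)"

definition multipliers :: "('a::chilbert_space \<Rightarrow>\<^sub>L 'a) set \<Rightarrow> (('a \<Rightarrow>\<^sub>L 'a) \<Rightarrow> 'a \<Rightarrow>\<^sub>L 'a) set"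
  where "multipliers D = {m. \<exists>n. adjoint_pair D m n}"

definition mult_star :: "('a::chilbert_space \<Rightarrow>\<^sub>L 'a) set \<Rightarrow> (('a \<Rightarrow>\<^sub>L 'a) \<Rightarrow> 'a \<Rightarrow>\<^sub>L 'a) \<Rightarrow>
    ('a \<Rightarrow>\<^sub>L 'a) \<Rightarrow> 'a \<Rightarrow>\<^sub>L 'a"
  where "mult_star D m = (THE n. adjoint_pair D m n)"

definition unitary_multipliers ::
    "('a::chilbert_space \<Rightarrow>\<^sub>L 'a) set \<Rightarrow> (('a \<Rightarrow>\<^sub>L 'a) \<Rightarrow> 'a \<Rightarrow>\<^sub>L 'a) set"
  where "unitary_multipliers D =
    {m \<in> multipliers D. \<forall>d\<in>D. mult_star D m (m d) = d \<and> m (mult_star D m d) = d}"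

text \<open>
  The extension to multipliers of a nondegenerate representation \<open>\<phi>\<close> of \<open>D\<close> on a Hilbert space.
  For the identity representation it is the image of a multiplier in the bounded operators.
\<close>

definition mult_ext :: "('a::chilbert_space \<Rightarrow>\<^sub>L 'a) set \<Rightarrow>
    (('a \<Rightarrow>\<^sub>L 'a) \<Rightarrow> 'b::chilbert_space \<Rightarrow>\<^sub>L 'b) \<Rightarrow> (('a \<Rightarrow>\<^sub>L 'a) \<Rightarrow> 'a \<Rightarrow>\<^sub>L 'a) \<Rightarrow> 'b \<Rightarrow>\<^sub>L 'b"
  where "mult_ext D \<phi> m = (THE T. \<forall>d\<in>D. T o\<^sub>L \<phi> d = \<phi> (m d))"

text \<open>The flip \<open>\<sigma>\<close> of \<open>C\<^sup>*\<close>-algebraic tensor factors, and its extension \<open>\<M>(C \<otimes> A) \<rightarrow> \<M>(A \<otimes> C)\<close>.\<close>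

definition flip_alg :: "(('a::chilbert_space, 'b::chilbert_space) tensor \<Rightarrow>\<^sub>L ('a, 'b) tensor) \<Rightarrow>
    ('b, 'a) tensor \<Rightarrow>\<^sub>L ('b, 'a) tensor"
  where "flip_alg T = flip o\<^sub>L T o\<^sub>L flip"

definition flip_mult :: "('a::chilbert_space \<Rightarrow>\<^sub>L 'a) set \<Rightarrow> ('b::chilbert_space \<Rightarrow>\<^sub>L 'b) set \<Rightarrow>
    ((('a, 'b) tensor \<Rightarrow>\<^sub>L ('a, 'b) tensor) \<Rightarrow> ('a, 'b) tensor \<Rightarrow>\<^sub>L ('a, 'b) tensor) \<Rightarrow>
    (('b, 'a) tensor \<Rightarrow>\<^sub>L ('b, 'a) tensor) \<Rightarrow> ('b, 'a) tensor \<Rightarrow>\<^sub>L ('b, 'a) tensor"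
  where "flip_mult C A m = restrict (\<lambda>e. flip_alg (m (flip_alg e))) (alg_tens A C)"

text \<open>The homomorphisms \<open>\<phi> \<otimes> id\<^sub>A\<close> and \<open>id\<^sub>C \<otimes> \<phi>\<close> on \<open>C \<otimes> A\<close>, with values in operators.\<close>

definition hom_tens_id :: "('a::chilbert_space \<Rightarrow>\<^sub>L 'a) set \<Rightarrow> ('b::chilbert_space \<Rightarrow>\<^sub>L 'b) set \<Rightarrow>
    (('a \<Rightarrow>\<^sub>L 'a) \<Rightarrow> 'a op2) \<Rightarrow> (('a, 'b) tensor \<Rightarrow>\<^sub>L ('a, 'b) tensor) \<Rightarrow>
    ('a, ('a, 'b) tensor) tensor \<Rightarrow>\<^sub>L ('a, ('a, 'b) tensor) tensor"
  where "hom_tens_id C A \<phi> = (THE f. f \<in> extensional (alg_tens C A) \<and>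
    continuous_on (alg_tens C A) f \<and>
    (\<forall>s\<in>alg_tens C A. \<forall>t\<in>alg_tens C A. f (s + t) = f s + f t) \<and>
    (\<forall>c\<in>C. \<forall>a\<in>A. f (c \<otimes>\<^sub>o a) = assoc o\<^sub>L (\<phi> c \<otimes>\<^sub>o a) o\<^sub>L adj assoc))"

definition id_tens_hom :: "('a::chilbert_space \<Rightarrow>\<^sub>L 'a) set \<Rightarrow> ('b::chilbert_space \<Rightarrow>\<^sub>L 'b) set \<Rightarrow>
    (('b \<Rightarrow>\<^sub>L 'b) \<Rightarrow> 'b op2) \<Rightarrow> (('a, 'b) tensor \<Rightarrow>\<^sub>L ('a, 'b) tensor) \<Rightarrow>
    ('a, ('b, 'b) tensor) tensor \<Rightarrow>\<^sub>L ('a, ('b, 'b) tensor) tensor"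
  where "id_tens_hom C A \<phi> = (THE f. f \<in> extensional (alg_tens C A) \<and>
    continuous_on (alg_tens C A) f \<and>
    (\<forall>s\<in>alg_tens C A. \<forall>t\<in>alg_tens C A. f (s + t) = f s + f t) \<and>
    (\<forall>c\<in>C. \<forall>a\<in>A. f (c \<otimes>\<^sub>o a) = c \<otimes>\<^sub>o \<phi> a))"

section \<open>Bicharacters\<close>

text \<open>The algebra \<open>\<hat>C \<otimes> A\<close>.\<close>

definition bichar_alg :: "'c::chilbert_space op2 \<Rightarrow> 'a::chilbert_space op2 \<Rightarrow>
    (('c, 'a) tensor \<Rightarrow>\<^sub>L ('c, 'a) tensor) set"
  where "bichar_alg WC WA = alg_tens (qg_algebra (dual WC)) (qg_algebra WA)"

type_synonym ('c, 'a) mult2 =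
  "(('c, 'a) tensor \<Rightarrow>\<^sub>L ('c, 'a) tensor) \<Rightarrow> ('c, 'a) tensor \<Rightarrow>\<^sub>L ('c, 'a) tensor"

text \<open>
  The identities \<open>(\<Delta> \<otimes> id) V = V\<^sub>2\<^sub>3 V\<^sub>1\<^sub>3\<close> and \<open>(id \<otimes> \<Delta>) V = V\<^sub>1\<^sub>2 V\<^sub>1\<^sub>3\<close> hold in multiplier algebras of
  concrete \<open>C\<^sup>*\<close>-algebras; these are faithfully embedded in the bounded operators, where the
  identities are written.
\<close>

definition bicharacter ::
    "'c::chilbert_space op2 \<Rightarrow> 'a::chilbert_space op2 \<Rightarrow> ('c, 'a) mult2 \<Rightarrow> bool"
  where "bicharacter WC WA V \<longleftrightarrow>
    (let C' = qg_algebra (dual WC); A = qg_algebra WA; D = alg_tens C' A in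
      V \<in> unitary_multipliers D \<and>
      mult_ext D (hom_tens_id C' A (comult (dual WC))) V = mult_ext D leg23 V o\<^sub>L mult_ext D leg13 V \<and>
      mult_ext D (id_tens_hom C' A (comult WA)) V = mult_ext D leg12 V o\<^sub>L mult_ext D leg13 V)"

definition concrete_bicharacter :: "'c::chilbert_space op2 \<Rightarrow> 'a::chilbert_space op2 \<Rightarrow>
    ('c, 'a) mult2 \<Rightarrow> ('c, 'a) tensor \<Rightarrow>\<^sub>L ('c, 'a) tensor"
  where "concrete_bicharacter WC WA V = mult_ext (bichar_alg WC WA) (\<lambda>d. d) V"

text \<open>The reduced bicharacter of the quantum group generated by \<open>W\<close>.\<close>

definition reduced_bicharacter :: "'c::chilbert_space op2 \<Rightarrow> ('c, 'c) mult2 \<Rightarrow> bool"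
  where "reduced_bicharacter W V \<longleftrightarrow>
    V \<in> unitary_multipliers (bichar_alg W W) \<and> concrete_bicharacter W W V = W"

text \<open>\<open>composite WC WA WB V_AB V_CA V_CB\<close> means \<open>V_CB = V_AB * V_CA\<close>.\<close>

definition composite :: "'c::chilbert_space op2 \<Rightarrow> 'a::chilbert_space op2 \<Rightarrow> 'b::chilbert_space op2 \<Rightarrow>
    ('a, 'b) mult2 \<Rightarrow> ('c, 'a) mult2 \<Rightarrow> ('c, 'b) mult2 \<Rightarrow> bool"
  where "composite WC WA WB V_AB V_CA V_CB \<longleftrightarrow>
    bicharacter WC WB V_CB \<and>
    leg23 (concrete_bicharacter WA WB V_AB) o\<^sub>L leg12 (concrete_bicharacter WC WA V_CA) =
    leg12 (concrete_bicharacter WC WA V_CA) o\<^sub>L leg13 (concrete_bicharacter WC WB V_CB) o\<^sub>L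
      leg23 (concrete_bicharacter WA WB V_AB)"

text \<open>The dual bicharacter \<open>\<sigma>(V\<^sup>*)\<close> of a bicharacter \<open>V\<close> from \<open>C\<close> to \<open>A\<close>.\<close>

definition dual_bicharacter :: "'c::chilbert_space op2 \<Rightarrow> 'a::chilbert_space op2 \<Rightarrow>
    ('c, 'a) mult2 \<Rightarrow> ('a, 'c) mult2"
  where "dual_bicharacter WC WA V =
    flip_mult (qg_algebra (dual WC)) (qg_algebra WA) (mult_star (bichar_alg WC WA) V)"

end

(*
  Since alg_tens C A is a nondegenerate subspace of complex-linear operators, a unitary multiplier of it
  is left multiplication by a unitary operator, which is the concrete bicharacter U.  As
  comultiplications are implemented by the multiplicative
  unitaries, V is a bicharacter iff, with What the dual of WC,
    What_12 U_13 What_12^* = U_23 U_13  and  WA_23 U_12 WA_23^* = U_12 U_13.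
  Taking adjoints and permuting the legs cyclically exchanges these two equations for U with those
  for Sigma U^* Sigma.  Taking adjoints and reversing the legs does the same for the pentagon equation
  and for the equation that defines composition.
*)
theory Submission
  imports Defs
begin

section \<open>Hilbert space preliminaries\<close>

text \<open>Two obstacles shape the proof. Adjoints, tensor products of operators, flips, slices,
  extensions to multipliers and homomorphisms on \<open>alg_tens\<close> are all definite
  descriptions over bounded real-linear maps, so existence has to be shown before anything can be
  computed: by extension from a spanning set, the Riesz theorem, a convergent series or an explicit
  formula. Uniqueness mostly comes from a dense real span. Complex linearity is carried separately,
  so one real-linear theory serves unitary and antiunitary maps. The second obstacle is the choice
  of permutation. In the comultiplication identities the multiplicative unitaries must survive
  unchanged while \<open>U\<close> is to be flipped. A cyclic shift does this: it moves
  \<open>leg23 WA\<close> to \<open>leg12 WA\<close>, but flips \<open>leg12 U\<close> and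
  \<open>leg13 U\<close>. The full reversal would flip \<open>WA\<close> as well. For the
  composition identity the reversal is right, since there every operator is replaced by its flipped
  adjoint; that it exchanges legs 12 and 23 makes the functor contravariant.\<close>

lemma subspace_closure:
  assumes "subspace (S :: 'a::real_normed_vector set)"
  shows "subspace (closure S)"
proof (rule subspaceI)
  show "0 \<in> closure S"
    using assms closure_subset subspace_0 by blast
  show "x + y \<in> closure S" if x: "x \<in> closure S" and y: "y \<in> closure S" for x y
  proof -
    obtain f g where "\<And>n. f n \<in> S" "f \<longlonglongrightarrow> x" "\<And>n. g n \<in> S" "g \<longlonglongrightarrow> y"
      using x y unfolding closure_sequential by blast
    then have "(\<lambda>n. f n + g n) \<longlonglongrightarrow> x + y" "\<And>n. f n + g n \<in> S"
      using assms by (auto intro: tendsto_add subspace_add)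
    then show ?thesis
      unfolding closure_sequential by (intro exI[of _ "\<lambda>n. f n + g n"]) auto
  qed
  show "c *\<^sub>R x \<in> closure S" if x: "x \<in> closure S" for c x
  proof -
    obtain f where "\<And>n. f n \<in> S" "f \<longlonglongrightarrow> x"
      using x unfolding closure_sequential by blast
    then have "(\<lambda>n. c *\<^sub>R f n) \<longlonglongrightarrow> c *\<^sub>R x" "\<And>n. c *\<^sub>R f n \<in> S"
      using assms by (auto intro: tendsto_scaleR subspace_scale)
    then show ?thesis
      unfolding closure_sequential by (intro exI[of _ "\<lambda>n. c *\<^sub>R f n"]) auto
  qed
qed

text \<open>Extension by continuity, phrased for graphs so that well-definedness on a spanning set
  is never checked separately. The bound passes to the closure of \<open>G\<close> and makes it
  single-valued; completeness of the codomain and density of the domain make it total.\<close>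

lemma bounded_graph_extension:
  fixes G :: "('a::real_normed_vector \<times> 'b::banach) set"
  assumes G: "subspace G" and dense: "closure (fst ` G) = UNIV" and "0 \<le> K"
    and bound: "\<And>x y. (x, y) \<in> G \<Longrightarrow> norm y \<le> K * norm x"
  obtains R :: "'a \<Rightarrow>\<^sub>L 'b" where "\<And>x y. (x, y) \<in> G \<Longrightarrow> R x = y" "norm R \<le> K"
proof -
  define H where "H = closure G"
  have H: "subspace H" "G \<subseteq> H"
    using subspace_closure[OF G] closure_subset by (auto simp: H_def)
  have "closed {p :: 'a \<times> 'b. norm (snd p) \<le> K * norm (fst p)}"
    by (intro closed_Collect_le continuous_intros)
  then have "H \<subseteq> {p. norm (snd p) \<le> K * norm (fst p)}"
    unfolding H_def using bound by (intro closure_minimal) auto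
  then have H_bound: "norm y \<le> K * norm x" if "(x, y) \<in> H" for x y
    using that by auto
  have uniq: "y = y'" if "(x, y) \<in> H" "(x, y') \<in> H" for x y y'
  proof -
    have "(0, y - y') \<in> H"
      using subspace_diff[OF H(1) that] by simp
    then show ?thesis using H_bound by fastforce
  qed
  have total: "\<exists>y. (x, y) \<in> H" for x
  proof -
    have "x \<in> closure (fst ` G)" using dense by simp
    then obtain f where f: "\<And>n. f n \<in> fst ` G" "f \<longlonglongrightarrow> x"
      unfolding closure_sequential by blast
    then have "\<forall>n. \<exists>y. (f n, y) \<in> G" by force
    then obtain g where g: "\<And>n. (f n, g n) \<in> G" by metis
    have "Cauchy g"
    proof (rule metric_CauchyI)
      fix e :: real assume "e > 0"
      \<comment> \<open>Dividing by \<open>K + 1\<close> instead of \<open>K\<close> covers the case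
        \<open>K = 0\<close>.\<close>
      then have "e / (K + 1) > 0" using \<open>0 \<le> K\<close> by simp
      then obtain N where N: "\<And>m n. m \<ge> N \<Longrightarrow> n \<ge> N \<Longrightarrow> dist (f m) (f n) < e / (K + 1)"
        using LIMSEQ_imp_Cauchy[OF f(2)] metric_CauchyD by blast
      have "dist (g m) (g n) < e" if "m \<ge> N" "n \<ge> N" for m n
      proof -
        have "norm (g m - g n) \<le> K * norm (f m - f n)"
          using bound subspace_diff[OF G g g, of m n] by simp
        also have "\<dots> \<le> (K + 1) * norm (f m - f n)"
          by (intro mult_right_mono) auto
        also have "\<dots> < e"
          using N[OF that] \<open>0 \<le> K\<close> by (simp add: dist_norm field_simps)
        finally show ?thesis by (simp add: dist_norm)
      qed
      then show "\<exists>N. \<forall>m\<ge>N. \<forall>n\<ge>N. dist (g m) (g n) < e" by blast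
    qed
    then obtain y where "g \<longlonglongrightarrow> y"
      using Cauchy_convergent convergent_def by blast
    then have "(\<lambda>n. (f n, g n)) \<longlonglongrightarrow> (x, y)"
      using f(2) by (intro tendsto_Pair)
    then show ?thesis
      unfolding H_def closure_sequential using g by (intro exI[of _ y] exI[of _ "\<lambda>n. (f n, g n)"]) auto
  qed
  then obtain r where r: "\<And>x. (x, r x) \<in> H" by metis
  have "bounded_linear r"
  proof (rule bounded_linear_intro)
    show "r (x + y) = r x + r y" for x y
      using uniq[OF r] subspace_add[OF H(1) r r, of x y] by simp
    show "r (c *\<^sub>R x) = c *\<^sub>R r x" for c x
      using uniq[OF r] subspace_scale[OF H(1) r, of c x] by simp
    show "norm (r x) \<le> norm x * K" for x
      using H_bound[OF r, of x] by (simp add: mult.commute)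
  qed
  then have app: "Blinfun r x = r x" for x
    by (simp add: bounded_linear_Blinfun_apply)
  show thesis
  proof
    show "Blinfun r x = y" if "(x, y) \<in> G" for x y
      using uniq[OF r] that H(2) by (auto simp: app)
    show "norm (Blinfun r) \<le> K"
      by (rule norm_blinfun_bound) (use \<open>0 \<le> K\<close> H_bound[OF r] in \<open>auto simp: app\<close>)
  qed
qed

text \<open>Inner products on the span are determined by those of generators, so the span of
  \<open>E\<close> is automatically the graph of an isometry. Only real inner products enter, which
  makes the result apply to antiunitary maps too.\<close>

lemma isometric_extension:
  fixes E :: "('a::real_inner \<times> 'b::{banach, real_inner}) set"
  assumes dense: "closure (span (fst ` E)) = UNIV"
    and iso: "\<And>x y x' y'. (x, y) \<in> E \<Longrightarrow> (x', y') \<in> E \<Longrightarrow> y \<bullet> y' = x \<bullet> x'"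
  obtains R :: "'a \<Rightarrow>\<^sub>L 'b" where "\<And>x y. (x, y) \<in> E \<Longrightarrow> R x = y"
proof -
  have 1: "snd p \<bullet> snd q = fst p \<bullet> fst q" if "p \<in> span E" "q \<in> E" for p q
    using that by (induction rule: span_induct_alt) (auto simp: inner_add_left iso)
  have 2: "snd p \<bullet> snd q = fst p \<bullet> fst q" if "q \<in> span E" "p \<in> span E" for p q
    using that by (induction rule: span_induct_alt) (auto simp: inner_add_right 1)
  have "norm y \<le> 1 * norm x" if "(x, y) \<in> span E" for x y
    using 2[OF that that] by (simp add: norm_eq_sqrt_inner)
  moreover have "fst ` span E = span (fst ` E)"
    by (rule linear_span_image[symmetric]) (simp add: linear_fst)
  ultimately obtain R :: "'a \<Rightarrow>\<^sub>L 'b" where "\<And>x y. (x, y) \<in> span E \<Longrightarrow> R x = y"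
    using bounded_graph_extension[of "span E" 1] dense by (metis subspace_span zero_le_one)
  then show thesis
    using that span_base by blast
qed

section \<open>Orthogonal projection and the Riesz representation theorem\<close>

text \<open>The midpoint of two members of a minimizing sequence lies in \<open>M\<close>, hence at
  distance at least \<open>d\<close> from \<open>x\<close>; the parallelogram law then forces the
  sequence to be Cauchy.\<close>

lemma closest_point_in_hilbert_subspace:
  fixes M :: "'a::{real_inner, banach} set"
  assumes M: "subspace M" "closed M"
  obtains m where "m \<in> M" "\<And>y. y \<in> M \<Longrightarrow> dist x m \<le> dist x y"
proof -
  define d where "d = infdist x M"
  have ne: "M \<noteq> {}" using subspace_0[OF M(1)] by auto
  have d: "0 \<le> d" "\<And>y. y \<in> M \<Longrightarrow> d \<le> dist x y"
    by (auto simp: d_def infdist_nonneg infdist_le)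
  have "\<exists>y\<in>M. (dist x y)\<^sup>2 < d\<^sup>2 + 1 / real (Suc n)" for n
  proof (rule ccontr)
    assume "\<not> ?thesis"
    then have *: "d\<^sup>2 + 1 / real (Suc n) \<le> (dist x y)\<^sup>2" if "y \<in> M" for y
      using that by force
    have "sqrt (d\<^sup>2 + 1 / real (Suc n)) \<le> dist x y" if "y \<in> M" for y
      using real_sqrt_le_mono[OF *[OF that]] by (simp only: real_sqrt_abs abs_of_nonneg zero_le_dist)
    then have "sqrt (d\<^sup>2 + 1 / real (Suc n)) \<le> d"
      unfolding d_def infdist_notempty[OF ne] using ne by (intro cINF_greatest)
    then have "d\<^sup>2 + 1 / real (Suc n) \<le> d\<^sup>2"
      using sqrt_le_D by blast
    then show False by (simp del: of_nat_Suc add: field_simps)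
  qed
  then obtain f where f: "\<And>n. f n \<in> M" "\<And>n. (dist x (f n))\<^sup>2 < d\<^sup>2 + 1 / real (Suc n)"
    by metis
  have diff: "(dist (f m) (f n))\<^sup>2 < 2 / real (Suc m) + 2 / real (Suc n)" for m n
  proof -
    have "(1/2) *\<^sub>R (f m + f n) \<in> M"
      using M f by (intro subspace_scale subspace_add) auto
    then have "d\<^sup>2 \<le> (norm (x - (1/2) *\<^sub>R (f m + f n)))\<^sup>2"
      using d by (metis dist_norm power_mono)
    moreover have "x - (1/2) *\<^sub>R (f m + f n) = (1/2) *\<^sub>R ((x - f m) + (x - f n))"
    proof -
      have "x = (1/2) *\<^sub>R (x + x)"
        by (simp only: scaleR_half_double)
      then show ?thesis
        by (metis add_diff_add scaleR_right_diff_distrib)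
    qed
    moreover have "(norm (v - u))\<^sup>2
        = 2 * (norm u)\<^sup>2 + 2 * (norm v)\<^sup>2 - 4 * (norm ((1/2) *\<^sub>R (u + v)))\<^sup>2" for u v :: 'a
      unfolding power2_norm_eq_inner
      by (simp add: inner_diff_left inner_diff_right inner_add_left inner_add_right inner_commute[of v u]
          add_divide_distrib)
    from this[of "x - f n" "x - f m"]
    have "(dist (f m) (f n))\<^sup>2 = 2 * (dist x (f n))\<^sup>2 + 2 * (dist x (f m))\<^sup>2
        - 4 * (norm ((1/2) *\<^sub>R ((x - f m) + (x - f n))))\<^sup>2"
      by (simp add: dist_norm norm_minus_commute add.commute)
    ultimately show ?thesis
      using f(2)[of m] f(2)[of n] by (simp only:)
  qed
  have "Cauchy f"
  proof (rule metric_CauchyI)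
    fix e :: real assume "e > 0"
    \<comment> \<open>The factor 4 is the sum of the two numerators in \<open>diff\<close>.\<close>
    then obtain N where N: "inverse (real (Suc N)) < e\<^sup>2 / 4"
      using reals_Archimedean[of "e\<^sup>2 / 4"] by auto
    then have N4: "4 * inverse (real (Suc N)) < e\<^sup>2"
      by linarith
    have "dist (f m) (f n) < e" if "m \<ge> N" "n \<ge> N" for m n
    proof (rule power2_less_imp_less)
      have "inverse (real (Suc k)) \<le> inverse (real (Suc N))" if "k \<ge> N" for k
        using that by (intro le_imp_inverse_le) auto
      from this[OF that(1)] this[OF that(2)]
      show "(dist (f m) (f n))\<^sup>2 < e\<^sup>2"
        using diff[of m n] N4 unfolding divide_inverse by linarith
    qed (use \<open>e > 0\<close> in simp)
    then show "\<exists>N. \<forall>m\<ge>N. \<forall>n\<ge>N. dist (f m) (f n) < e" by blast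
  qed
  then obtain m where m: "f \<longlonglongrightarrow> m"
    using Cauchy_convergent convergent_def by blast
  have "m \<in> M"
    using M(2) f(1) m closed_sequentially by blast
  moreover have "(dist x m)\<^sup>2 \<le> d\<^sup>2"
  proof (rule LIMSEQ_le)
    show "(\<lambda>n. (dist x (f n))\<^sup>2) \<longlonglongrightarrow> (dist x m)\<^sup>2"
      by (intro tendsto_intros m)
    show "(\<lambda>n. d\<^sup>2 + 1 / real (Suc n)) \<longlonglongrightarrow> d\<^sup>2"
      using tendsto_add[OF tendsto_const LIMSEQ_inverse_real_of_nat, of "d\<^sup>2"]
      by (simp add: inverse_eq_divide)
  qed (use f(2) in \<open>auto intro: less_imp_le\<close>)
  then have "dist x m \<le> d"
    using d(1) by (rule power2_le_imp_le)
  ultimately show thesis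
    using that d(2) order_trans by blast
qed

text \<open>The variational inequality at the closest point, used in the directions \<open>y\<close>
  and \<open>- y\<close>.\<close>

lemma hilbert_projection:
  fixes M :: "'a::{real_inner, banach} set"
  assumes M: "subspace M" "closed M"
  obtains m where "m \<in> M" "\<And>y. y \<in> M \<Longrightarrow> (x - m) \<bullet> y = 0"
proof -
  obtain m where m: "m \<in> M" "\<And>y. y \<in> M \<Longrightarrow> dist x m \<le> dist x y"
    using closest_point_in_hilbert_subspace[OF M] by blast
  have le: "(x - m) \<bullet> y \<le> 0" if "y \<in> M" for y
    using any_closest_point_dot[of M m "m + y" x] M m that
    by (simp add: subspace_imp_convex subspace_add)
  have "(x - m) \<bullet> y = 0" if "y \<in> M" for y
    using le[OF that] le[OF subspace_neg[OF M(1) that]] by simp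
  then show thesis using that m(1) by blast
qed

lemma dense_spanI:
  fixes S :: "'a::{real_inner, banach} set"
  assumes "\<And>v. (\<And>s. s \<in> S \<Longrightarrow> v \<bullet> s = 0) \<Longrightarrow> v = 0"
  shows "closure (span S) = UNIV"
proof (intro set_eqI iffI UNIV_I)
  fix x
  obtain m where m: "m \<in> closure (span S)" "\<And>y. y \<in> closure (span S) \<Longrightarrow> (x - m) \<bullet> y = 0"
    using hilbert_projection[OF subspace_closure[OF subspace_span] closed_closure] by blast
  have "x - m = 0"
    using assms m(2) closure_subset span_base by blast
  then show "x \<in> closure (span S)" using m(1) by simp
qed

lemma riesz_representation:
  fixes f :: "'a::{real_inner, banach} \<Rightarrow> real"
  assumes "bounded_linear f"
  obtains v where "\<And>x. f x = v \<bullet> x"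
proof (cases "\<forall>x. f x = 0")
  case True
  then show thesis using that[of 0] by simp
next
  case False
  interpret bounded_linear f by fact
  obtain x where x: "f x \<noteq> 0" using False by blast
  have sub: "subspace {y. f y = 0}"
    by (auto intro!: subspaceI simp: add scaleR)
  have cl: "closed {y. f y = 0}"
    by (intro closed_Collect_eq continuous_intros linear_continuous_on assms)
  obtain m where "m \<in> {y. f y = 0}" "\<And>y. y \<in> {y. f y = 0} \<Longrightarrow> (x - m) \<bullet> y = 0"
    using hilbert_projection[OF sub cl, of x] by blast
  then have m: "f m = 0" "\<And>y. f y = 0 \<Longrightarrow> (x - m) \<bullet> y = 0"
    by auto
  define z where "z = x - m"
  have fz: "f z \<noteq> 0" using x m(1) by (simp add: z_def diff)
  then have zz: "z \<bullet> z \<noteq> 0" by (auto simp: zero)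
  have "f y = ((f z / (z \<bullet> z)) *\<^sub>R z) \<bullet> y" for y
  proof -
    have "z \<bullet> (y - (f y / f z) *\<^sub>R z) = 0"
      unfolding z_def by (rule m(2)) (use fz in \<open>simp add: diff scaleR z_def\<close>)
    then have "z \<bullet> y = f y / f z * (z \<bullet> z)"
      by (simp add: inner_diff_right)
    then have "f z / (z \<bullet> z) * (z \<bullet> y) = f y"
      using fz zz by simp
    then show ?thesis by simp
  qed
  then show thesis using that by blast
qed

lemma cinner_eqI:
  assumes "\<And>z. cinner z x = cinner z y"
  shows "x = (y :: 'a::chilbert_space)"
proof -
  have "cinner (x - y) (x - y) = 0"
    using assms by (simp add: cinner_diff_right)
  then show ?thesis by (simp add: cinner_self)
qed

text \<open>Lets identities obtained for the real inner product be upgraded to the complex one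
  wherever multiplication by \<open>\<i>\<close> is respected.\<close>

lemma Im_cinner: "Im (cinner x y) = - (x \<bullet> (\<i> *\<^sub>C y))"
  by (simp add: inner_eq_Re_cinner cinner_scaleC_right)

lemma scaleC_zero_right [simp]: "c *\<^sub>C 0 = (0 :: 'a::chilbert_space)"
  by (metis add_cancel_left_right scaleC_add_right)

lemma scaleC_scaleR: "c *\<^sub>C r *\<^sub>R x = r *\<^sub>R c *\<^sub>C (x :: 'a::chilbert_space)"
  by (simp add: scaleR_scaleC scaleC_scaleC mult.commute)

lemma bounded_linear_scaleC: "bounded_linear (\<lambda>x :: 'a::chilbert_space. c *\<^sub>C x)"
  by (rule bounded_linear_intro[of _ "cmod c"])
    (simp_all add: scaleC_add_right scaleC_scaleR norm_scaleC mult.commute)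

subsection \<open>Complex-linear operators and adjoints\<close>

lemma complex_opD: "complex_op T \<Longrightarrow> T (c *\<^sub>C x) = c *\<^sub>C T x"
  by (simp add: complex_op_def)

lemma complex_op_compose [intro, simp]: "complex_op S \<Longrightarrow> complex_op T \<Longrightarrow> complex_op (S o\<^sub>L T)"
  by (simp add: complex_op_def)

lemma complex_op_id [intro, simp]: "complex_op id_blinfun"
  by (simp add: complex_op_def)

lemma complex_op_zero [intro, simp]: "complex_op 0"
  by (simp add: complex_op_def)

lemma complex_op_add [intro]: "complex_op S \<Longrightarrow> complex_op T \<Longrightarrow> complex_op (S + T)"
  by (simp add: complex_op_def blinfun.add_left scaleC_add_right)

lemma complex_op_scaleR [intro]: "complex_op T \<Longrightarrow> complex_op (r *\<^sub>R T)"
  by (simp add: complex_op_def blinfun.scaleR_left scaleC_scaleR)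

lemma subspace_complex_op: "subspace {T. complex_op T}"
  by (auto intro: subspaceI)

text \<open>Together with \<open>subspace_complex_op\<close> this carries complex linearity to norm
  limits: to \<open>qg_algebra\<close>, to \<open>alg_tens\<close> and to the series that define
  slices.\<close>

lemma closed_complex_op: "closed {T :: 'a::chilbert_space \<Rightarrow>\<^sub>L 'b::chilbert_space. complex_op T}"
proof -
  have "closed {T :: 'a \<Rightarrow>\<^sub>L 'b. T (c *\<^sub>C x) = c *\<^sub>C T x}" for c x
    by (intro closed_Collect_eq linear_continuous_on bounded_linear_apply_blinfun
        bounded_linear_compose[OF bounded_linear_scaleC])
  then show ?thesis
    unfolding complex_op_def by (intro closed_Collect_all)
qed

lemma adj_eqI:
  fixes T :: "'a::chilbert_space \<Rightarrow>\<^sub>L 'b::chilbert_space" and S :: "'b \<Rightarrow>\<^sub>L 'a"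
  assumes "\<And>x y. cinner (S y) x = cinner y (T x)"
  shows "adj T = S"
  unfolding adj_def
proof (rule the_equality)
  fix S' :: "'b \<Rightarrow>\<^sub>L 'a" assume S': "\<forall>x y. cinner (S' y) x = cinner y (T x)"
  have "cinner x (S' y) = cinner x (S y)" for x y
    using S' assms cinner_commute by metis
  then show "S' = S"
    by (intro blinfun_eqI cinner_eqI) auto
qed (use assms in blast)

text \<open>The Riesz theorem for the real inner product yields an adjoint for the real part.
  Complex linearity of \<open>T\<close> adds the imaginary part, by replacing \<open>x\<close> with
  its multiple by \<open>\<i>\<close>.\<close>

lemma cinner_adj_left:
  fixes T :: "'a::chilbert_space \<Rightarrow>\<^sub>L 'b::chilbert_space"
  assumes "complex_op T"
  shows "cinner (adj T y) x = cinner y (T x)"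
proof -
  have "\<exists>v. \<forall>x. y \<bullet> T x = v \<bullet> x" for y
    using riesz_representation[OF bounded_linear_compose[OF bounded_linear_inner_right blinfun.bounded_linear_right]]
    by metis
  then obtain s where s: "\<And>x y. s y \<bullet> x = y \<bullet> T x" by metis
  have eqI: "u = v" if "\<And>x. u \<bullet> x = v \<bullet> x" for u v :: 'a
    using that[of "u - v"] by (metis inner_diff_left inner_eq_zero_iff right_minus_eq)
  have "bounded_linear s"
  proof (rule bounded_linear_intro)
    show "s (x + y) = s x + s y" for x y
      by (rule eqI) (simp add: s inner_add_left)
    show "s (r *\<^sub>R x) = r *\<^sub>R s x" for r x
      by (rule eqI) (simp add: s)
    show "norm (s x) \<le> norm x * norm T" for x
    proof (cases "s x = 0")
      case False
      have "norm (s x) * norm (s x) = x \<bullet> T (s x)"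
        using s[of x "s x"] by (simp add: power2_norm_eq_inner[symmetric] power2_eq_square)
      also have "\<dots> \<le> norm x * norm (T (s x))" by (rule norm_cauchy_schwarz)
      also have "\<dots> \<le> norm x * (norm T * norm (s x))"
        by (intro mult_left_mono norm_blinfun) simp
      finally show ?thesis using False by (simp add: field_simps)
    qed simp
  qed
  then have app: "Blinfun s y = s y" for y
    by (simp add: bounded_linear_Blinfun_apply)
  have "cinner (Blinfun s y) x = cinner y (T x)" for x y
  proof (rule complex_eqI)
    show "Re (cinner (Blinfun s y) x) = Re (cinner y (T x))"
      by (simp add: app s inner_eq_Re_cinner[symmetric])
    show "Im (cinner (Blinfun s y) x) = Im (cinner y (T x))"
      by (simp add: app s Im_cinner complex_opD[OF assms])
  qed
  then show ?thesis
    using adj_eqI by metis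
qed

lemma cinner_adj_right:
  "complex_op T \<Longrightarrow> cinner x (adj T y) = cinner (T x) y"
  by (metis cinner_adj_left cinner_commute)

lemma complex_op_adj [intro, simp]: "complex_op T \<Longrightarrow> complex_op (adj T)"
  unfolding complex_op_def[of "adj T"]
  by (intro allI cinner_eqI) (simp add: cinner_adj_right cinner_scaleC_right)

lemma adj_adj [simp]: "complex_op T \<Longrightarrow> adj (adj T) = T"
  by (rule adj_eqI) (simp add: cinner_adj_right)

lemma adj_compose: "complex_op S \<Longrightarrow> complex_op T \<Longrightarrow> adj (S o\<^sub>L T) = adj T o\<^sub>L adj S"
  by (rule adj_eqI) (simp add: cinner_adj_left)

lemma adj_id [simp]: "adj id_blinfun = id_blinfun"
  by (rule adj_eqI) simp

text \<open>Definiteness of the module inner product, from which uniqueness of adjoints of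
  multipliers follows.\<close>

lemma adj_compose_self_eq_0D:
  assumes "complex_op T" "adj T o\<^sub>L T = 0"
  shows "T = 0"
proof (rule blinfun_eqI)
  fix x
  have "cinner (T x) (T x) = cinner x ((adj T o\<^sub>L T) x)"
    by (simp add: cinner_adj_right assms(1))
  then show "T x = blinfun_apply 0 x"
    by (simp add: assms(2) cinner_self)
qed

lemma unitary_opD:
  assumes "unitary_op U"
  shows "complex_op U" "adj U o\<^sub>L U = id_blinfun" "U o\<^sub>L adj U = id_blinfun"
    "adj U (U x) = x" "U (adj U y) = y"
  using assms unfolding unitary_op_def by (metis blinfun_apply_blinfun_compose blinfun_apply_id_blinfun)+

lemma unitary_op_adj: "unitary_op U \<Longrightarrow> unitary_op (adj U)"
  by (simp add: unitary_op_def)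

lemma unitary_op_compose:
  assumes "unitary_op U" "unitary_op V"
  shows "unitary_op (U o\<^sub>L V)"
  unfolding unitary_op_def
  by (auto intro!: blinfun_eqI simp: adj_compose unitary_opD[OF assms(1)] unitary_opD[OF assms(2)])

lemma unitary_opI:
  assumes "complex_op U" "\<And>x. adj U (U x) = x" "\<And>y. U (adj U y) = y"
  shows "unitary_op U"
  using assms unfolding unitary_op_def by (auto intro!: blinfun_eqI)

text \<open>The library \<open>span\<close> is real. If \<open>S\<close> is stable under
  \<open>\<i>\<close>, real orthogonality to \<open>S\<close> already gives complex orthogonality,
  so density may be tested with \<open>cinner\<close>.\<close>

lemma dense_span_complexI:
  fixes S :: "'a::chilbert_space set"
  assumes "\<And>v. (\<And>s. s \<in> S \<Longrightarrow> cinner v s = 0) \<Longrightarrow> v = 0" and "\<And>s. s \<in> S \<Longrightarrow> \<i> *\<^sub>C s \<in> S"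
  shows "closure (span S) = UNIV"
proof (rule dense_spanI)
  fix v assume v: "\<And>s. s \<in> S \<Longrightarrow> v \<bullet> s = 0"
  have "cinner v s = 0" if "s \<in> S" for s
    using v[OF that] v[OF assms(2)[OF that]] Im_cinner[of v s]
    by (simp add: complex_eq_iff inner_eq_Re_cinner[symmetric])
  then show "v = 0" using assms(1) by blast
qed

lemma blinfun_eq_on_dense:
  fixes A B :: "'a::real_normed_vector \<Rightarrow>\<^sub>L 'b::real_normed_vector"
  assumes "closure (span S) = UNIV" "\<And>s. s \<in> S \<Longrightarrow> A s = B s"
  shows "A = B"
proof (rule blinfun_eqI)
  fix x
  have "A s = B s" if "s \<in> span S" for s
    using that by (induction rule: span_induct_alt) (auto simp: assms(2) blinfun.add_right blinfun.scaleR_right)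
  then have "span S \<subseteq> {x. A x = B x}" by auto
  moreover have "closed {x. A x = B x}"
    by (intro closed_Collect_eq linear_continuous_on blinfun.bounded_linear_right)
  ultimately have "closure (span S) \<subseteq> {x. A x = B x}" by (rule closure_minimal)
  then show "A x = B x" using assms(1) by auto
qed

lemma blinfun_compose_assoc: "(A o\<^sub>L B) o\<^sub>L C = A o\<^sub>L (B o\<^sub>L C)"
  by (rule blinfun_eqI) simp

lemma blinfun_compose_id [simp]: "id_blinfun o\<^sub>L A = A" "A o\<^sub>L id_blinfun = A"
  by (rule blinfun_eqI; simp)+

section \<open>Operators on tensor products\<close>

lemma tens_scaleR_left: "(r *\<^sub>R x) \<otimes> y = r *\<^sub>R (x \<otimes> y)"
  by (simp add: scaleR_scaleC tens_scaleC_left)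

lemma tens_scaleR_right: "x \<otimes> (r *\<^sub>R y) = r *\<^sub>R (x \<otimes> y)"
  by (simp add: scaleR_scaleC tens_scaleC_right)

lemma norm_tens: "norm (x \<otimes> y) = norm x * norm y"
proof -
  have "complex_of_real ((norm (x \<otimes> y))\<^sup>2) = complex_of_real ((norm x * norm y)\<^sup>2)"
    unfolding cinner_self[symmetric] cinner_tens by (simp add: cinner_self power_mult_distrib)
  then show ?thesis
    by (simp only: of_real_eq_iff) (simp add: power2_eq_iff_nonneg)
qed

lemma tens_zero_left [simp]: "0 \<otimes> y = 0"
  using tens_scaleR_left[of 0 0 y] by simp

lemma bounded_bilinear_tens: "bounded_bilinear (\<otimes>)"
  by standard (auto simp: tens_add_left tens_add_right tens_scaleR_left tens_scaleR_right norm_tens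
      intro!: exI[of _ 1])

lemma tens_right_apply [simp]: "tens_right y x = x \<otimes> y"
  unfolding tens_right_def
  by (simp add: bounded_linear_Blinfun_apply bounded_bilinear.bounded_linear_left[OF bounded_bilinear_tens])

lemma complex_op_tens_right [simp]: "complex_op (tens_right y)"
  by (simp add: complex_op_def tens_scaleC_left)

definition tens_left :: "'a::chilbert_space \<Rightarrow> 'b::chilbert_space \<Rightarrow>\<^sub>L ('a, 'b) tensor"
  where "tens_left x = Blinfun (\<lambda>y. x \<otimes> y)"

lemma tens_left_apply [simp]: "tens_left x y = x \<otimes> y"
  unfolding tens_left_def
  by (simp add: bounded_linear_Blinfun_apply bounded_bilinear.bounded_linear_right[OF bounded_bilinear_tens])

lemma complex_op_tens_left [simp]: "complex_op (tens_left y)"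
  by (simp add: complex_op_def tens_scaleC_right)

lemma norm_tens_left: "norm (tens_left x) \<le> norm x"
  by (rule norm_blinfun_bound) (simp_all add: norm_tens)

lemma tens_eqI:
  fixes A B :: "('a::chilbert_space, 'b::chilbert_space) tensor \<Rightarrow>\<^sub>L 'd::real_normed_vector"
  assumes "\<And>x y. A (x \<otimes> y) = B (x \<otimes> y)"
  shows "A = B"
  by (rule blinfun_eq_on_dense[OF closure_span_tens]) (use assms in auto)

lemma bounded_linear_cinner_right: "bounded_linear (cinner v)"
  by (rule bounded_bilinear.bounded_linear_right[OF bounded_bilinear_cinner])

lemma eq_zero_if_orthogonal_dense:
  fixes v :: "'a::chilbert_space"
  assumes "closure (span S) = UNIV" "\<And>s. s \<in> S \<Longrightarrow> cinner v s = 0"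
  shows "v = 0"
proof -
  have "Blinfun (cinner v) = 0"
    by (rule blinfun_eq_on_dense[OF assms(1)])
      (simp add: bounded_linear_Blinfun_apply bounded_linear_cinner_right assms(2))
  then have "Blinfun (cinner v) v = 0" by simp
  then have "cinner v v = 0"
    by (simp add: bounded_linear_Blinfun_apply bounded_linear_cinner_right)
  then show ?thesis by (simp add: cinner_self)
qed

lemma tens_orthogonal:
  assumes "\<And>x y. cinner v (x \<otimes> y) = 0"
  shows "v = 0"
  by (rule eq_zero_if_orthogonal_dense[OF closure_span_tens]) (use assms in auto)

lemma cinner_tens_eqI:
  assumes "\<And>x y. cinner v (x \<otimes> y) = cinner w (x \<otimes> y)"
  shows "v = w"
  using tens_orthogonal[of "v - w"] assms by (simp add: cinner_diff_left)

lemma complex_op_tensI: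
  fixes A :: "('a::chilbert_space, 'b::chilbert_space) tensor \<Rightarrow>\<^sub>L 'd::chilbert_space"
  assumes "\<And>c x y. A ((c *\<^sub>C x) \<otimes> y) = c *\<^sub>C A (x \<otimes> y)"
  shows "complex_op A"
proof -
  have app: "Blinfun ((*\<^sub>C) c) x = c *\<^sub>C x" for c and x :: "'h::chilbert_space"
    by (simp add: bounded_linear_Blinfun_apply bounded_linear_scaleC)
  have "A o\<^sub>L Blinfun ((*\<^sub>C) c) = Blinfun ((*\<^sub>C) c) o\<^sub>L A" for c
    by (rule tens_eqI) (simp add: app assms tens_scaleC_left[symmetric])
  then have "(A o\<^sub>L Blinfun ((*\<^sub>C) c)) x = (Blinfun ((*\<^sub>C) c) o\<^sub>L A) x" for c x
    by simp
  then show ?thesis by (simp add: app complex_op_def)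
qed

text \<open>Applying \<open>adj (tens_right y)\<close> to \<open>v\<close> turns orthogonality in
  the tensor product into orthogonality in the first factor, where density of \<open>span S\<close>
  is available.\<close>

lemma orthogonal_tens_right:
  assumes "closure (span S) = UNIV" "\<And>s. s \<in> S \<Longrightarrow> cinner v (s \<otimes> y) = 0"
  shows "cinner v (x \<otimes> y) = 0"
proof -
  have "adj (tens_right y) v = 0"
    by (rule eq_zero_if_orthogonal_dense[OF assms(1)]) (simp add: cinner_adj_left assms(2))
  then show ?thesis
    using cinner_adj_left[of "tens_right y" v x] by simp
qed

lemma orthogonal_tens_left:
  assumes "closure (span S) = UNIV" "\<And>s. s \<in> S \<Longrightarrow> cinner v (x \<otimes> s) = 0"
  shows "cinner v (x \<otimes> y) = 0"
proof -
  have "adj (tens_left x) v = 0"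
    by (rule eq_zero_if_orthogonal_dense[OF assms(1)]) (simp add: cinner_adj_left assms(2))
  then show ?thesis
    using cinner_adj_left[of "tens_left x" v y] by simp
qed

text \<open>Complex multiples of the basis vectors are included because the span is only
  real.\<close>

lemma closure_span_onb: "closure (span {c *\<^sub>C e |c e. e \<in> onb}) = (UNIV :: 'a::chilbert_space set)"
proof (rule dense_span_complexI)
  fix v :: 'a assume v: "\<And>s. s \<in> {c *\<^sub>C e |c e. e \<in> onb} \<Longrightarrow> cinner v s = 0"
  show "v = 0"
  proof (rule onb_total)
    fix e :: 'a assume "e \<in> onb"
    then have "cinner v (1 *\<^sub>C e) = 0" by (intro v) blast
    then show "cinner e v = 0" using cinner_commute[of e v] by simp
  qed
qed (use scaleC_scaleC in blast)

subsection \<open>The flip\<close>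

lemma flip_tens [simp]:
  fixes x :: "'a::chilbert_space" and y :: "'b::chilbert_space"
  shows "flip (x \<otimes> y) = y \<otimes> x"
proof -
  let ?E = "{(x \<otimes> y, y \<otimes> x) |x y. True} :: (('a, 'b) tensor \<times> ('b, 'a) tensor) set"
  have "fst ` ?E = {x \<otimes> y |x y. True}"
    by force
  then have "closure (span (fst ` ?E)) = UNIV"
    by (simp only: closure_span_tens)
  then obtain R :: "('a, 'b) tensor \<Rightarrow>\<^sub>L ('b, 'a) tensor" where R: "\<And>v w. (v, w) \<in> ?E \<Longrightarrow> R v = w"
    by (rule isometric_extension) (auto simp: inner_eq_Re_cinner cinner_tens)
  then have R: "R (x \<otimes> y) = y \<otimes> x" for x y
    by blast
  have eq: "flip = R"
    unfolding flip_def by (rule the_equality) (auto intro!: tens_eqI simp: R)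
  show ?thesis unfolding eq by (rule R)
qed

lemma complex_op_flip [simp]: "complex_op flip"
  by (rule complex_op_tensI) (simp add: tens_scaleC_right)

lemma flip_compose_flip [simp]: "flip o\<^sub>L flip = id_blinfun"
  by (rule tens_eqI) simp

lemma flip_flip [simp]: "flip (flip v) = v"
  by (metis blinfun_apply_blinfun_compose blinfun_apply_id_blinfun flip_compose_flip)

lemma adj_flip [simp]: "adj flip = flip"
  by (rule tens_eqI, rule cinner_tens_eqI) (simp add: cinner_adj_left cinner_tens)

lemma unitary_op_flip [simp]: "unitary_op flip"
  by (rule unitary_opI) simp_all

subsection \<open>Tensor products of operators\<close>

lemma cinner_sum_tens_onb:
  fixes x y :: "'b::chilbert_space \<Rightarrow> 'a::chilbert_space"
  assumes "finite F" "F \<subseteq> onb"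
  shows "cinner (\<Sum>f\<in>F. x f \<otimes> f) (\<Sum>f\<in>F. y f \<otimes> f) = (\<Sum>f\<in>F. cinner (x f) (y f))"
proof -
  have "cinner (x f) (y g) * cinner f g = (if f = g then cinner (x f) (y g) else 0)"
    if "f \<in> F" "g \<in> F" for f g
    using that assms onb[where 'a = 'b] by (auto simp: orthonormal_def subset_iff)
  then show ?thesis
    using assms(1) by (simp add: cinner_sum_left cinner_sum_right cinner_tens cong: sum.cong)
qed

text \<open>Pythagoras: with distinct basis vectors in the second leg the summands are orthogonal,
  so \<open>S\<close> can be estimated term by term.\<close>

lemma norm_sum_tens_onb_le:
  fixes x :: "'b::chilbert_space \<Rightarrow> 'a::chilbert_space" and S :: "'a \<Rightarrow>\<^sub>L 'c::chilbert_space"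
  assumes "finite F" "F \<subseteq> onb"
  shows "norm (\<Sum>f\<in>F. S (x f) \<otimes> f) \<le> norm S * norm (\<Sum>f\<in>F. x f \<otimes> f)"
proof (rule power2_le_imp_le)
  have norm_eq: "(norm (\<Sum>f\<in>F. y f \<otimes> f))\<^sup>2 = (\<Sum>f\<in>F. (norm (y f))\<^sup>2)"
    for y :: "'b \<Rightarrow> 'd::chilbert_space"
  proof -
    have "complex_of_real ((norm (\<Sum>f\<in>F. y f \<otimes> f))\<^sup>2) = complex_of_real (\<Sum>f\<in>F. (norm (y f))\<^sup>2)"
      unfolding cinner_self[symmetric] cinner_sum_tens_onb[OF assms] of_real_sum by (simp add: cinner_self)
    then show ?thesis by (simp only: of_real_eq_iff)
  qed
  have "(\<Sum>f\<in>F. (norm (S (x f)))\<^sup>2) \<le> (\<Sum>f\<in>F. (norm S * norm (x f))\<^sup>2)"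
    by (intro sum_mono power_mono norm_blinfun) simp
  then show "(norm (\<Sum>f\<in>F. S (x f) \<otimes> f))\<^sup>2 \<le> (norm S * norm (\<Sum>f\<in>F. x f \<otimes> f))\<^sup>2"
    by (simp add: norm_eq power_mult_distrib sum_distrib_left)
qed simp

text \<open>The difficulty is boundedness on arbitrary combinations of elementary tensors.
  Restricting the second leg to an orthonormal basis gives every element of the span a
  representation with distinct, hence orthogonal, second legs. Arbitrary second legs are recovered
  afterwards by density.\<close>

lemma op_tens_id_exists:
  fixes S :: "'a::chilbert_space \<Rightarrow>\<^sub>L 'c::chilbert_space"
  assumes S: "complex_op S"
  obtains R :: "('a, 'b::chilbert_space) tensor \<Rightarrow>\<^sub>L ('c, 'b) tensor"
  where "\<And>x y. R (x \<otimes> y) = S x \<otimes> y" "norm R \<le> norm S"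
proof -
  define E where "E = {(x \<otimes> f, S x \<otimes> f) |x f. f \<in> (onb :: 'b set)}"
  have rep: "\<exists>F x. finite F \<and> F \<subseteq> onb \<and> p = (\<Sum>f\<in>F. x f \<otimes> f, \<Sum>f\<in>F. S (x f) \<otimes> f)"
    if "p \<in> span E" for p
    using that
  proof (induction rule: span_induct_alt)
    case base
    show ?case by (rule exI[of _ "{}"]) (simp add: zero_prod_def)
  next
    case (step c q p)
    obtain y g where q: "q = (y \<otimes> g, S y \<otimes> g)" "g \<in> onb"
      using step(1) unfolding E_def by blast
    obtain F x where p: "finite F" "F \<subseteq> onb" "p = (\<Sum>f\<in>F. x f \<otimes> f, \<Sum>f\<in>F. S (x f) \<otimes> f)"
      using step(2) by blast
    \<comment> \<open>The new term is merged with the old one if \<open>g\<close> already occurs in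
      \<open>F\<close>, so that the second legs stay distinct.\<close>
    define x' where "x' f = (if f = g then c *\<^sub>R y else 0) + (if f \<in> F then x f else 0)" for f
    have sum: "(\<Sum>f\<in>insert g F. T (x' f) \<otimes> f) = c *\<^sub>R (T y \<otimes> g) + (\<Sum>f\<in>F. T (x f) \<otimes> f)"
      for T :: "'a \<Rightarrow>\<^sub>L 'd::chilbert_space"
    proof -
      have "T (x' f) \<otimes> f = (if f = g then c *\<^sub>R (T y \<otimes> g) else 0) + (if f \<in> F then T (x f) \<otimes> f else 0)" for f
        by (simp add: x'_def blinfun.add_right blinfun.scaleR_right tens_add_left tens_scaleR_left)
      moreover have "(\<Sum>f\<in>insert g F. if f \<in> F then T (x f) \<otimes> f else 0) = (\<Sum>f\<in>F. T (x f) \<otimes> f)"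
        using p(1) by (intro sum.mono_neutral_cong_right) auto
      ultimately show ?thesis
        using p(1) by (simp add: sum.distrib sum.delta)
    qed
    have "c *\<^sub>R q + p = (\<Sum>f\<in>insert g F. x' f \<otimes> f, \<Sum>f\<in>insert g F. S (x' f) \<otimes> f)"
      using sum[of S] sum[of id_blinfun] by (simp add: q p(3))
    then show ?case
      using p(1,2) q(2) by (intro exI[of _ "insert g F"] exI[of _ x']) auto
  qed
  have "fst ` E = {x \<otimes> f |x f. f \<in> onb}"
    unfolding E_def by force
  moreover have "closure (span {x \<otimes> f |(x :: 'a) f. f \<in> (onb :: 'b set)}) = UNIV"
  proof (rule dense_span_complexI)
    fix v :: "('a, 'b) tensor" assume v: "\<And>s. s \<in> {x \<otimes> f |x f. f \<in> onb} \<Longrightarrow> cinner v s = 0"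
    have *: "cinner v (x \<otimes> (c *\<^sub>C f)) = 0" if "f \<in> onb" for x c f
    proof -
      have "cinner v ((c *\<^sub>C x) \<otimes> f) = 0" by (rule v) (use that in blast)
      then show ?thesis by (simp add: tens_scaleC_left tens_scaleC_right)
    qed
    have "cinner v (x \<otimes> y) = 0" for x y
      by (rule orthogonal_tens_left[OF closure_span_onb]) (use * in auto)
    then show "v = 0" by (rule tens_orthogonal)
  next
    fix s assume "s \<in> {x \<otimes> f |(x :: 'a) f. f \<in> (onb :: 'b set)}"
    then show "\<i> *\<^sub>C s \<in> {x \<otimes> f |x f. f \<in> onb}"
      using tens_scaleC_left[symmetric] by blast
  qed
  moreover have "fst ` span E = span (fst ` E)"
    by (rule linear_span_image[symmetric]) (simp add: linear_fst)
  ultimately have dense: "closure (fst ` span E) = UNIV"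
    by simp
  have bound: "norm w \<le> norm S * norm v" if "(v, w) \<in> span E" for v w
    using rep[OF that] norm_sum_tens_onb_le by blast
  obtain R :: "('a, 'b) tensor \<Rightarrow>\<^sub>L ('c, 'b) tensor"
    where R: "\<And>v w. (v, w) \<in> span E \<Longrightarrow> R v = w" "norm R \<le> norm S"
    using bounded_graph_extension[OF subspace_span dense norm_ge_zero bound] by metis
  have onb: "R (x \<otimes> f) = S x \<otimes> f" if "f \<in> onb" for x f
    by (rule R(1), rule span_base) (use that in \<open>auto simp: E_def\<close>)
  have "R o\<^sub>L tens_left x = tens_left (S x)" for x
  proof (rule blinfun_eq_on_dense[OF closure_span_onb])
    fix s assume "s \<in> {c *\<^sub>C e |c e. e \<in> (onb :: 'b set)}"
    then obtain c e where s: "s = c *\<^sub>C e" "e \<in> onb" by blast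
    \<comment> \<open>Complex scalars of the second leg are moved to the first one, where
      \<open>S\<close> commutes with them; this is where complex linearity of \<open>S\<close>
      enters.\<close>
    have "R (x \<otimes> (c *\<^sub>C e)) = R ((c *\<^sub>C x) \<otimes> e)"
      by (simp add: tens_scaleC_left tens_scaleC_right)
    also have "\<dots> = c *\<^sub>C (S x \<otimes> e)"
      by (simp only: onb[OF s(2)] complex_opD[OF S], simp only: tens_scaleC_left)
    finally show "(R o\<^sub>L tens_left x) s = tens_left (S x) s"
      by (simp add: s(1) tens_scaleC_right)
  qed
  then have "(R o\<^sub>L tens_left x) y = tens_left (S x) y" for x y
    by simp
  then show thesis
    using R(2) by (intro that) simp_all
qed

lemma op_tens_eqI:
  fixes R :: "('a::chilbert_space, 'b::chilbert_space) tensor \<Rightarrow>\<^sub>L ('c::chilbert_space, 'd::chilbert_space) tensor"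
    and S :: "'a \<Rightarrow>\<^sub>L 'c" and T :: "'b \<Rightarrow>\<^sub>L 'd"
  assumes "\<And>x y. R (x \<otimes> y) = S x \<otimes> T y"
  shows "S \<otimes>\<^sub>o T = R"
  unfolding op_tens_def by (rule the_equality) (auto intro: tens_eqI simp: assms)

text \<open>Existence behind the definite description of \<open>\<otimes>\<^sub>o\<close>: the
  operator is the product of \<open>S\<close> acting on the first leg with the flip conjugate of
  \<open>T\<close> acting on a first leg, so one-sided amplifications suffice.\<close>

lemma op_tens_tens [simp]:
  fixes S :: "'a::chilbert_space \<Rightarrow>\<^sub>L 'c::chilbert_space" and T :: "'b::chilbert_space \<Rightarrow>\<^sub>L 'd::chilbert_space"
  assumes "complex_op S" "complex_op T"
  shows "(S \<otimes>\<^sub>o T) (x \<otimes> y) = S x \<otimes> T y"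
proof -
  obtain R1 :: "('a, 'd) tensor \<Rightarrow>\<^sub>L ('c, 'd) tensor" where R1: "\<And>x y. R1 (x \<otimes> y) = S x \<otimes> y"
    using op_tens_id_exists[OF assms(1)] by metis
  obtain R2 :: "('b, 'a) tensor \<Rightarrow>\<^sub>L ('d, 'a) tensor" where R2: "\<And>x y. R2 (x \<otimes> y) = T x \<otimes> y"
    using op_tens_id_exists[OF assms(2)] by metis
  have "S \<otimes>\<^sub>o T = R1 o\<^sub>L flip o\<^sub>L R2 o\<^sub>L flip"
    by (rule op_tens_eqI) (simp add: R1 R2)
  then show ?thesis by (simp add: R1 R2)
qed

lemma norm_op_tens_id_le: "complex_op S \<Longrightarrow> norm (S \<otimes>\<^sub>o id_blinfun) \<le> norm S"
  by (metis op_tens_id_exists op_tens_eqI id_blinfun.rep_eq)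

lemma complex_op_op_tens [simp]: "complex_op S \<Longrightarrow> complex_op T \<Longrightarrow> complex_op (S \<otimes>\<^sub>o T)"
  by (rule complex_op_tensI) (simp add: complex_opD, simp add: tens_scaleC_left)

lemma op_tens_compose:
  assumes "complex_op S" "complex_op T" "complex_op S'" "complex_op T'"
  shows "(S \<otimes>\<^sub>o T) o\<^sub>L (S' \<otimes>\<^sub>o T') = (S o\<^sub>L S') \<otimes>\<^sub>o (T o\<^sub>L T')"
  by (rule tens_eqI) (simp add: assms)

lemma op_tens_id_id [simp]: "id_blinfun \<otimes>\<^sub>o id_blinfun = id_blinfun"
  by (rule op_tens_eqI) simp

lemma adj_op_tens: "complex_op S \<Longrightarrow> complex_op T \<Longrightarrow> adj (S \<otimes>\<^sub>o T) = adj S \<otimes>\<^sub>o adj T"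
  by (rule tens_eqI, rule cinner_tens_eqI) (simp add: cinner_adj_left cinner_tens)

lemma unitary_op_id_tens_flip [simp]: "unitary_op (id_blinfun \<otimes>\<^sub>o flip)"
  unfolding unitary_op_def by (simp add: adj_op_tens op_tens_compose)

lemma id_tens_flip_twice [simp]: "(id_blinfun \<otimes>\<^sub>o flip) ((id_blinfun \<otimes>\<^sub>o flip) v) = v"
  using unitary_opD(4)[OF unitary_op_id_tens_flip] by (simp add: adj_op_tens)

lemma flip_op_tens_flip:
  "complex_op S \<Longrightarrow> complex_op T \<Longrightarrow> flip o\<^sub>L (S \<otimes>\<^sub>o T) o\<^sub>L flip = T \<otimes>\<^sub>o S"
  by (rule tens_eqI) simp

subsection \<open>Triple tensor products and leg numbering\<close>

lemma tens3_left_orthogonal: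
  assumes "\<And>x y z. cinner v ((x \<otimes> y) \<otimes> z) = 0"
  shows "v = 0"
proof (rule tens_orthogonal)
  show "cinner v (w \<otimes> z) = 0" for w z
    by (rule orthogonal_tens_right[OF closure_span_tens]) (use assms in auto)
qed

lemma tens3_orthogonal:
  assumes "\<And>x y z. cinner v (x \<otimes> y \<otimes> z) = 0"
  shows "v = 0"
proof (rule tens_orthogonal)
  show "cinner v (x \<otimes> w) = 0" for x w
    by (rule orthogonal_tens_left[OF closure_span_tens]) (use assms in auto)
qed

lemma closure_span_tens3: "closure (span {x \<otimes> y \<otimes> z |x y z. True}) = UNIV"
  by (rule dense_span_complexI)
    (blast intro: tens3_orthogonal, use tens_scaleC_left[symmetric] in blast)

lemma closure_span_tens3_left: "closure (span {(x \<otimes> y) \<otimes> z |x y z. True}) = UNIV"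
proof (rule dense_span_complexI)
  fix s :: "(('a, 'b) tensor, 'c) tensor" assume "s \<in> {(x \<otimes> y) \<otimes> z |x y z. True}"
  then show "\<i> *\<^sub>C s \<in> {(x \<otimes> y) \<otimes> z |x y z. True}"
    using tens_scaleC_right[symmetric] by blast
qed (blast intro: tens3_left_orthogonal)

lemma tens3_eqI:
  fixes A B :: "('a::chilbert_space, ('b::chilbert_space, 'c::chilbert_space) tensor) tensor
    \<Rightarrow>\<^sub>L 'd::real_normed_vector"
  assumes "\<And>x y z. A (x \<otimes> y \<otimes> z) = B (x \<otimes> y \<otimes> z)"
  shows "A = B"
  by (rule blinfun_eq_on_dense[OF closure_span_tens3]) (use assms in auto)

lemma tens3_left_eqI:
  fixes A B :: "(('a::chilbert_space, 'b::chilbert_space) tensor, 'c::chilbert_space) tensor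
    \<Rightarrow>\<^sub>L 'd::real_normed_vector"
  assumes "\<And>x y z. A ((x \<otimes> y) \<otimes> z) = B ((x \<otimes> y) \<otimes> z)"
  shows "A = B"
  by (rule blinfun_eq_on_dense[OF closure_span_tens3_left]) (use assms in auto)

lemma assoc_tens [simp]:
  fixes x :: "'a::chilbert_space" and y :: "'b::chilbert_space" and z :: "'c::chilbert_space"
  shows "assoc ((x \<otimes> y) \<otimes> z) = x \<otimes> y \<otimes> z"
proof -
  let ?E = "{((x \<otimes> y) \<otimes> z, x \<otimes> y \<otimes> z) |x y z. True}
    :: ((('a, 'b) tensor, 'c) tensor \<times> ('a, ('b, 'c) tensor) tensor) set"
  have "fst ` ?E = {(x \<otimes> y) \<otimes> z |x y z. True}"
    by force
  then have "closure (span (fst ` ?E)) = UNIV"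
    by (simp only: closure_span_tens3_left)
  then obtain R :: "(('a, 'b) tensor, 'c) tensor \<Rightarrow>\<^sub>L ('a, ('b, 'c) tensor) tensor"
    where R: "\<And>v w. (v, w) \<in> ?E \<Longrightarrow> R v = w"
    by (rule isometric_extension) (auto simp: inner_eq_Re_cinner cinner_tens mult.assoc)
  then have R: "R ((x \<otimes> y) \<otimes> z) = x \<otimes> y \<otimes> z" for x y z
    by blast
  have eq: "assoc = R"
    unfolding assoc_def by (rule the_equality) (auto intro!: tens3_left_eqI simp: R)
  show ?thesis unfolding eq by (rule R)
qed

lemma complex_op_assoc [simp]: "complex_op assoc"
proof (rule complex_op_tensI)
  fix c and w :: "('a, 'b) tensor" and z :: 'c
  have "complex_op (assoc o\<^sub>L tens_right z :: ('a, 'b) tensor \<Rightarrow>\<^sub>L ('a, ('b, 'c) tensor) tensor)"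
    by (rule complex_op_tensI) (simp, simp add: tens_scaleC_left)
  then show "assoc ((c *\<^sub>C w) \<otimes> z) = c *\<^sub>C assoc (w \<otimes> z)"
    using complex_opD[of "assoc o\<^sub>L tens_right z" c w] by simp
qed

lemma adj_assoc_tens [simp]: "adj assoc (x \<otimes> y \<otimes> z) = (x \<otimes> y) \<otimes> z"
proof -
  have "adj assoc (x \<otimes> y \<otimes> z) - (x \<otimes> y) \<otimes> z = 0"
    by (rule tens3_left_orthogonal) (simp add: cinner_diff_left cinner_adj_left cinner_tens)
  then show ?thesis by simp
qed

lemma unitary_op_assoc [simp]: "unitary_op assoc"
  unfolding unitary_op_def by (auto intro!: tens3_left_eqI tens3_eqI)

lemma adj_assoc_assoc [simp]: "adj assoc (assoc v) = v" "assoc (adj assoc w) = w"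
  using unitary_opD[OF unitary_op_assoc] by auto

text \<open>
  \<open>put\<^sub>i\<^sub>j\<close> inserts a fixed vector into the remaining leg; it intertwines an operator with its
  leg-numbered version.
\<close>

definition put12 :: "'c::chilbert_space \<Rightarrow>
    ('a::chilbert_space, 'b::chilbert_space) tensor \<Rightarrow>\<^sub>L ('a, ('b, 'c) tensor) tensor"
  where "put12 z = assoc o\<^sub>L tens_right z"

definition put13 :: "'b::chilbert_space \<Rightarrow>
    ('a::chilbert_space, 'c::chilbert_space) tensor \<Rightarrow>\<^sub>L ('a, ('b, 'c) tensor) tensor"
  where "put13 y = (id_blinfun \<otimes>\<^sub>o flip) o\<^sub>L put12 y"

lemma complex_op_put [simp]: "complex_op (put12 z)" "complex_op (put13 y)"
  by (simp_all add: put12_def put13_def)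

lemma put_tens [simp]:
  "put12 z (x \<otimes> y) = x \<otimes> y \<otimes> z" "put13 y (x \<otimes> z) = x \<otimes> y \<otimes> z"
  by (simp_all add: put12_def put13_def)

lemma leg_put [simp]:
  assumes "complex_op T"
  shows "leg12 T (put12 z w) = put12 z (T w)" "leg13 T (put13 z w) = put13 z (T w)"
    "leg23 T (x \<otimes> w) = x \<otimes> T w"
  using assms by (simp_all add: leg12_def leg13_def leg23_def put12_def put13_def)

lemma leg12_tens: "complex_op T \<Longrightarrow> leg12 T (x \<otimes> y \<otimes> z) = put12 z (T (x \<otimes> y))"
  using leg_put(1)[of T z "x \<otimes> y"] by simp

lemma leg13_tens: "complex_op T \<Longrightarrow> leg13 T (x \<otimes> y \<otimes> z) = put13 y (T (x \<otimes> z))"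
  using leg_put(2)[of T y "x \<otimes> z"] by simp

lemmas leg_tens = leg12_tens leg13_tens

lemma complex_op_leg [simp]:
  "complex_op T \<Longrightarrow> complex_op (leg12 T)" "complex_op T \<Longrightarrow> complex_op (leg13 T)"
  "complex_op T \<Longrightarrow> complex_op (leg23 T)"
  by (simp_all add: leg12_def leg13_def leg23_def)

lemma leg_compose:
  assumes "complex_op S" "complex_op T"
  shows "leg12 (S o\<^sub>L T) = leg12 S o\<^sub>L leg12 T" "leg13 (S o\<^sub>L T) = leg13 S o\<^sub>L leg13 T"
    "leg23 (S o\<^sub>L T) = leg23 S o\<^sub>L leg23 T"
  by (rule tens3_eqI; simp add: assms leg_tens)+

lemma leg_id [simp]:
  "leg12 id_blinfun = id_blinfun" "leg13 id_blinfun = id_blinfun" "leg23 id_blinfun = id_blinfun"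
  by (rule tens3_eqI; simp add: leg_tens)+

lemma adj_leg:
  assumes "complex_op T"
  shows "adj (leg12 T) = leg12 (adj T)" "adj (leg13 T) = leg13 (adj T)" "adj (leg23 T) = leg23 (adj T)"
  using assms
  by (simp_all add: leg12_def leg13_def leg23_def adj_compose adj_op_tens blinfun_compose_assoc)

lemma unitary_op_leg:
  assumes "unitary_op U"
  shows "unitary_op (leg12 U)" "unitary_op (leg13 U)" "unitary_op (leg23 U)"
  using unitary_opD[OF assms] unfolding unitary_op_def
  by (simp_all add: adj_leg leg_compose[symmetric])

lemma leg_add:
  assumes "complex_op S" "complex_op T"
  shows "leg12 (S + T) = leg12 S + leg12 T" "leg13 (S + T) = leg13 S + leg13 T"
  by (rule tens3_eqI; simp add: assms leg_tens complex_op_add blinfun.add_left blinfun.add_right tens_add_right)+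

text \<open>The homomorphisms on \<open>alg_tens\<close> are described as continuous maps, so their
  candidates, built from legs, must be continuous. Amplification is contractive on complex-linear
  operators, the ones on which \<open>\<otimes>\<^sub>o\<close> is under control; hence the
  restriction to \<open>D\<close>.\<close>

lemma continuous_on_leg:
  fixes D :: "(('a::chilbert_space, 'b::chilbert_space) tensor \<Rightarrow>\<^sub>L ('a, 'b) tensor) set"
  assumes "D \<subseteq> {T. complex_op T}"
  shows "continuous_on D (leg12 :: _ \<Rightarrow> ('a, ('b, 'c::chilbert_space) tensor) tensor \<Rightarrow>\<^sub>L _)" (is ?thesis12)
    and "continuous_on D (leg13 :: _ \<Rightarrow> ('a, ('c, 'b) tensor) tensor \<Rightarrow>\<^sub>L _)" (is ?thesis13)
proof -
  have "dist (S \<otimes>\<^sub>o id_blinfun) (T \<otimes>\<^sub>o id_blinfun :: (('a, 'b) tensor, 'c) tensor \<Rightarrow>\<^sub>L _)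
      \<le> 1 * dist S T" if "S \<in> D" "T \<in> D" for S T
  proof -
    have S: "complex_op S" and T: "complex_op T" and ST: "complex_op (S - T)"
      using assms that subspace_diff[OF subspace_complex_op] by auto
    have "(S - T) \<otimes>\<^sub>o id_blinfun
        = S \<otimes>\<^sub>o id_blinfun - (T \<otimes>\<^sub>o id_blinfun :: (('a, 'b) tensor, 'c) tensor \<Rightarrow>\<^sub>L _)"
      by (rule op_tens_eqI)
        (simp add: S T blinfun.diff_left bounded_bilinear.diff_left[OF bounded_bilinear_tens])
    from this[symmetric] show ?thesis
      unfolding dist_norm mult_1 by (simp only: norm_op_tens_id_le[OF ST])
  qed
  then have "1-lipschitz_on D (\<lambda>T. T \<otimes>\<^sub>o id_blinfun :: (('a, 'b) tensor, 'c) tensor \<Rightarrow>\<^sub>L _)"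
    by (intro lipschitz_onI) auto
  then have c: "continuous_on D (\<lambda>T. T \<otimes>\<^sub>o id_blinfun :: (('a, 'b) tensor, 'c) tensor \<Rightarrow>\<^sub>L _)"
    by (rule lipschitz_on_continuous_on)
  note * = bounded_bilinear.continuous_on[OF bounded_bilinear_blinfun_compose _ continuous_on_const]
    bounded_bilinear.continuous_on[OF bounded_bilinear_blinfun_compose continuous_on_const]
  show ?thesis12
    unfolding leg12_def by (intro * c)
  show ?thesis13
    unfolding leg13_def leg12_def by (intro * c)
qed

subsection \<open>Permutations of the legs\<close>

definition rot :: "('a::chilbert_space, ('b::chilbert_space, 'c::chilbert_space) tensor) tensor
    \<Rightarrow>\<^sub>L ('b, ('c, 'a) tensor) tensor"
  where "rot = assoc o\<^sub>L flip"

definition rev_legs :: "('a::chilbert_space, ('b::chilbert_space, 'c::chilbert_space) tensor) tensor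
    \<Rightarrow>\<^sub>L ('c, ('b, 'a) tensor) tensor"
  where "rev_legs = assoc o\<^sub>L flip o\<^sub>L (id_blinfun \<otimes>\<^sub>o flip)"

lemma rot_tens [simp]: "rot (x \<otimes> y \<otimes> z) = y \<otimes> z \<otimes> x"
  by (simp add: rot_def)

lemma rev_legs_tens [simp]: "rev_legs (x \<otimes> y \<otimes> z) = z \<otimes> y \<otimes> x"
  by (simp add: rev_legs_def)

lemma unitary_op_rot [simp]: "unitary_op rot"
  by (simp add: rot_def unitary_op_compose)

lemma unitary_op_rev_legs [simp]: "unitary_op rev_legs"
  by (simp add: rev_legs_def unitary_op_compose)

lemma complex_op_flip_alg [simp]: "complex_op T \<Longrightarrow> complex_op (flip_alg T)"
  by (simp add: flip_alg_def)

lemma flip_alg_tens [simp]: "flip_alg T (x \<otimes> y) = flip (T (y \<otimes> x))"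
  by (simp add: flip_alg_def)

lemma perm_put:
  "rot (put12 z w) = put13 z (flip w)" "rot (put13 y v) = y \<otimes> flip v" "rot (x \<otimes> u) = put12 x u"
  "rev_legs (put12 z w) = z \<otimes> flip w" "rev_legs (put13 y v) = put13 y (flip v)"
  "rev_legs (x \<otimes> u) = put12 x (flip u)"
proof -
  have "rot o\<^sub>L put12 z = put13 z o\<^sub>L flip" "rot o\<^sub>L put13 y = tens_left y o\<^sub>L flip" "rot o\<^sub>L tens_left x = put12 x"
    "rev_legs o\<^sub>L put12 z = tens_left z o\<^sub>L flip" "rev_legs o\<^sub>L put13 y = put13 y o\<^sub>L flip"
    "rev_legs o\<^sub>L tens_left x = put12 x o\<^sub>L flip"
    by (rule tens_eqI; simp)+
  from this[THEN arg_cong, of "\<lambda>T. blinfun_apply T _"] show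
    "rot (put12 z w) = put13 z (flip w)" "rot (put13 y v) = y \<otimes> flip v" "rot (x \<otimes> u) = put12 x u"
    "rev_legs (put12 z w) = z \<otimes> flip w" "rev_legs (put13 y v) = put13 y (flip v)"
    "rev_legs (x \<otimes> u) = put12 x (flip u)"
    by simp_all
qed

text \<open>Moving the first leg to the end reverses the order of the two active legs exactly when
  the first leg is one of them. Thus \<open>leg23 T\<close> is relocated without a flip.\<close>

lemma rot_leg:
  assumes "complex_op T"
  shows "rot o\<^sub>L leg12 T = leg13 (flip_alg T) o\<^sub>L rot" "rot o\<^sub>L leg13 T = leg23 (flip_alg T) o\<^sub>L rot"
    "rot o\<^sub>L leg23 T = leg12 T o\<^sub>L rot"
  by (rule tens3_eqI; simp add: assms leg_tens perm_put)+

lemma rev_leg: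
  assumes "complex_op T"
  shows "rev_legs o\<^sub>L leg12 T = leg23 (flip_alg T) o\<^sub>L rev_legs"
    "rev_legs o\<^sub>L leg13 T = leg13 (flip_alg T) o\<^sub>L rev_legs"
    "rev_legs o\<^sub>L leg23 T = leg12 (flip_alg T) o\<^sub>L rev_legs"
  by (rule tens3_eqI; simp add: assms leg_tens perm_put)+

section \<open>Slices and nondegeneracy\<close>

lemma norm_adj_le:
  assumes "complex_op T"
  shows "norm (adj T) \<le> norm T"
proof (rule norm_blinfun_bound)
  fix y
  show "norm (adj T y) \<le> norm T * norm y"
  proof (cases "adj T y = 0")
    case False
    have "complex_of_real ((norm (adj T y))\<^sup>2) = cinner y (T (adj T y))"
      unfolding cinner_self[symmetric] by (rule cinner_adj_left[OF assms])
    then have "(norm (adj T y))\<^sup>2 \<le> norm y * norm (T (adj T y))"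
      using norm_cinner_le[of y "T (adj T y)"] by (metis norm_of_real abs_of_nonneg zero_le_power2)
    also have "\<dots> \<le> norm y * (norm T * norm (adj T y))"
      by (intro mult_left_mono norm_blinfun) simp
    finally have "norm (adj T y) * norm (adj T y) \<le> (norm T * norm y) * norm (adj T y)"
      by (simp add: power2_eq_square mult_ac)
    then show ?thesis using False by simp
  qed simp
qed simp

lemma norm_mult_le_sum_squares: "norm x * norm y \<le> (norm x)\<^sup>2 + (norm y)\<^sup>2"
proof -
  have "0 \<le> norm x * norm y" by simp
  then show ?thesis
    using sum_squares_bound[of "norm x" "norm y"] by linarith
qed

text \<open>A normal functional is a series of vector functionals, so its slice is the series of the
  compressions of \<open>T\<close> by \<open>tens_left (x n)\<close> and
  \<open>tens_left (y n)\<close>. Square summability of both sequences makes it converge absolutely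
  in norm.\<close>

lemma slice_exists:
  fixes T :: "('a::chilbert_space, 'b::chilbert_space) tensor \<Rightarrow>\<^sub>L ('a, 'b) tensor"
  assumes T: "complex_op T" and "normal_functional \<omega>"
  obtains S :: "'b \<Rightarrow>\<^sub>L 'b" where "complex_op S"
    "\<And>\<xi> \<eta>. cinner \<xi> (S \<eta>) = \<omega> (adj (tens_right \<xi>) o\<^sub>L T o\<^sub>L tens_right \<eta>)"
proof -
  obtain x y :: "nat \<Rightarrow> 'a" where xy: "summable (\<lambda>n. (norm (x n))\<^sup>2)" "summable (\<lambda>n. (norm (y n))\<^sup>2)"
    and \<omega>: "\<omega> = (\<lambda>T. \<Sum>n. cinner (x n) (T (y n)))"
    using assms(2) unfolding normal_functional_def by blast
  define s where "s n = adj (tens_left (x n)) o\<^sub>L T o\<^sub>L tens_left (y n)" for n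
  have "norm (s n) \<le> norm T * ((norm (x n))\<^sup>2 + (norm (y n))\<^sup>2)" for n
  proof -
    have "norm (s n) \<le> norm (adj (tens_left (x n)) o\<^sub>L T) * norm (tens_left (y n) :: 'b \<Rightarrow>\<^sub>L _)"
      unfolding s_def by (rule norm_blinfun_compose)
    also have "\<dots> \<le> (norm (adj (tens_left (x n) :: 'b \<Rightarrow>\<^sub>L _)) * norm T) * norm (y n)"
      by (intro mult_mono norm_blinfun_compose norm_tens_left) auto
    also have "\<dots> \<le> (norm (x n) * norm T) * norm (y n)"
      by (intro mult_right_mono order_trans[OF norm_adj_le norm_tens_left]) auto
    also have "\<dots> = norm T * (norm (x n) * norm (y n))"
      by simp
    also have "\<dots> \<le> norm T * ((norm (x n))\<^sup>2 + (norm (y n))\<^sup>2)"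
      by (intro mult_left_mono norm_mult_le_sum_squares) simp
    finally show ?thesis .
  qed
  then have "summable s"
    by (rule summable_comparison_test'[OF summable_mult[OF summable_add[OF xy]]])
  then have s: "s sums suminf s"
    by (rule summable_sums)
  have "complex_op (s n)" for n
    by (simp add: s_def T)
  then have "(\<Sum>i<n. s i) \<in> {S. complex_op S}" for n
    by (intro subspace_sum subspace_complex_op) auto
  then have "suminf s \<in> {S. complex_op S}"
    using closed_sequentially[OF closed_complex_op _ s[unfolded sums_def]] by blast
  moreover have "cinner \<xi> (suminf s \<eta>) = \<omega> (adj (tens_right \<xi>) o\<^sub>L T o\<^sub>L tens_right \<eta>)" for \<xi> \<eta>
  proof -
    have eq: "cinner \<xi> (s n \<eta>) = cinner (x n) ((adj (tens_right \<xi>) o\<^sub>L T o\<^sub>L tens_right \<eta>) (y n))" for n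
      by (simp add: s_def cinner_adj_right T)
    have "(\<lambda>n. cinner \<xi> (s n \<eta>)) sums cinner \<xi> (suminf s \<eta>)"
      using s by (intro bounded_linear.sums[OF bounded_linear_cinner_right]
          bounded_linear.sums[OF bounded_linear_apply_blinfun])
    then show ?thesis
      unfolding eq by (simp add: \<omega> sums_iff)
  qed
  ultimately show thesis using that by blast
qed

lemma
  fixes T :: "('a::chilbert_space, 'b::chilbert_space) tensor \<Rightarrow>\<^sub>L ('a, 'b) tensor"
  assumes "complex_op T" "normal_functional \<omega>"
  shows cinner_slice: "cinner \<xi> (slice \<omega> T \<eta>) = \<omega> (adj (tens_right \<xi>) o\<^sub>L T o\<^sub>L tens_right \<eta>)"
    and complex_op_slice: "complex_op (slice \<omega> T)"
proof -
  obtain S where S: "complex_op S"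
    "\<And>\<xi> \<eta>. cinner \<xi> (S \<eta>) = \<omega> (adj (tens_right \<xi>) o\<^sub>L T o\<^sub>L tens_right \<eta>)"
    using slice_exists[OF assms] by metis
  have "slice \<omega> T = S"
    unfolding slice_def
  proof (rule the_equality)
    fix S' :: "'b \<Rightarrow>\<^sub>L 'b"
    assume "\<forall>\<xi> \<eta>. cinner \<xi> (S' \<eta>) = \<omega> (adj (tens_right \<xi>) o\<^sub>L T o\<^sub>L tens_right \<eta>)"
    then have "cinner \<xi> (S' \<eta>) = cinner \<xi> (S \<eta>)" for \<xi> \<eta>
      by (simp only: S(2))
    then show "S' = S"
      by (intro blinfun_eqI cinner_eqI)
  qed (simp add: S(2))
  then show "cinner \<xi> (slice \<omega> T \<eta>) = \<omega> (adj (tens_right \<xi>) o\<^sub>L T o\<^sub>L tens_right \<eta>)"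
    "complex_op (slice \<omega> T)"
    using S by auto
qed

lemma cinner_scaleR_right: "cinner x (r *\<^sub>R y) = complex_of_real r * cinner x y"
  by (simp add: scaleR_scaleC cinner_scaleC_right)

lemma normal_functional_vector: "normal_functional (\<lambda>T. cinner x (T y))"
  unfolding normal_functional_def
proof (intro exI conjI)
  have "summable (\<lambda>n. (norm (if n = 0 then z else 0))\<^sup>2)" for z :: 'a
    by (rule summable_finite[of "{0}"]) auto
  then show "summable (\<lambda>n. (norm (if n = 0 then x else 0))\<^sup>2)"
    "summable (\<lambda>n. (norm (if n = 0 then y else 0))\<^sup>2)"
    by blast+
  have "(\<Sum>n::nat. cinner (if n = 0 then x else 0) (T (if n = 0 then y else 0))) = cinner x (T y)"
    for T :: "'a \<Rightarrow>\<^sub>L 'a"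
    by (subst suminf_finite[of "{0}"]) auto
  then show "(\<lambda>T. cinner x (blinfun_apply T y)) =
      (\<lambda>T. \<Sum>n::nat. cinner (if n = 0 then x else 0) (blinfun_apply T (if n = 0 then y else 0)))"
    by simp
qed

text \<open>The scalar is absorbed into \<open>y\<close>. Summability for each \<open>T\<close> is
  checked first, since only then may the factor be pulled through \<open>suminf\<close>.\<close>

lemma normal_functional_scaleR:
  assumes "normal_functional \<omega>"
  shows "normal_functional (\<lambda>T. complex_of_real r * \<omega> T)"
proof -
  obtain x y :: "nat \<Rightarrow> 'a" where xy: "summable (\<lambda>n. (norm (x n))\<^sup>2)" "summable (\<lambda>n. (norm (y n))\<^sup>2)"
    and \<omega>: "\<omega> = (\<lambda>T. \<Sum>n. cinner (x n) (T (y n)))"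
    using assms unfolding normal_functional_def by blast
  have summ: "summable (\<lambda>n. cinner (x n) (T (y n)))" for T :: "'a \<Rightarrow>\<^sub>L 'a"
  proof (rule summable_comparison_test')
    show "summable (\<lambda>n. norm T * ((norm (x n))\<^sup>2 + (norm (y n))\<^sup>2))"
      by (intro summable_mult summable_add xy)
    show "norm (cinner (x n) (T (y n))) \<le> norm T * ((norm (x n))\<^sup>2 + (norm (y n))\<^sup>2)" for n
    proof -
      have "norm (cinner (x n) (T (y n))) \<le> norm (x n) * norm (T (y n))"
        by (rule norm_cinner_le)
      also have "\<dots> \<le> norm (x n) * (norm T * norm (y n))"
        by (intro mult_left_mono norm_blinfun) simp
      also have "\<dots> = norm T * (norm (x n) * norm (y n))"
        by simp
      also have "\<dots> \<le> norm T * ((norm (x n))\<^sup>2 + (norm (y n))\<^sup>2)"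
        by (intro mult_left_mono norm_mult_le_sum_squares) simp
      finally show ?thesis .
    qed
  qed
  have "complex_of_real r * \<omega> T = (\<Sum>n. cinner (x n) (T (r *\<^sub>R y n)))" for T
    unfolding \<omega> suminf_mult[OF summ, symmetric]
    by (simp add: blinfun.scaleR_right cinner_scaleR_right)
  moreover have "summable (\<lambda>n. (norm (r *\<^sub>R y n))\<^sup>2)"
    using summable_mult[OF xy(2), of "r\<^sup>2"] by (simp add: power_mult_distrib)
  ultimately show ?thesis
    unfolding normal_functional_def using xy(1) by (intro exI[of _ x] exI[of _ "\<lambda>n. r *\<^sub>R y n"]) auto
qed

text \<open>Stated for arbitrary sets of operators, so that it applies to images of
  \<open>alg_tens\<close> under leg numbering and conjugation. The real span is adequate: ranges of
  complex-linear operators are closed under complex scalars.\<close>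

definition nondegenerate :: "('a::chilbert_space \<Rightarrow>\<^sub>L 'b::chilbert_space) set \<Rightarrow> bool"
  where "nondegenerate \<Phi> \<longleftrightarrow> closure (span {blinfun_apply T \<xi> |T \<xi>. T \<in> \<Phi>}) = UNIV"

lemma nondegenerateI:
  fixes \<Phi> :: "('a::chilbert_space \<Rightarrow>\<^sub>L 'b::chilbert_space) set"
  assumes "\<And>T. T \<in> \<Phi> \<Longrightarrow> complex_op T"
    and "\<And>v. (\<And>T \<xi>. T \<in> \<Phi> \<Longrightarrow> cinner v (T \<xi>) = 0) \<Longrightarrow> v = 0"
  shows "nondegenerate \<Phi>"
  unfolding nondegenerate_def
proof (rule dense_span_complexI)
  show "v = 0" if "\<And>s. s \<in> {blinfun_apply T \<xi> |T \<xi>. T \<in> \<Phi>} \<Longrightarrow> cinner v s = 0" for v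
    using that by (intro assms(2)) blast
  show "\<i> *\<^sub>C s \<in> {blinfun_apply T \<xi> |T \<xi>. T \<in> \<Phi>}" if "s \<in> {blinfun_apply T \<xi> |T \<xi>. T \<in> \<Phi>}" for s
    using that complex_opD[OF assms(1), symmetric] by blast
qed

lemma nondegenerate_orthogonal:
  assumes "nondegenerate \<Phi>" "\<And>T \<xi>. T \<in> \<Phi> \<Longrightarrow> cinner v (T \<xi>) = 0"
  shows "v = 0"
  by (rule eq_zero_if_orthogonal_dense[OF assms(1)[unfolded nondegenerate_def]]) (use assms(2) in auto)

lemma nondegenerate_eqI:
  fixes A B :: "'b::chilbert_space \<Rightarrow>\<^sub>L 'c::real_normed_vector"
  assumes "nondegenerate \<Phi>" "\<And>T. T \<in> \<Phi> \<Longrightarrow> A o\<^sub>L T = B o\<^sub>L T"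
  shows "A = B"
proof (rule blinfun_eq_on_dense[OF assms(1)[unfolded nondegenerate_def]])
  fix s assume "s \<in> {blinfun_apply T \<xi> |T \<xi>. T \<in> \<Phi>}"
  then obtain T \<xi> where T: "T \<in> \<Phi>" "s = T \<xi>" by blast
  show "A s = B s"
    using arg_cong[OF assms(2)[OF T(1)], of "\<lambda>S. S \<xi>"] by (simp add: T(2))
qed

lemma nondegenerate_conjugate:
  assumes "nondegenerate \<Phi>" "\<And>T. T \<in> \<Phi> \<Longrightarrow> complex_op T" "unitary_op U"
  shows "nondegenerate ((\<lambda>T. U o\<^sub>L T o\<^sub>L adj U) ` \<Phi>)"
proof (rule nondegenerateI)
  fix v assume v: "\<And>T \<xi>. T \<in> (\<lambda>T. U o\<^sub>L T o\<^sub>L adj U) ` \<Phi> \<Longrightarrow> cinner v (T \<xi>) = 0"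
  have "cinner (adj U v) (T \<xi>) = 0" if "T \<in> \<Phi>" for T \<xi>
    using v[OF imageI[OF that], of "U \<xi>"] unitary_opD[OF assms(3)] by (simp add: cinner_adj_left)
  then have "adj U v = 0"
    by (rule nondegenerate_orthogonal[OF assms(1)])
  then show "v = 0"
    using unitary_opD(5)[OF assms(3), of v] by simp
qed (use assms unitary_opD in auto)

text \<open>Filling the idle leg with a fixed vector intertwines \<open>T\<close> with its
  leg-numbered version; the adjoint of that filling map brings orthogonality back to the two-leg
  space, where \<open>\<Phi>\<close> is nondegenerate.\<close>

lemma nondegenerate_leg:
  fixes \<Phi> :: "(('a::chilbert_space, 'b::chilbert_space) tensor \<Rightarrow>\<^sub>L ('a, 'b) tensor) set"
  assumes "nondegenerate \<Phi>" and \<Phi>: "\<And>T. T \<in> \<Phi> \<Longrightarrow> complex_op T"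
  shows "nondegenerate (leg12 ` \<Phi>)" "nondegenerate (leg13 ` \<Phi>)" "nondegenerate (leg23 ` \<Phi>)"
proof -
  show "nondegenerate (leg12 ` \<Phi>)"
  proof (rule nondegenerateI)
    fix v assume v: "\<And>T \<xi>. T \<in> leg12 ` \<Phi> \<Longrightarrow> cinner v (T \<xi>) = 0"
    have "adj (put12 z) v = 0" for z
    proof (rule nondegenerate_orthogonal[OF assms(1)])
      show "cinner (adj (put12 z) v) (T w) = 0" if "T \<in> \<Phi>" for T w
        using v[OF imageI[OF that], of "put12 z w"] by (simp add: cinner_adj_left \<Phi>[OF that])
    qed
    then have "cinner v (put12 z w) = 0" for z w
      using cinner_adj_left[of "put12 z" v w] by simp
    then show "v = 0"
      by (intro tens3_orthogonal) (simp only: put_tens(1)[symmetric])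
  qed (use \<Phi> in auto)
  show "nondegenerate (leg13 ` \<Phi>)"
  proof (rule nondegenerateI)
    fix v assume v: "\<And>T \<xi>. T \<in> leg13 ` \<Phi> \<Longrightarrow> cinner v (T \<xi>) = 0"
    have "adj (put13 z) v = 0" for z
    proof (rule nondegenerate_orthogonal[OF assms(1)])
      show "cinner (adj (put13 z) v) (T w) = 0" if "T \<in> \<Phi>" for T w
        using v[OF imageI[OF that], of "put13 z w"] by (simp add: cinner_adj_left \<Phi>[OF that])
    qed
    then have "cinner v (put13 z w) = 0" for z w
      using cinner_adj_left[of "put13 z" v w] by simp
    then show "v = 0"
      by (intro tens3_orthogonal) (simp only: put_tens(2)[symmetric])
  qed (use \<Phi> in auto)
  show "nondegenerate (leg23 ` \<Phi>)"
  proof (rule nondegenerateI)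
    fix v assume v: "\<And>T \<xi>. T \<in> leg23 ` \<Phi> \<Longrightarrow> cinner v (T \<xi>) = 0"
    have "adj (tens_left z) v = 0" for z
    proof (rule nondegenerate_orthogonal[OF assms(1)])
      show "cinner (adj (tens_left z) v) (T w) = 0" if "T \<in> \<Phi>" for T w
        using v[OF imageI[OF that], of "tens_left z w"] by (simp add: cinner_adj_left \<Phi>[OF that])
    qed
    then have "cinner v (z \<otimes> w) = 0" for z w
      using cinner_adj_left[of "tens_left z" v w] by simp
    then show "v = 0"
      by (rule tens_orthogonal)
  qed (use \<Phi> in auto)
qed

subsection \<open>Quantum group algebras and their tensor products\<close>

lemma qg_algebra_complex_op:
  assumes "complex_op W" "c \<in> qg_algebra W"
  shows "complex_op c"
proof -
  have "qg_algebra W \<subseteq> {T. complex_op T}"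
    unfolding qg_algebra_def
    by (rule closure_minimal[OF _ closed_complex_op]) (use complex_op_slice[OF assms(1)] in auto)
  then show ?thesis using assms(2) by blast
qed

text \<open>The descriptions \<open>hom_tens_id\<close> and \<open>id_tens_hom\<close> ask for
  additivity but not homogeneity. In the uniqueness argument real scalars are therefore shifted into
  the first tensor factor, which must absorb them.\<close>

lemma qg_algebra_scaleR:
  assumes W: "complex_op W" and c: "c \<in> qg_algebra W"
  shows "r *\<^sub>R c \<in> qg_algebra W"
proof -
  have "r *\<^sub>R slice \<omega> W \<in> {slice \<omega> W |\<omega>. normal_functional \<omega>}" if \<omega>: "normal_functional \<omega>" for \<omega>
  proof -
    have "r *\<^sub>R slice \<omega> W = slice (\<lambda>T. complex_of_real r * \<omega> T) W"
      by (intro blinfun_eqI cinner_eqI)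
        (simp add: blinfun.scaleR_left cinner_scaleR_right
          cinner_slice[OF W \<omega>] cinner_slice[OF W normal_functional_scaleR[OF \<omega>]])
    then show ?thesis
      using normal_functional_scaleR[OF \<omega>] by blast
  qed
  then have "(*\<^sub>R) r ` {slice \<omega> W |\<omega>. normal_functional \<omega>} \<subseteq> {slice \<omega> W |\<omega>. normal_functional \<omega>}"
    by auto
  then have "closure ((*\<^sub>R) r ` {slice \<omega> W |\<omega>. normal_functional \<omega>}) \<subseteq> qg_algebra W"
    unfolding qg_algebra_def by (rule closure_mono)
  then show ?thesis
    using c closure_bounded_linear_image_subset[OF bounded_linear_scaleR_right, of r]
    unfolding qg_algebra_def by blast
qed

text \<open>Slicing with the vector functional of the same \<open>v\<close> to which all ranges are
  orthogonal makes \<open>v \<otimes> v\<close> orthogonal to the whole range of \<open>W\<close>.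
  Since \<open>W\<close> is unitary, \<open>v \<otimes> v\<close> vanishes, and so does
  \<open>v\<close>.\<close>

lemma nondegenerate_qg_algebra:
  fixes W :: "'h::chilbert_space op2"
  assumes W: "unitary_op W"
  shows "nondegenerate (qg_algebra W)"
proof (rule nondegenerateI)
  fix v :: 'h assume v: "\<And>T \<xi>. T \<in> qg_algebra W \<Longrightarrow> cinner v (T \<xi>) = 0"
  have "cinner (adj W (v \<otimes> v)) (y \<otimes> \<xi>) = 0" for y \<xi>
  proof -
    have "slice (\<lambda>T. cinner v (T y)) W \<in> qg_algebra W"
      unfolding qg_algebra_def
      by (intro closure_subset[THEN subsetD]) (use normal_functional_vector in blast)
    from v[OF this, of \<xi>] show ?thesis
      using cinner_slice[OF unitary_opD(1)[OF W] normal_functional_vector, of v v y \<xi>] unitary_opD[OF W]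
      by (simp add: cinner_adj_right cinner_adj_left)
  qed
  then have "adj W (v \<otimes> v) = 0"
    by (rule tens_orthogonal)
  then have "norm (v \<otimes> v) = 0"
    using unitary_opD(5)[OF W, of "v \<otimes> v"] by simp
  then show "v = 0" by (simp add: norm_tens)
qed (use qg_algebra_complex_op W unitary_opD in blast)

lemma alg_tens_complex_op:
  assumes "\<And>c. c \<in> C \<Longrightarrow> complex_op c" "\<And>a. a \<in> A \<Longrightarrow> complex_op a" "T \<in> alg_tens C A"
  shows "complex_op T"
proof -
  have "alg_tens C A \<subseteq> {T. complex_op T}"
    unfolding alg_tens_def
    by (intro closure_minimal closed_complex_op span_minimal subspace_complex_op) (use assms in auto)
  then show ?thesis using assms(3) by blast
qed

lemma subspace_alg_tens: "subspace (alg_tens C A)"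
  unfolding alg_tens_def by (intro subspace_closure subspace_span)

lemma tens_in_alg_tens: "c \<in> C \<Longrightarrow> a \<in> A \<Longrightarrow> c \<otimes>\<^sub>o a \<in> alg_tens C A"
  unfolding alg_tens_def by (intro closure_subset[THEN subsetD] span_base) blast

lemma nondegenerate_alg_tens:
  assumes C: "\<And>c. c \<in> C \<Longrightarrow> complex_op c" "nondegenerate C"
    and A: "\<And>a. a \<in> A \<Longrightarrow> complex_op a" "nondegenerate A"
  shows "nondegenerate (alg_tens C A)"
proof (rule nondegenerateI)
  fix v assume v: "\<And>T \<xi>. T \<in> alg_tens C A \<Longrightarrow> cinner v (T \<xi>) = 0"
  have 1: "cinner v (c \<xi> \<otimes> a \<eta>) = 0" if "c \<in> C" "a \<in> A" for c a \<xi> \<eta>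
    using v[OF tens_in_alg_tens[OF that], of "\<xi> \<otimes> \<eta>"] that C A by simp
  have 2: "cinner v (x \<otimes> a \<eta>) = 0" if "a \<in> A" for x a \<eta>
    by (rule orthogonal_tens_right[OF C(2)[unfolded nondegenerate_def]]) (use 1 that in auto)
  have "cinner v (x \<otimes> y) = 0" for x y
    by (rule orthogonal_tens_left[OF A(2)[unfolded nondegenerate_def]]) (use 2 in auto)
  then show "v = 0" by (rule tens_orthogonal)
qed (rule alg_tens_complex_op[OF C(1) A(1)])

text \<open>Additivity together with agreement on all \<open>c \<otimes>\<^sub>o a\<close> gives
  agreement on the real span, a scalar being part of \<open>c\<close>; continuity extends this to
  the closure.\<close>

lemma alg_tens_hom_unique:
  fixes f g :: "_ \<Rightarrow> 'v::real_normed_vector"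
  assumes C: "\<And>c r. c \<in> C \<Longrightarrow> r *\<^sub>R c \<in> C" "\<And>c. c \<in> C \<Longrightarrow> complex_op c"
    and A: "\<And>a. a \<in> A \<Longrightarrow> complex_op a"
    and ext: "f \<in> extensional (alg_tens C A)" "g \<in> extensional (alg_tens C A)"
    and cont: "continuous_on (alg_tens C A) f" "continuous_on (alg_tens C A) g"
    and add: "\<And>s t. s \<in> alg_tens C A \<Longrightarrow> t \<in> alg_tens C A \<Longrightarrow> f (s + t) = f s + f t"
      "\<And>s t. s \<in> alg_tens C A \<Longrightarrow> t \<in> alg_tens C A \<Longrightarrow> g (s + t) = g s + g t"
    and eq: "\<And>c a. c \<in> C \<Longrightarrow> a \<in> A \<Longrightarrow> f (c \<otimes>\<^sub>o a) = g (c \<otimes>\<^sub>o a)"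
  shows "f = g"
proof (rule extensionalityI[OF ext])
  let ?S = "span {c \<otimes>\<^sub>o a |c a. c \<in> C \<and> a \<in> A}"
  have D: "alg_tens C A = closure ?S" by (simp add: alg_tens_def)
  have sub: "?S \<subseteq> alg_tens C A" unfolding D by (rule closure_subset)
  have zero: "0 \<in> alg_tens C A" by (rule subspace_0[OF subspace_alg_tens])
  \<comment> \<open>Membership is carried through the induction because additivity is available only
    inside \<open>alg_tens C A\<close>.\<close>
  have "t \<in> ?S \<and> f t = g t" if "t \<in> ?S" for t
    using that
  proof (induction rule: span_induct_alt)
    case base
    show ?case using add[OF zero zero] span_zero by simp
  next
    case (step r s t)
    obtain c a where s: "s = c \<otimes>\<^sub>o a" "c \<in> C" "a \<in> A" using step(1) by blast
    have "(r *\<^sub>R c) \<otimes>\<^sub>o a = r *\<^sub>R s"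
      unfolding s(1) using C(2) A s
      by (intro op_tens_eqI) (simp add: blinfun.scaleR_left tens_scaleR_left)
    then have "f (r *\<^sub>R s) = g (r *\<^sub>R s)"
      using eq[OF C(1)[OF s(2)] s(3), of r] by simp
    moreover have "r *\<^sub>R s \<in> ?S"
      using step(1) by (intro span_scale span_base)
    ultimately show ?case
      using step(2) add[OF subsetD[OF sub] subsetD[OF sub], of "r *\<^sub>R s" t] by (auto intro: span_add)
  qed
  then have *: "\<And>t. t \<in> ?S \<Longrightarrow> f t - g t = 0" by simp
  show "f t = g t" if "t \<in> alg_tens C A" for t
    using continuous_constant_on_closure[of ?S "\<lambda>t. f t - g t" 0 t] * that cont
    unfolding D by (simp add: continuous_on_diff)
qed

section \<open>Unitary multipliers\<close>

lemma mult_ext_eqI: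
  fixes \<phi> :: "('a::chilbert_space \<Rightarrow>\<^sub>L 'a) \<Rightarrow> 'b::chilbert_space \<Rightarrow>\<^sub>L 'b"
  assumes "nondegenerate (\<phi> ` D)" "\<And>d. d \<in> D \<Longrightarrow> T o\<^sub>L \<phi> d = \<phi> (m d)"
  shows "mult_ext D \<phi> m = T"
  unfolding mult_ext_def
proof (rule the_equality)
  show "S = T" if "\<forall>d\<in>D. S o\<^sub>L \<phi> d = \<phi> (m d)" for S
    by (rule nondegenerate_eqI[OF assms(1)]) (use that assms(2) in auto)
qed (use assms(2) in blast)

text \<open>Isolates the properties of \<open>bichar_alg\<close> on which the passage between
  multipliers and operators rests: differences stay in \<open>D\<close>, which gives uniqueness of
  adjoints, and the ranges span a dense subspace, which turns multipliers into operators.\<close>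

locale nondegenerate_space =
  fixes D :: "('a::chilbert_space \<Rightarrow>\<^sub>L 'a) set"
  assumes complex: "\<And>d. d \<in> D \<Longrightarrow> complex_op d"
    and subspace: "subspace D"
    and nondegenerate: "nondegenerate D"
begin

text \<open>Two adjoints \<open>n\<close> and \<open>n'\<close> have the same inner products with
  all of \<open>D\<close>; testing with the element \<open>n' b - n b\<close> itself shows that it
  is zero.\<close>

lemma mult_star_eqI:
  assumes "adjoint_pair D m n"
  shows "mult_star D m = n"
  unfolding mult_star_def
proof (rule the_equality)
  show "adjoint_pair D m n" by (rule assms)
  fix n' assume n': "adjoint_pair D m n'"
  have D: "n b \<in> D" "n' b \<in> D" if "b \<in> D" for b
    using assms n' that unfolding adjoint_pair_def by auto
  have "n' b = n b" if "b \<in> D" for b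
  proof -
    have e: "n' b - n b \<in> D"
      using D[OF that] subspace by (intro subspace_diff)
    have "adj (n' b - n b) o\<^sub>L n' b = adj (n' b - n b) o\<^sub>L n b"
      using assms n' e that unfolding adjoint_pair_def by metis
    then have "adj (n' b - n b) o\<^sub>L (n' b - n b) = 0"
      by (simp add: bounded_bilinear.diff_right[OF bounded_bilinear_blinfun_compose])
    then show ?thesis
      using adj_compose_self_eq_0D[OF complex[OF e]] by simp
  qed
  moreover have "n \<in> extensional D" "n' \<in> extensional D"
    using assms n' unfolding adjoint_pair_def by (auto simp: PiE_def)
  ultimately show "n' = n"
    by (intro extensionalityI[of n' D n]) auto
qed

lemma unitary_multiplier_leftI:
  assumes U: "unitary_op U" and D: "\<And>d. d \<in> D \<Longrightarrow> U o\<^sub>L d \<in> D" "\<And>d. d \<in> D \<Longrightarrow> adj U o\<^sub>L d \<in> D"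
  shows "restrict (\<lambda>d. U o\<^sub>L d) D \<in> unitary_multipliers D"
    and "mult_star D (restrict (\<lambda>d. U o\<^sub>L d) D) = restrict (\<lambda>d. adj U o\<^sub>L d) D"
proof -
  have pair: "adjoint_pair D (restrict (\<lambda>d. U o\<^sub>L d) D) (restrict (\<lambda>d. adj U o\<^sub>L d) D)"
    unfolding adjoint_pair_def
    using D by (auto simp: adj_compose complex unitary_opD[OF U] blinfun_compose_assoc)
  then show star: "mult_star D (restrict (\<lambda>d. U o\<^sub>L d) D) = restrict (\<lambda>d. adj U o\<^sub>L d) D"
    by (rule mult_star_eqI)
  show "restrict (\<lambda>d. U o\<^sub>L d) D \<in> unitary_multipliers D"
    unfolding unitary_multipliers_def multipliers_def
    using pair D by (auto simp: star blinfun_compose_assoc[symmetric] unitary_opD[OF U])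
qed

text \<open>The operator is to send \<open>d \<xi>\<close> to \<open>V d \<xi>\<close>. Moving one
  \<open>V\<close> across the inner product and cancelling it against the other shows that inner
  products are preserved, which settles well-definedness, linearity and boundedness at once.\<close>

lemma unitary_multiplier_left:
  assumes "V \<in> unitary_multipliers D"
  obtains U where "unitary_op U" "V = restrict (\<lambda>d. U o\<^sub>L d) D"
    "mult_star D V = restrict (\<lambda>d. adj U o\<^sub>L d) D"
    "\<And>d. d \<in> D \<Longrightarrow> U o\<^sub>L d \<in> D" "\<And>d. d \<in> D \<Longrightarrow> adj U o\<^sub>L d \<in> D"
proof -
  obtain V' where pair: "adjoint_pair D V V'"
    using assms unfolding unitary_multipliers_def multipliers_def by blast
  then have star: "mult_star D V = V'"
    by (rule mult_star_eqI)
  have inv: "V' (V d) = d" "V (V' d) = d" if "d \<in> D" for d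
    using assms that unfolding unitary_multipliers_def by (auto simp: star)
  have D: "V d \<in> D" "V' d \<in> D" if "d \<in> D" for d
    using pair that unfolding adjoint_pair_def by auto
  have VV': "adj (V a) o\<^sub>L b = adj a o\<^sub>L V' b" if "a \<in> D" "b \<in> D" for a b
    using pair that unfolding adjoint_pair_def by blast
  have cinner_V: "cinner (V a \<xi>) (b \<eta>) = cinner (a \<xi>) (V' b \<eta>)" if "a \<in> D" "b \<in> D" for a b \<xi> \<eta>
    using arg_cong[OF VV'[OF that], of "\<lambda>T. cinner \<xi> (T \<eta>)"] that
    by (simp add: cinner_adj_right complex D)
  let ?E = "{(blinfun_apply d \<xi>, V d \<xi>) |d \<xi>. d \<in> D}"
  have "fst ` ?E = {blinfun_apply d \<xi> |d \<xi>. d \<in> D}" by force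
  then have dense: "closure (span (fst ` ?E)) = UNIV"
    using nondegenerate by (simp add: nondegenerate_def)
  have iso: "w \<bullet> w' = v \<bullet> v'" if "(v, w) \<in> ?E" "(v', w') \<in> ?E" for v w v' w'
    using that by (auto simp: inner_eq_Re_cinner cinner_V D inv)
  obtain U :: "'a \<Rightarrow>\<^sub>L 'a" where "\<And>v w. (v, w) \<in> ?E \<Longrightarrow> U v = w"
    by (rule isometric_extension[OF dense], rule iso, assumption+, rule that)
  then have U_app: "U (d \<xi>) = V d \<xi>" if "d \<in> D" for d \<xi>
    using that by blast
  have UV: "U o\<^sub>L d = V d" if "d \<in> D" for d
    by (rule blinfun_eqI) (simp add: U_app that)
  have cU: "complex_op U"
  proof -
    \<comment> \<open>The isometric extension is only real-linear. Complex linearity is tested on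
      the ranges of elements of \<open>D\<close>, which are complex-linear, as are their images
      under \<open>V\<close>.\<close>
    have "Blinfun (\<lambda>v. U (c *\<^sub>C v)) = Blinfun (\<lambda>v. c *\<^sub>C U v)" for c
    proof (rule nondegenerate_eqI[OF nondegenerate], rule blinfun_eqI)
      fix d \<xi> assume d: "d \<in> D"
      have "U (c *\<^sub>C d \<xi>) = c *\<^sub>C U (d \<xi>)"
        using U_app[OF d] complex_opD[OF complex[OF d]] complex_opD[OF complex[OF D(1)[OF d]]] by metis
      then show "(Blinfun (\<lambda>v. U (c *\<^sub>C v)) o\<^sub>L d) \<xi> = (Blinfun (\<lambda>v. c *\<^sub>C U v) o\<^sub>L d) \<xi>"
        by (simp add: bounded_linear_Blinfun_apply bounded_linear_compose[OF bounded_linear_scaleC]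
            bounded_linear_compose[OF _ bounded_linear_scaleC] blinfun.bounded_linear_right)
    qed
    from this[THEN arg_cong, of "\<lambda>T. blinfun_apply T _"] show ?thesis
      unfolding complex_op_def
      by (simp add: bounded_linear_Blinfun_apply bounded_linear_compose[OF bounded_linear_scaleC]
            bounded_linear_compose[OF _ bounded_linear_scaleC] blinfun.bounded_linear_right)
  qed
  have UV': "adj U o\<^sub>L d = V' d" if d: "d \<in> D" for d
  proof (rule blinfun_eqI)
    fix \<xi>
    have "adj U (d \<xi>) - V' d \<xi> = 0"
    proof (rule nondegenerate_orthogonal[OF nondegenerate])
      fix a \<eta> assume a: "a \<in> D"
      have "cinner (d \<xi>) (V a \<eta>) = cinner (V' d \<xi>) (a \<eta>)"
        using cinner_V[OF a d, of \<eta> \<xi>] cinner_commute by metis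
      then show "cinner (adj U (d \<xi>) - V' d \<xi>) (a \<eta>) = 0"
        by (simp add: cinner_diff_left cinner_adj_left cU U_app a)
    qed
    then show "(adj U o\<^sub>L d) \<xi> = V' d \<xi>" by simp
  qed
  have "adj U o\<^sub>L U = id_blinfun" "U o\<^sub>L adj U = id_blinfun"
    by (rule nondegenerate_eqI[OF nondegenerate]; simp add: blinfun_compose_assoc UV UV' D inv)+
  then have U: "unitary_op U"
    using cU by (simp add: unitary_op_def)
  have "V \<in> extensional D" "V' \<in> extensional D"
    using pair unfolding adjoint_pair_def by (auto simp: PiE_def)
  then have V: "V = restrict (\<lambda>d. U o\<^sub>L d) D" and V': "V' = restrict (\<lambda>d. adj U o\<^sub>L d) D"
    by (auto simp: restrict_def extensional_def fun_eq_iff UV UV')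
  show thesis
  proof (rule that[OF U V])
    show "mult_star D V = restrict (\<lambda>d. adj U o\<^sub>L d) D"
      using star V' by (rule trans)
  qed (simp_all add: UV UV' D)
qed

lemma mult_ext_id_left:
  "(\<And>d. d \<in> D \<Longrightarrow> U o\<^sub>L d \<in> D) \<Longrightarrow> mult_ext D (\<lambda>d. d) (restrict (\<lambda>d. U o\<^sub>L d) D) = U"
  by (rule mult_ext_eqI) (simp_all add: nondegenerate)

end

section \<open>Bicharacters\<close>

lemma adj_flip_alg: "complex_op T \<Longrightarrow> adj (flip_alg T) = flip_alg (adj T)"
  by (simp add: flip_alg_def adj_compose blinfun_compose_assoc)

lemma flip_alg_flip_alg [simp]: "flip_alg (flip_alg T) = T"
  by (rule blinfun_eqI) (simp add: flip_alg_def)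

lemma flip_alg_compose: "flip_alg (S o\<^sub>L T) = flip_alg S o\<^sub>L flip_alg T"
  by (rule blinfun_eqI) (simp add: flip_alg_def)

lemma unitary_op_flip_alg: "unitary_op U \<Longrightarrow> unitary_op (flip_alg U)"
  by (simp add: flip_alg_def unitary_op_compose)

lemma dual_eq_flip_alg: "dual W = flip_alg (adj W)"
  by (simp add: dual_def flip_alg_def)

lemma unitary_op_dual: "unitary_op W \<Longrightarrow> unitary_op (dual W)"
  by (simp add: dual_eq_flip_alg unitary_op_flip_alg unitary_op_adj)

lemma dual_dual: "complex_op W \<Longrightarrow> dual (dual W) = W"
  by (simp add: dual_eq_flip_alg adj_flip_alg)

lemma flip_alg_in_alg_tens:
  assumes C: "\<And>c. c \<in> C \<Longrightarrow> complex_op c" and A: "\<And>a. a \<in> A \<Longrightarrow> complex_op a"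
    and T: "T \<in> alg_tens C A"
  shows "flip_alg T \<in> alg_tens A C"
proof -
  have lin: "bounded_linear flip_alg"
    unfolding flip_alg_def
    by (intro bounded_linear_compose[OF bounded_bilinear.bounded_linear_left[OF bounded_bilinear_blinfun_compose]]
        bounded_bilinear.bounded_linear_right[OF bounded_bilinear_blinfun_compose])
  have "flip_alg ` span {c \<otimes>\<^sub>o a |c a. c \<in> C \<and> a \<in> A} = span (flip_alg ` {c \<otimes>\<^sub>o a |c a. c \<in> C \<and> a \<in> A})"
    by (rule linear_span_image[symmetric]) (rule bounded_linear.linear[OF lin])
  also have "\<dots> \<subseteq> span {a \<otimes>\<^sub>o c |a c. a \<in> A \<and> c \<in> C}"
  proof (rule span_mono, safe)
    fix c a assume "c \<in> C" "a \<in> A"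
    then show "\<exists>a' c'. flip_alg (c \<otimes>\<^sub>o a) = a' \<otimes>\<^sub>o c' \<and> a' \<in> A \<and> c' \<in> C"
      using C A unfolding flip_alg_def by (metis flip_op_tens_flip)
  qed
  finally have "closure (flip_alg ` span {c \<otimes>\<^sub>o a |c a. c \<in> C \<and> a \<in> A}) \<subseteq> alg_tens A C"
    unfolding alg_tens_def by (rule closure_mono)
  then show ?thesis
    using closure_bounded_linear_image_subset[OF lin] T unfolding alg_tens_def by blast
qed

section \<open>Comultiplications on a tensor factor as conjugations\<close>

text \<open>On generators, \<open>leg13 (c \<otimes>\<^sub>o a)\<close> has the identity in the
  middle leg, and conjugating with \<open>leg12 W\<close> turns the first two legs into
  \<open>comult W c\<close>. The formula meets every clause of the description, and
  \<open>alg_tens_hom_unique\<close> excludes any other map.\<close>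

lemma hom_tens_id_comult:
  fixes W :: "'c::chilbert_space op2" and A :: "('a::chilbert_space \<Rightarrow>\<^sub>L 'a) set"
  assumes W: "unitary_op W"
    and C: "\<And>c r. c \<in> C \<Longrightarrow> r *\<^sub>R c \<in> C" "\<And>c. c \<in> C \<Longrightarrow> complex_op c"
    and A: "\<And>a. a \<in> A \<Longrightarrow> complex_op a"
  shows "hom_tens_id C A (comult W) = restrict (\<lambda>T. leg12 W o\<^sub>L leg13 T o\<^sub>L adj (leg12 W)) (alg_tens C A)"
    (is "_ = ?f")
proof -
  let ?D = "alg_tens C A"
  have D: "complex_op T" if "T \<in> ?D" for T
    by (rule alg_tens_complex_op[OF C(2) A that])
  have cW: "complex_op W" by (rule unitary_opD(1)[OF W])
  have ext: "?f \<in> extensional ?D" by simp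
  have cont: "continuous_on ?D ?f"
  proof (subst continuous_on_cong[OF refl])
    show "continuous_on ?D (\<lambda>T. leg12 W o\<^sub>L leg13 T o\<^sub>L adj (leg12 W))"
      by (intro bounded_bilinear.continuous_on[OF bounded_bilinear_blinfun_compose]
          continuous_on_const continuous_on_leg) (use D in auto)
  qed simp
  have add: "?f (s + t) = ?f s + ?f t" if "s \<in> ?D" "t \<in> ?D" for s t
    using that subspace_add[OF subspace_alg_tens that] D
    by (simp add: leg_add bounded_bilinear.add_left[OF bounded_bilinear_blinfun_compose]
        bounded_bilinear.add_right[OF bounded_bilinear_blinfun_compose])
  have gen: "?f (c \<otimes>\<^sub>o a) = assoc o\<^sub>L (comult W c \<otimes>\<^sub>o a) o\<^sub>L adj assoc" if "c \<in> C" "a \<in> A" for c a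
  proof -
    have ca: "complex_op c" "complex_op a" using C A that by auto
    have leg13: "leg13 (c \<otimes>\<^sub>o a) = assoc o\<^sub>L ((c \<otimes>\<^sub>o (id_blinfun :: 'c \<Rightarrow>\<^sub>L 'c)) \<otimes>\<^sub>o a) o\<^sub>L adj assoc"
      by (rule tens3_eqI) (simp add: leg_tens ca)
    have comult: "comult W c \<otimes>\<^sub>o a
        = (W \<otimes>\<^sub>o id_blinfun) o\<^sub>L ((c \<otimes>\<^sub>o id_blinfun) \<otimes>\<^sub>o a) o\<^sub>L (adj W \<otimes>\<^sub>o id_blinfun)"
      unfolding comult_def by (simp add: op_tens_compose cW ca)
    have "?f (c \<otimes>\<^sub>o a) = leg12 W o\<^sub>L leg13 (c \<otimes>\<^sub>o a) o\<^sub>L leg12 (adj W)"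
      using tens_in_alg_tens[OF that] by (simp add: adj_leg cW)
    also have "\<dots> = assoc o\<^sub>L (comult W c \<otimes>\<^sub>o a) o\<^sub>L adj assoc"
      unfolding leg13 comult leg12_def by (rule blinfun_eqI) simp
    finally show ?thesis .
  qed
  show ?thesis
    unfolding hom_tens_id_def
  proof (rule the_equality, intro conjI ballI)
    fix f assume "f \<in> extensional ?D \<and> continuous_on ?D f \<and> (\<forall>s\<in>?D. \<forall>t\<in>?D. f (s + t) = f s + f t) \<and>
      (\<forall>c\<in>C. \<forall>a\<in>A. f (c \<otimes>\<^sub>o a) = assoc o\<^sub>L (comult W c \<otimes>\<^sub>o a) o\<^sub>L adj assoc)"
    then show "f = ?f"
      by (intro alg_tens_hom_unique[OF C A _ ext _ cont _ add]) (auto simp: gen simp del: restrict_apply)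
  qed (use ext cont add gen in blast)+
qed

text \<open>Same argument, with the identity in the third leg and \<open>leg23 W\<close> acting on
  the last two.\<close>

lemma id_tens_hom_comult:
  fixes W :: "'a::chilbert_space op2" and C :: "('c::chilbert_space \<Rightarrow>\<^sub>L 'c) set"
  assumes W: "unitary_op W"
    and C: "\<And>c r. c \<in> C \<Longrightarrow> r *\<^sub>R c \<in> C" "\<And>c. c \<in> C \<Longrightarrow> complex_op c"
    and A: "\<And>a. a \<in> A \<Longrightarrow> complex_op a"
  shows "id_tens_hom C A (comult W) = restrict (\<lambda>T. leg23 W o\<^sub>L leg12 T o\<^sub>L adj (leg23 W)) (alg_tens C A)"
    (is "_ = ?f")
proof -
  let ?D = "alg_tens C A"
  have D: "complex_op T" if "T \<in> ?D" for T
    by (rule alg_tens_complex_op[OF C(2) A that])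
  have cW: "complex_op W" by (rule unitary_opD(1)[OF W])
  have ext: "?f \<in> extensional ?D" by simp
  have cont: "continuous_on ?D ?f"
  proof (subst continuous_on_cong[OF refl])
    show "continuous_on ?D (\<lambda>T. leg23 W o\<^sub>L leg12 T o\<^sub>L adj (leg23 W))"
      by (intro bounded_bilinear.continuous_on[OF bounded_bilinear_blinfun_compose]
          continuous_on_const continuous_on_leg) (use D in auto)
  qed simp
  have add: "?f (s + t) = ?f s + ?f t" if "s \<in> ?D" "t \<in> ?D" for s t
    using that subspace_add[OF subspace_alg_tens that] D
    by (simp add: leg_add bounded_bilinear.add_left[OF bounded_bilinear_blinfun_compose]
        bounded_bilinear.add_right[OF bounded_bilinear_blinfun_compose])
  have gen: "?f (c \<otimes>\<^sub>o a) = c \<otimes>\<^sub>o comult W a" if "c \<in> C" "a \<in> A" for c a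
  proof -
    have ca: "complex_op c" "complex_op a" using C A that by auto
    have "leg12 (c \<otimes>\<^sub>o a) = c \<otimes>\<^sub>o (a \<otimes>\<^sub>o (id_blinfun :: 'a \<Rightarrow>\<^sub>L 'a))"
      by (rule tens3_eqI) (simp add: leg_tens ca)
    then show ?thesis
      using tens_in_alg_tens[OF that] by (simp add: leg23_def comult_def adj_op_tens op_tens_compose cW ca)
  qed
  show ?thesis
    unfolding id_tens_hom_def
  proof (rule the_equality, intro conjI ballI)
    fix f assume "f \<in> extensional ?D \<and> continuous_on ?D f \<and> (\<forall>s\<in>?D. \<forall>t\<in>?D. f (s + t) = f s + f t) \<and>
      (\<forall>c\<in>C. \<forall>a\<in>A. f (c \<otimes>\<^sub>o a) = c \<otimes>\<^sub>o comult W a)"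
    then show "f = ?f"
      by (intro alg_tens_hom_unique[OF C A _ ext _ cont _ add]) (auto simp: gen simp del: restrict_apply)
  qed (use ext cont add gen in blast)+
qed

section \<open>Bicharacters as identities between unitary operators\<close>

context
  fixes WC :: "'c::chilbert_space op2" and WA :: "'a::chilbert_space op2"
  assumes WC: "unitary_op WC" and WA: "unitary_op WA"
begin

lemma complex_op_qg_algebra:
  "c \<in> qg_algebra (dual WC) \<Longrightarrow> complex_op c" "a \<in> qg_algebra WA \<Longrightarrow> complex_op a"
  using qg_algebra_complex_op unitary_op_dual[OF WC] WA unitary_opD(1) by blast+

lemma nondegenerate_space_bichar_alg: "nondegenerate_space (bichar_alg WC WA)"
  unfolding bichar_alg_def
proof
  show "complex_op d" if "d \<in> alg_tens (qg_algebra (dual WC)) (qg_algebra WA)" for d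
    using alg_tens_complex_op[OF complex_op_qg_algebra that] .
  show "subspace (alg_tens (qg_algebra (dual WC)) (qg_algebra WA))"
    by (rule subspace_alg_tens)
  show "nondegenerate (alg_tens (qg_algebra (dual WC)) (qg_algebra WA))"
    by (intro nondegenerate_alg_tens nondegenerate_qg_algebra unitary_op_dual WC WA complex_op_qg_algebra)
qed

interpretation nondegenerate_space "bichar_alg WC WA"
  by (rule nondegenerate_space_bichar_alg)

lemma concrete_bicharacter_left:
  "(\<And>d. d \<in> bichar_alg WC WA \<Longrightarrow> U o\<^sub>L d \<in> bichar_alg WC WA) \<Longrightarrow>
    concrete_bicharacter WC WA (restrict (\<lambda>d. U o\<^sub>L d) (bichar_alg WC WA)) = U"
  unfolding concrete_bicharacter_def by (rule mult_ext_id_left)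

lemma unitary_multiplier_concrete:
  assumes "V \<in> unitary_multipliers (bichar_alg WC WA)"
  defines "U \<equiv> concrete_bicharacter WC WA V"
  shows "unitary_op U" "V = restrict (\<lambda>d. U o\<^sub>L d) (bichar_alg WC WA)"
    "mult_star (bichar_alg WC WA) V = restrict (\<lambda>d. adj U o\<^sub>L d) (bichar_alg WC WA)"
    "\<And>d. d \<in> bichar_alg WC WA \<Longrightarrow> U o\<^sub>L d \<in> bichar_alg WC WA"
    "\<And>d. d \<in> bichar_alg WC WA \<Longrightarrow> adj U o\<^sub>L d \<in> bichar_alg WC WA"
proof -
  obtain U' where U': "unitary_op U'" "V = restrict (\<lambda>d. U' o\<^sub>L d) (bichar_alg WC WA)"
    "mult_star (bichar_alg WC WA) V = restrict (\<lambda>d. adj U' o\<^sub>L d) (bichar_alg WC WA)"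
    "\<And>d. d \<in> bichar_alg WC WA \<Longrightarrow> U' o\<^sub>L d \<in> bichar_alg WC WA"
    "\<And>d. d \<in> bichar_alg WC WA \<Longrightarrow> adj U' o\<^sub>L d \<in> bichar_alg WC WA"
    using unitary_multiplier_left[OF assms(1)] by metis
  have eq: "U = U'"
    unfolding U_def U'(2) by (rule concrete_bicharacter_left[OF U'(4)])
  show "unitary_op U" "V = restrict (\<lambda>d. U o\<^sub>L d) (bichar_alg WC WA)"
    "mult_star (bichar_alg WC WA) V = restrict (\<lambda>d. adj U o\<^sub>L d) (bichar_alg WC WA)"
    "\<And>d. d \<in> bichar_alg WC WA \<Longrightarrow> U o\<^sub>L d \<in> bichar_alg WC WA"
    "\<And>d. d \<in> bichar_alg WC WA \<Longrightarrow> adj U o\<^sub>L d \<in> bichar_alg WC WA"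
    unfolding eq by (fact U')+
qed

text \<open>Each extension to multipliers that occurs in the definition is along a multiplicative
  map, a leg or a conjugated leg, so its value on left multiplication by \<open>U\<close> is the
  same map applied to \<open>U\<close>; nondegeneracy of the image makes this value unique.\<close>

lemma bicharacter_iff:
  "bicharacter WC WA V \<longleftrightarrow> V \<in> unitary_multipliers (bichar_alg WC WA) \<and>
    (let U = concrete_bicharacter WC WA V in
      leg12 (dual WC) o\<^sub>L leg13 U o\<^sub>L adj (leg12 (dual WC)) = leg23 U o\<^sub>L leg13 U \<and>
      leg23 WA o\<^sub>L leg12 U o\<^sub>L adj (leg23 WA) = leg12 U o\<^sub>L leg13 U)"
proof (cases "V \<in> unitary_multipliers (bichar_alg WC WA)")
  case True
  define U where "U = concrete_bicharacter WC WA V"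
  note U = unitary_multiplier_concrete[OF True, folded U_def]
  have cU: "complex_op U" by (rule unitary_opD(1)[OF U(1)])
  let ?D = "bichar_alg WC WA"
  have app: "V d = U o\<^sub>L d" if "d \<in> ?D" for d
    using that by (subst U(2)) simp
  have leg: "mult_ext ?D leg12 V = leg12 U" "mult_ext ?D leg13 V = leg13 U" "mult_ext ?D leg23 V = leg23 U"
    by (rule mult_ext_eqI[OF nondegenerate_leg(1)[OF nondegenerate complex]],
          simp_all add: app leg_compose cU complex)
      (rule mult_ext_eqI[OF nondegenerate_leg(2)[OF nondegenerate complex]],
          simp_all add: app leg_compose cU complex,
        rule mult_ext_eqI[OF nondegenerate_leg(3)[OF nondegenerate complex]],
          simp_all add: app leg_compose cU complex)
  \<comment> \<open>Serves both comultiplications, with \<open>l\<close> as \<open>leg13\<close> and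
    as \<open>leg12\<close>. The space \<open>'x\<close> is left general since the two identities
    live on different triple tensor products.\<close>
  have conj: "mult_ext ?D (restrict (\<lambda>T. L o\<^sub>L l T o\<^sub>L adj L) ?D) V = L o\<^sub>L l U o\<^sub>L adj L"
    if L: "unitary_op L" and l: "nondegenerate (l ` ?D)" "\<And>d. d \<in> ?D \<Longrightarrow> complex_op (l d)"
      "\<And>d. d \<in> ?D \<Longrightarrow> l (U o\<^sub>L d) = l U o\<^sub>L l d"
    for l :: "_ \<Rightarrow> 'x::chilbert_space \<Rightarrow>\<^sub>L 'x" and L
  proof (rule mult_ext_eqI)
    have "nondegenerate ((\<lambda>T. L o\<^sub>L T o\<^sub>L adj L) ` l ` ?D)"
      by (rule nondegenerate_conjugate[OF l(1) _ L]) (use l(2) in auto)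
    then show "nondegenerate (restrict (\<lambda>T. L o\<^sub>L l T o\<^sub>L adj L) ?D ` ?D)"
      by (simp add: image_image)
    show "L o\<^sub>L l U o\<^sub>L adj L o\<^sub>L restrict (\<lambda>T. L o\<^sub>L l T o\<^sub>L adj L) ?D d
        = restrict (\<lambda>T. L o\<^sub>L l T o\<^sub>L adj L) ?D (V d)" if "d \<in> ?D" for d
      using that U(4) by (auto intro!: blinfun_eqI simp: app l(3) unitary_opD[OF L])
  qed
  note qg = qg_algebra_scaleR[OF unitary_opD(1)[OF unitary_op_dual[OF WC]]] complex_op_qg_algebra
  have "hom_tens_id (qg_algebra (dual WC)) (qg_algebra WA) (comult (dual WC))
      = restrict (\<lambda>T. leg12 (dual WC) o\<^sub>L leg13 T o\<^sub>L adj (leg12 (dual WC))) ?D"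
    unfolding bichar_alg_def by (rule hom_tens_id_comult[OF unitary_op_dual[OF WC] qg])
  then have "mult_ext ?D (hom_tens_id (qg_algebra (dual WC)) (qg_algebra WA) (comult (dual WC))) V
      = leg12 (dual WC) o\<^sub>L leg13 U o\<^sub>L adj (leg12 (dual WC))"
    by (simp only:) (intro conj unitary_op_leg unitary_op_dual WC nondegenerate_leg nondegenerate complex,
      simp_all add: complex leg_compose cU)
  moreover have "id_tens_hom (qg_algebra (dual WC)) (qg_algebra WA) (comult WA)
      = restrict (\<lambda>T. leg23 WA o\<^sub>L leg12 T o\<^sub>L adj (leg23 WA)) ?D"
    unfolding bichar_alg_def by (rule id_tens_hom_comult[OF WA qg])
  then have "mult_ext ?D (id_tens_hom (qg_algebra (dual WC)) (qg_algebra WA) (comult WA)) V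
      = leg23 WA o\<^sub>L leg12 U o\<^sub>L adj (leg23 WA)"
    by (simp only:) (intro conj unitary_op_leg WA nondegenerate_leg nondegenerate complex,
      simp_all add: complex leg_compose cU)
  ultimately show ?thesis
    unfolding bicharacter_def Let_def bichar_alg_def[symmetric] U_def[symmetric] leg by simp
qed (simp add: bicharacter_def bichar_alg_def Let_def)

lemma bichar_alg_dual: "bichar_alg (dual WA) (dual WC) = alg_tens (qg_algebra WA) (qg_algebra (dual WC))"
  using unitary_opD(1)[OF WA] by (simp add: bichar_alg_def dual_dual)

end

section \<open>Duals of bicharacters and of composites\<close>

text \<open>Conjugation by the flip exchanges the algebra of \<open>V\<close> with that of its dual,
  the double dual of \<open>WA\<close> being \<open>WA\<close>. It therefore carries left
  multiplication by \<open>adj U\<close> to left multiplication by the flipped adjoint.\<close>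

lemma dual_bicharacter_multiplier:
  fixes WC :: "'c::chilbert_space op2" and WA :: "'a::chilbert_space op2"
  assumes WC: "unitary_op WC" and WA: "unitary_op WA"
    and V: "V \<in> unitary_multipliers (bichar_alg WC WA)"
  shows "dual_bicharacter WC WA V \<in> unitary_multipliers (bichar_alg (dual WA) (dual WC))"
    and "concrete_bicharacter (dual WA) (dual WC) (dual_bicharacter WC WA V)
      = flip_alg (adj (concrete_bicharacter WC WA V))"
proof -
  define U where "U = concrete_bicharacter WC WA V"
  note U = unitary_multiplier_concrete[OF WC WA V, folded U_def]
  have cU: "complex_op U" by (rule unitary_opD(1)[OF U(1)])
  let ?D = "bichar_alg WC WA" and ?D' = "bichar_alg (dual WA) (dual WC)"
  interpret D': nondegenerate_space ?D'
    by (intro nondegenerate_space_bichar_alg unitary_op_dual WC WA)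
  note complex = complex_op_qg_algebra[OF WC WA]
  have flip_D: "flip_alg d \<in> ?D'" if "d \<in> ?D" for d
    unfolding bichar_alg_dual[OF WC WA]
    by (rule flip_alg_in_alg_tens[OF complex]) (use that in \<open>simp_all add: bichar_alg_def\<close>)
  have flip_D': "flip_alg e \<in> ?D" if "e \<in> ?D'" for e
    unfolding bichar_alg_def
    by (rule flip_alg_in_alg_tens[OF complex(2,1)])
      (use that in \<open>simp_all add: bichar_alg_dual[OF WC WA]\<close>)
  have D': "flip_alg (adj U) o\<^sub>L e \<in> ?D'" "adj (flip_alg (adj U)) o\<^sub>L e \<in> ?D'" if "e \<in> ?D'" for e
    using flip_D[OF U(4)[OF flip_D'[OF that]]] flip_D[OF U(5)[OF flip_D'[OF that]]]
    by (simp_all add: flip_alg_compose adj_flip_alg cU)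
  have eq: "dual_bicharacter WC WA V = restrict (\<lambda>e. flip_alg (adj U) o\<^sub>L e) ?D'"
    unfolding dual_bicharacter_def flip_mult_def U(3) bichar_alg_dual[OF WC WA, symmetric]
    by (intro restrict_ext) (simp add: flip_D' flip_alg_compose)
  show "dual_bicharacter WC WA V \<in> unitary_multipliers ?D'"
    unfolding eq by (intro D'.unitary_multiplier_leftI unitary_op_flip_alg unitary_op_adj U(1) D')
  show "concrete_bicharacter (dual WA) (dual WC) (dual_bicharacter WC WA V) = flip_alg (adj U)"
    unfolding eq by (intro concrete_bicharacter_left unitary_op_dual WC WA D')
qed

lemma leg_rot_apply:
  assumes "complex_op T"
  shows "leg13 (flip_alg T) (rot v) = rot (leg12 T v)" "leg23 (flip_alg T) (rot u) = rot (leg13 T u)"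
    "leg12 T (rot w) = rot (leg23 T w)"
  by (simp_all only: blinfun_apply_blinfun_compose[symmetric] rot_leg[OF assms])

lemma leg_rev_apply:
  assumes "complex_op T"
  shows "leg23 (flip_alg T) (rev_legs v) = rev_legs (leg12 T v)"
    "leg13 (flip_alg T) (rev_legs u) = rev_legs (leg13 T u)"
    "leg12 (flip_alg T) (rev_legs w) = rev_legs (leg23 T w)"
  by (simp_all only: blinfun_apply_blinfun_compose[symmetric] rev_leg[OF assms])

lemma bicharacter_dual:
  fixes WC :: "'c::chilbert_space op2" and WA :: "'a::chilbert_space op2"
  assumes WC: "unitary_op WC" and WA: "unitary_op WA" and V: "bicharacter WC WA V"
  shows "bicharacter (dual WA) (dual WC) (dual_bicharacter WC WA V)"
proof -
  define U where "U = concrete_bicharacter WC WA V"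
  have UM: "V \<in> unitary_multipliers (bichar_alg WC WA)"
    and 1: "leg12 (dual WC) o\<^sub>L leg13 U o\<^sub>L adj (leg12 (dual WC)) = leg23 U o\<^sub>L leg13 U"
    and 2: "leg23 WA o\<^sub>L leg12 U o\<^sub>L adj (leg23 WA) = leg12 U o\<^sub>L leg13 U"
    using V unfolding bicharacter_iff[OF WC WA] U_def by (auto simp: Let_def)
  have cU: "complex_op U"
    using unitary_multiplier_concrete(1)[OF WC WA UM] unitary_opD(1) by (simp add: U_def)
  have cWA: "complex_op WA" and cWC: "complex_op (dual WC)"
    using WA unitary_op_dual[OF WC] unitary_opD(1) by blast+
  \<comment> \<open>The adjoint preserves the shape of the conjugation on the left and reverses the
    order of the product on the right.\<close>
  have 1: "leg12 (dual WC) (leg13 (adj U) (leg12 (adj (dual WC)) v)) = leg13 (adj U) (leg23 (adj U) v)" for v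
    using arg_cong[OF arg_cong[OF 1, of adj], of "\<lambda>T. T v"] by (simp add: adj_compose adj_leg cU cWC)
  have 2: "leg23 WA (leg12 (adj U) (leg23 (adj WA) v)) = leg13 (adj U) (leg12 (adj U) v)" for v
    using arg_cong[OF arg_cong[OF 2, of adj], of "\<lambda>T. T v"] by (simp add: adj_compose adj_leg cU cWA)
  let ?U = "flip_alg (adj U)"
  have "leg12 WA o\<^sub>L leg13 ?U o\<^sub>L adj (leg12 WA) = leg23 ?U o\<^sub>L leg13 ?U"
  proof (rule blinfun_eqI)
    fix v :: "('a, ('a, 'c) tensor) tensor"
    define w :: "('c, ('a, 'a) tensor) tensor" where "w = adj rot v"
    have v: "v = rot w" by (simp add: w_def unitary_opD)
    show "(leg12 WA o\<^sub>L leg13 ?U o\<^sub>L adj (leg12 WA)) v = (leg23 ?U o\<^sub>L leg13 ?U) v"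
      unfolding v by (simp add: adj_leg leg_rot_apply cU cWA 2)
  qed
  moreover have "leg23 (dual WC) o\<^sub>L leg12 ?U o\<^sub>L adj (leg23 (dual WC)) = leg12 ?U o\<^sub>L leg13 ?U"
  proof (rule blinfun_eqI)
    fix v :: "('a, ('c, 'c) tensor) tensor"
    \<comment> \<open>This identity is the one that becomes the known identity after rotation, so
      \<open>rot\<close> is applied to both sides and cancelled at the end; in the previous case the
      known identity was rotated instead.\<close>
    have "rot ((leg23 (dual WC) o\<^sub>L leg12 ?U o\<^sub>L adj (leg23 (dual WC))) v)
        = leg12 (dual WC) (leg13 (adj U) (leg12 (adj (dual WC)) (rot v)))"
      by (simp add: adj_leg leg_rot_apply(3) leg_rot_apply(1)[of ?U, unfolded flip_alg_flip_alg] cU cWC)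
    also have "\<dots> = rot ((leg12 ?U o\<^sub>L leg13 ?U) v)"
      by (simp add: 1 cU leg_rot_apply(1,2)[of ?U, unfolded flip_alg_flip_alg])
    finally show "(leg23 (dual WC) o\<^sub>L leg12 ?U o\<^sub>L adj (leg23 (dual WC))) v = (leg12 ?U o\<^sub>L leg13 ?U) v"
      by (metis unitary_op_rot unitary_opD(4))
  qed
  ultimately show ?thesis
    unfolding bicharacter_iff[OF unitary_op_dual[OF WA] unitary_op_dual[OF WC]]
    using dual_bicharacter_multiplier[OF WC WA UM]
    by (simp add: Let_def U_def dual_dual unitary_opD(1)[OF WA])
qed

text \<open>Allowing three different operators covers composition of bicharacters, where
  \<open>S\<close> and \<open>T\<close> exchange roles, and with \<open>S = T = R\<close> the
  pentagon equation of \<open>dual W\<close>.\<close>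

lemma pentagon_flip:
  fixes T :: "('c::chilbert_space, 'a::chilbert_space) tensor \<Rightarrow>\<^sub>L ('c, 'a) tensor"
    and S :: "('a, 'b::chilbert_space) tensor \<Rightarrow>\<^sub>L ('a, 'b) tensor"
    and R :: "('c, 'b) tensor \<Rightarrow>\<^sub>L ('c, 'b) tensor"
  assumes "complex_op S" "complex_op T" "complex_op R"
    and "leg23 S o\<^sub>L leg12 T = leg12 T o\<^sub>L leg13 R o\<^sub>L leg23 S"
  shows "leg23 (flip_alg (adj T)) o\<^sub>L leg12 (flip_alg (adj S))
    = leg12 (flip_alg (adj S)) o\<^sub>L leg13 (flip_alg (adj R)) o\<^sub>L leg23 (flip_alg (adj T))"
proof (rule blinfun_eqI)
  fix v :: "('b, ('a, 'c) tensor) tensor"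
  define w :: "('c, ('a, 'b) tensor) tensor" where "w = adj rev_legs v"
  have v: "v = rev_legs w" by (simp add: w_def unitary_opD)
  have "leg12 (adj T) (leg23 (adj S) w) = leg23 (adj S) (leg13 (adj R) (leg12 (adj T) w))"
    using arg_cong[OF arg_cong[OF assms(4), of adj], of "\<lambda>T. T w"]
    by (simp add: adj_compose adj_leg assms(1-3))
  then show "(leg23 (flip_alg (adj T)) o\<^sub>L leg12 (flip_alg (adj S))) v
      = (leg12 (flip_alg (adj S)) o\<^sub>L leg13 (flip_alg (adj R)) o\<^sub>L leg23 (flip_alg (adj T))) v"
    unfolding v by (simp add: leg_rev_apply assms(1-3))
qed

lemma composite_dual:
  fixes WC :: "'c::chilbert_space op2" and WA :: "'a::chilbert_space op2" and WB :: "'b::chilbert_space op2"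
  assumes W: "unitary_op WC" "unitary_op WA" "unitary_op WB"
    and CA: "bicharacter WC WA V_CA" and AB: "bicharacter WA WB V_AB"
    and comp: "composite WC WA WB V_AB V_CA V_CB"
  shows "composite (dual WB) (dual WA) (dual WC)
    (dual_bicharacter WC WA V_CA) (dual_bicharacter WA WB V_AB) (dual_bicharacter WC WB V_CB)"
proof -
  have CB: "bicharacter WC WB V_CB"
    using comp by (simp add: composite_def)
  have UM: "V_CA \<in> unitary_multipliers (bichar_alg WC WA)" "V_AB \<in> unitary_multipliers (bichar_alg WA WB)"
    "V_CB \<in> unitary_multipliers (bichar_alg WC WB)"
    using CA AB CB W by (auto simp: bicharacter_iff)
  show ?thesis
    unfolding composite_def
  proof
    show "bicharacter (dual WB) (dual WC) (dual_bicharacter WC WB V_CB)"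
      by (rule bicharacter_dual[OF W(1,3) CB])
    show "leg23 (concrete_bicharacter (dual WA) (dual WC) (dual_bicharacter WC WA V_CA)) o\<^sub>L
        leg12 (concrete_bicharacter (dual WB) (dual WA) (dual_bicharacter WA WB V_AB)) =
      leg12 (concrete_bicharacter (dual WB) (dual WA) (dual_bicharacter WA WB V_AB)) o\<^sub>L
        leg13 (concrete_bicharacter (dual WB) (dual WC) (dual_bicharacter WC WB V_CB)) o\<^sub>L
        leg23 (concrete_bicharacter (dual WA) (dual WC) (dual_bicharacter WC WA V_CA))"
      unfolding dual_bicharacter_multiplier(2)[OF W(1,2) UM(1)]
        dual_bicharacter_multiplier(2)[OF W(2,3) UM(2)] dual_bicharacter_multiplier(2)[OF W(1,3) UM(3)]
      using comp unitary_multiplier_concrete(1)[OF W(1,2) UM(1), THEN unitary_opD(1)]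
        unitary_multiplier_concrete(1)[OF W(2,3) UM(2), THEN unitary_opD(1)]
        unitary_multiplier_concrete(1)[OF W(1,3) UM(3), THEN unitary_opD(1)]
      by (intro pentagon_flip) (simp_all add: composite_def)
  qed
qed

lemma multiplicative_unitary_dual:
  assumes "multiplicative_unitary W"
  shows "multiplicative_unitary (dual W)"
  using assms pentagon_flip[of W W W] unitary_op_dual unitary_opD(1)
  by (auto simp: multiplicative_unitary_def dual_eq_flip_alg)

section \<open>The dual of a modular multiplicative unitary\<close>

lemma unconj_conj [simp]: "unconj (conj x) = x"
  by (rule conj_inverse) simp

lemma cinner_conj [simp]: "cinner (conj x) (conj y) = cinner y x"
  by (simp add: cinner_conj.rep_eq)

lemma closure_span_conj_tens:
  "closure (span {conj x \<otimes> y |(x :: 'a::chilbert_space) (y :: 'b::chilbert_space). True}) = UNIV"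
proof -
  have "{conj x \<otimes> y |(x :: 'a) (y :: 'b). True} = {p \<otimes> y |p y. True}"
    by (metis conj_cases)
  then show ?thesis by (simp only: closure_span_tens)
qed

text \<open>This operator is antiunitary, hence only real-linear.\<close>

definition conj_flip :: "('h::chilbert_space conj, 'h) tensor \<Rightarrow>\<^sub>L ('h conj, 'h) tensor"
  where "conj_flip = (THE R :: ('h conj, 'h) tensor \<Rightarrow>\<^sub>L ('h conj, 'h) tensor.
    \<forall>x y. R (conj x \<otimes> y) = conj y \<otimes> x)"

text \<open>Inner products of elementary tensors are conjugated, so their real parts are preserved,
  as \<open>isometric_extension\<close> requires.\<close>

lemma conj_flip_tens [simp]: "conj_flip (conj x \<otimes> y) = conj y \<otimes> (x :: 'h::chilbert_space)"
proof -
  let ?E = "{(conj x \<otimes> y, conj y \<otimes> x) |x y. True} :: (('h conj, 'h) tensor \<times> ('h conj, 'h) tensor) set"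
  have "fst ` ?E = {conj x \<otimes> y |x y. True}"
    by force
  then have dense: "closure (span (fst ` ?E)) = UNIV"
    by (simp only: closure_span_conj_tens)
  have iso: "w \<bullet> w' = v \<bullet> v'" if "(v, w) \<in> ?E" "(v', w') \<in> ?E" for v w v' w'
  proof -
    obtain x y x' y' where *: "v = conj x \<otimes> y" "w = conj y \<otimes> x" "v' = conj x' \<otimes> y'" "w' = conj y' \<otimes> x'"
      using \<open>(v, w) \<in> ?E\<close> \<open>(v', w') \<in> ?E\<close> by blast
    have "cinner w w' = cnj (cinner v v')"
      using cinner_commute[of y y'] cinner_commute[of x x'] by (simp add: * cinner_tens)
    then show ?thesis
      by (simp add: inner_eq_Re_cinner)
  qed
  obtain R :: "('h conj, 'h) tensor \<Rightarrow>\<^sub>L ('h conj, 'h) tensor"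
    where "\<And>v w. (v, w) \<in> ?E \<Longrightarrow> R v = w"
    by (rule isometric_extension[OF dense], rule iso, assumption+, rule that)
  then have R: "R (conj x \<otimes> y) = conj y \<otimes> x" for x y
    by blast
  have eq: "conj_flip = R"
    unfolding conj_flip_def
  proof (rule the_equality)
    fix S :: "('h conj, 'h) tensor \<Rightarrow>\<^sub>L ('h conj, 'h) tensor"
    assume "\<forall>x y. S (conj x \<otimes> y) = conj y \<otimes> x"
    then show "S = R"
      by (intro blinfun_eq_on_dense[OF closure_span_conj_tens]) (auto simp: R)
  qed (simp add: R)
  show ?thesis unfolding eq by (rule R)
qed

lemma conj_flip_twice [simp]: "conj_flip (conj_flip v) = v"
proof -
  have "conj_flip o\<^sub>L conj_flip = id_blinfun"
    by (rule blinfun_eq_on_dense[OF closure_span_conj_tens]) auto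
  then show ?thesis
    by (metis blinfun_apply_blinfun_compose blinfun_apply_id_blinfun)
qed

text \<open>The symmetry relation of an antiunitary involution. Both sides are bounded and
  real-linear in \<open>v\<close>, and the relation is symmetric in the two vectors, so the density
  argument \<open>step\<close> can be run once for each of them.\<close>

lemma cinner_conj_flip:
  fixes v w :: "('h::chilbert_space conj, 'h) tensor"
  shows "cinner (conj_flip v) w = cinner (conj_flip w) v"
proof -
  have lin: "bounded_linear (\<lambda>v. cinner (conj_flip v) u)" for u :: "('h conj, 'h) tensor"
    by (intro bounded_linear_compose[OF bounded_bilinear.bounded_linear_left[OF bounded_bilinear_cinner]]
        blinfun.bounded_linear_right)
  have step: "cinner (conj_flip v) u = cinner (conj_flip u) v"
    if "\<And>x y. cinner (conj_flip (conj x \<otimes> y)) u = cinner (conj_flip u) (conj x \<otimes> y)"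
    for u v :: "('h conj, 'h) tensor"
  proof -
    have "Blinfun (\<lambda>v. cinner (conj_flip v) u) = Blinfun (cinner (conj_flip u))"
      by (rule blinfun_eq_on_dense[OF closure_span_conj_tens])
        (use that in \<open>auto simp: bounded_linear_Blinfun_apply lin bounded_linear_cinner_right simp del: conj_flip_tens\<close>)
    then have "Blinfun (\<lambda>v. cinner (conj_flip v) u) v = Blinfun (cinner (conj_flip u)) v"
      by simp
    then show ?thesis
      by (simp add: bounded_linear_Blinfun_apply lin bounded_linear_cinner_right)
  qed
  have elementary: "cinner (conj_flip v) (conj x \<otimes> y) = cinner (conj_flip (conj x \<otimes> y)) v"
    for v :: "('h conj, 'h) tensor" and x y
    by (rule step) (simp add: cinner_tens)
  show ?thesis
    by (rule step) (rule elementary[symmetric])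
qed

lemma conj_flip_scaleC: "conj_flip (c *\<^sub>C v) = cnj c *\<^sub>C conj_flip v"
proof (rule cinner_eqI)
  fix w
  have "cinner (conj_flip (c *\<^sub>C v)) w = cinner (cnj c *\<^sub>C conj_flip v) w"
    by (simp add: cinner_conj_flip[of _ w] cinner_scaleC_left cinner_scaleC_right)
  then show "cinner w (conj_flip (c *\<^sub>C v)) = cinner w (cnj c *\<^sub>C conj_flip v)"
    by (simp only: cinner_commute[of w])
qed

lemma unitary_op_conj_flip:
  assumes "unitary_op U"
  shows "unitary_op (conj_flip o\<^sub>L U o\<^sub>L conj_flip)"
proof -
  \<comment> \<open>The two conjugations of scalars cancel.\<close>
  have complex: "complex_op (conj_flip o\<^sub>L U o\<^sub>L conj_flip)"
    by (simp add: complex_op_def conj_flip_scaleC complex_opD[OF unitary_opD(1)[OF assms]])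
  have adj: "adj (conj_flip o\<^sub>L U o\<^sub>L conj_flip) = conj_flip o\<^sub>L adj U o\<^sub>L conj_flip"
  proof (rule adj_eqI)
    fix x y
    have "cinner (conj_flip (adj U (conj_flip y))) x = cinner (U (conj_flip x)) (conj_flip y)"
      by (simp add: cinner_conj_flip[of _ x] cinner_adj_right unitary_opD[OF assms])
    also have "\<dots> = cnj (cinner (conj_flip (U (conj_flip x))) y)"
      by (simp add: cinner_conj_flip[of _ y] cinner_commute[symmetric])
    finally show "cinner ((conj_flip o\<^sub>L adj U o\<^sub>L conj_flip) y) x
        = cinner y ((conj_flip o\<^sub>L U o\<^sub>L conj_flip) x)"
      by (simp add: cinner_commute[symmetric])
  qed
  show ?thesis
    by (rule unitary_opI[OF complex]) (simp_all add: adj unitary_opD[OF assms])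
qed

section \<open>Self-adjoint graphs and the modularity condition\<close>

lemma selfadjoint_cinner:
  assumes "positive_selfadjoint Q" "(x, x') \<in> Q" "(y, y') \<in> Q"
  shows "cinner x y' = cinner x' y"
proof -
  have "(x, x') \<in> {(y, z). \<forall>(x, w)\<in>Q. cinner y w = cinner z x}"
    using assms(1,2) unfolding positive_selfadjoint_def by blast
  then show ?thesis using assms(3) by blast
qed

lemma selfadjointI:
  assumes "positive_selfadjoint Q" "\<And>y y'. (y, y') \<in> Q \<Longrightarrow> cinner x y' = cinner x' y"
  shows "(x, x') \<in> Q"
proof -
  have "(x, x') \<in> {(y, z). \<forall>(x, w)\<in>Q. cinner y w = cinner z x}"
    using assms(2) by blast
  then show ?thesis
    using assms(1) unfolding positive_selfadjoint_def by blast
qed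

text \<open>The orthogonal complement of the range of a self-adjoint operator is its kernel:
  orthogonality of \<open>v\<close> to the range says that \<open>(v, 0)\<close> lies in the adjoint
  graph.\<close>

lemma closure_span_Range:
  assumes Q: "positive_selfadjoint Q" and ker: "trivial_kernel Q"
  shows "closure (span (Range Q)) = UNIV"
proof (rule dense_span_complexI)
  fix v assume "\<And>s. s \<in> Range Q \<Longrightarrow> cinner v s = 0"
  then have "(v, 0) \<in> Q"
    by (intro selfadjointI[OF Q]) auto
  then show "v = 0"
    using ker by (simp add: trivial_kernel_def)
next
  fix s assume "s \<in> Range Q"
  then obtain x where "(x, s) \<in> Q" by blast
  then have "(\<i> *\<^sub>C x, \<i> *\<^sub>C s) \<in> Q"
    by (intro selfadjointI[OF Q]) (simp add: cinner_scaleC_left selfadjoint_cinner[OF Q])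
  then show "\<i> *\<^sub>C s \<in> Range Q" by blast
qed

text \<open>For fixed elementary tensors this is a closed real-linear condition on
  \<open>(\<xi>, \<eta>)\<close>, so it can be verified on the generators of
  \<open>graph_tens\<close>, where it splits into the symmetry of \<open>G\<close> and of
  \<open>H\<close>.\<close>

lemma graph_tens_symmetric:
  assumes G: "positive_selfadjoint G" "(u', u) \<in> G" and H: "positive_selfadjoint H" "(z', z) \<in> H"
    and "(\<xi>, \<eta>) \<in> graph_tens G H"
  shows "cinner (u \<otimes> z) \<xi> = cinner (u' \<otimes> z') \<eta>"
proof -
  let ?K = "{p. cinner (u \<otimes> z) (fst p) = cinner (u' \<otimes> z') (snd p)}"
  have "closed ?K"
    by (intro closed_Collect_eq linear_continuous_on bounded_linear_compose[OF bounded_linear_cinner_right]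
        bounded_linear_fst bounded_linear_snd)
  moreover have "subspace ?K"
    by (rule subspaceI) (auto simp: cinner_add_right cinner_scaleR_right)
  moreover have "(x \<otimes> y, x' \<otimes> y') \<in> ?K" if "(x, x') \<in> G" "(y, y') \<in> H" for x x' y y'
    using selfadjoint_cinner[OF G that(1)] selfadjoint_cinner[OF H that(2)] by (simp add: cinner_tens)
  ultimately have "graph_tens G H \<subseteq> ?K"
    unfolding graph_tens_def by (intro closure_minimal span_minimal) auto
  then show ?thesis using assms(5) by auto
qed

lemma flip_graph_tens:
  assumes "(\<xi>, \<eta>) \<in> graph_tens G H"
  shows "(flip \<xi>, flip \<eta>) \<in> graph_tens H G"
proof -
  let ?f = "\<lambda>p. (flip (fst p), flip (snd p))"
  let ?S = "{(x \<otimes> y, x' \<otimes> y') |x x' y y'. (x, x') \<in> G \<and> (y, y') \<in> H}"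
  let ?T = "{(y \<otimes> x, y' \<otimes> x') |y y' x x'. (y, y') \<in> H \<and> (x, x') \<in> G}"
  have lin: "bounded_linear ?f"
    by (intro bounded_linear_Pair bounded_linear_compose[OF blinfun.bounded_linear_right]
        bounded_linear_fst bounded_linear_snd)
  have "?f ` span ?S = span (?f ` ?S)"
    by (rule linear_span_image[symmetric]) (rule bounded_linear.linear[OF lin])
  also have "\<dots> \<subseteq> span ?T"
    by (rule span_mono) force
  finally have "closure (?f ` span ?S) \<subseteq> graph_tens H G"
    unfolding graph_tens_def by (rule closure_mono)
  moreover have "?f ` graph_tens G H \<subseteq> closure (?f ` span ?S)"
    unfolding graph_tens_def by (rule closure_bounded_linear_image_subset[OF lin])
  ultimately show ?thesis
    using assms by force
qed

text \<open>
  If \<open>Wt\<close> is the companion of \<open>W\<close> in the modularity condition, the companion of the dual is the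
  transpose \<open>conj_flip o\<^sub>L Wt o\<^sub>L conj_flip\<close>, and \<open>Q\<close>, \<open>Q'\<close> exchange roles.  The identity follows by applying the
  condition for \<open>W\<close> to \<open>Q'\<close>-images and using that \<open>W\<close> commutes with \<open>Q' \<otimes> Q\<close>, first for \<open>x\<close>
  in the domain and \<open>z\<close> in the range of \<open>Q\<close>, and then for all \<open>x\<close> and \<open>z\<close> by density.
\<close>

lemma modular_transpose:
  fixes W :: "'h::chilbert_space op2"
  assumes W: "unitary_op W" and Wt: "complex_op Wt"
    and Q': "positive_selfadjoint Q'" and Q: "positive_selfadjoint Q" "trivial_kernel Q"
    and inv: "\<And>\<xi> \<eta>. (\<xi>, \<eta>) \<in> graph_tens Q' Q \<Longrightarrow> (W \<xi>, W \<eta>) \<in> graph_tens Q' Q"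
    and mod: "\<And>x z y y' u u'. (y, y') \<in> Q \<Longrightarrow> (u', u) \<in> Q \<Longrightarrow>
      cinner (x \<otimes> y) (W (z \<otimes> u)) = cinner (conj z \<otimes> y') (Wt (conj x \<otimes> u'))"
    and y: "(y, y') \<in> Q'" and u: "(u', u) \<in> Q'"
  shows "cinner (u \<otimes> z) (W (y \<otimes> x)) = cinner (conj y' \<otimes> z) (Wt (conj u' \<otimes> x))"
proof -
  have 1: "cinner (u \<otimes> z) (W (y \<otimes> x)) = cinner (conj y' \<otimes> z) (Wt (conj u' \<otimes> x))"
    if z: "(z0, z) \<in> Q" and x: "(x, x') \<in> Q" for z z0 x x'
  proof -
    have "(y \<otimes> x, y' \<otimes> x') \<in> graph_tens Q' Q"
      unfolding graph_tens_def by (intro closure_subset[THEN subsetD] span_base) (use y x in blast)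
    \<comment> \<open>Here \<open>u \<otimes> z\<close> is the image of
      \<open>u' \<otimes> z0\<close> under \<open>Q' \<otimes> Q\<close>. Symmetry shifts this
      operator to the other side, past \<open>W\<close> and onto \<open>y \<otimes> x\<close>, which
      leaves exactly a left-hand side of \<open>mod\<close>.\<close>
    from graph_tens_symmetric[OF Q' u Q(1) z inv[OF this]]
    have "cinner (u \<otimes> z) (W (y \<otimes> x)) = cinner (u' \<otimes> z0) (W (y' \<otimes> x'))" .
    also have "\<dots> = cinner (conj y' \<otimes> z) (Wt (conj u' \<otimes> x))"
      by (rule mod[OF z x])
    finally show ?thesis .
  qed
  have 2: "cinner (u \<otimes> z) (W (y \<otimes> x)) = cinner (conj y' \<otimes> z) (Wt (conj u' \<otimes> x))"
    if z: "(z0, z) \<in> Q" for z z0 x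
  proof -
    let ?K = "{x. cinner (u \<otimes> z) ((W o\<^sub>L tens_left y) x) = cinner (conj y' \<otimes> z) ((Wt o\<^sub>L tens_left (conj u')) x)}"
    have "closed ?K"
      by (intro closed_Collect_eq linear_continuous_on bounded_linear_compose[OF bounded_linear_cinner_right]
          blinfun.bounded_linear_right)
    moreover have "Domain Q \<subseteq> ?K"
      using 1[OF z] by auto
    ultimately have "closure (Domain Q) \<subseteq> ?K"
      by (intro closure_minimal)
    then show ?thesis
      using Q(1) unfolding positive_selfadjoint_def by auto
  qed
  \<comment> \<open>Compressing by \<open>u\<close> and \<open>conj y'\<close> leaves vectors in the
    space of \<open>z\<close>, where the dense range of \<open>Q\<close> removes the condition on
    \<open>z\<close>.\<close>
  have "adj (tens_left u) (W (y \<otimes> x)) - adj (tens_left (conj y')) (Wt (conj u' \<otimes> x)) = 0"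
  proof (rule eq_zero_if_orthogonal_dense[OF closure_span_Range[OF Q]])
    fix s assume "s \<in> Range Q"
    then obtain s0 where "(s0, s) \<in> Q" by blast
    from 2[OF this, of x] have "cinner (W (y \<otimes> x)) (u \<otimes> s) = cinner (Wt (conj u' \<otimes> x)) (conj y' \<otimes> s)"
      by (metis cinner_commute)
    then show "cinner (adj (tens_left u) (W (y \<otimes> x)) - adj (tens_left (conj y')) (Wt (conj u' \<otimes> x))) s = 0"
      by (simp add: cinner_diff_left cinner_adj_left)
  qed
  then have "cinner z (adj (tens_left u) (W (y \<otimes> x))) = cinner z (adj (tens_left (conj y')) (Wt (conj u' \<otimes> x)))"
    by simp
  then show ?thesis
    by (simp add: cinner_adj_right)
qed

lemma modular_multiplicative_unitary_dual:
  fixes W :: "'h::chilbert_space op2"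
  assumes "modular_multiplicative_unitary W"
  shows "modular_multiplicative_unitary (dual W)"
proof -
  obtain Q' Q and Wt :: "('h conj, 'h) tensor \<Rightarrow>\<^sub>L ('h conj, 'h) tensor"
    where mult: "multiplicative_unitary W"
      and Q': "positive_selfadjoint Q'" "trivial_kernel Q'"
      and Q: "positive_selfadjoint Q" "trivial_kernel Q" and Wt: "unitary_op Wt"
      and inv: "{(adj W \<xi>, adj W \<eta>) |\<xi> \<eta>. (\<xi>, \<eta>) \<in> graph_tens Q' Q} = graph_tens Q' Q"
      and mod: "\<forall>x z y y' u u'. (y, y') \<in> Q \<longrightarrow> (u', u) \<in> Q \<longrightarrow>
        cinner (x \<otimes> y) (W (z \<otimes> u)) = cinner (conj z \<otimes> y') (Wt (conj x \<otimes> u'))"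
    using assms unfolding modular_multiplicative_unitary_def by (elim conjE exE) (rule that)
  have W: "unitary_op W"
    using mult by (simp add: multiplicative_unitary_def)
  have cW: "complex_op W" and cWt: "complex_op Wt"
    using W Wt unitary_opD by blast+
  have inv_adj: "(adj W \<xi>, adj W \<eta>) \<in> graph_tens Q' Q" if "(\<xi>, \<eta>) \<in> graph_tens Q' Q" for \<xi> \<eta>
    using inv that by blast
  \<comment> \<open>Equality of the two graphs, and not just inclusion, gives invariance under
    \<open>W\<close> as well as under \<open>adj W\<close>.\<close>
  have inv_W: "(W \<xi>, W \<eta>) \<in> graph_tens Q' Q" if "(\<xi>, \<eta>) \<in> graph_tens Q' Q" for \<xi> \<eta>
  proof -
    have "(\<xi>, \<eta>) \<in> {(adj W \<xi>, adj W \<eta>) |\<xi> \<eta>. (\<xi>, \<eta>) \<in> graph_tens Q' Q}"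
      using inv that by simp
    then obtain a b where "\<xi> = adj W a" "\<eta> = adj W b" "(a, b) \<in> graph_tens Q' Q" by blast
    then show ?thesis by (simp add: unitary_opD[OF W])
  qed
  have adj_dual: "adj (dual W) = flip_alg W"
    by (simp add: dual_eq_flip_alg adj_flip_alg cW)
  have "{(adj (dual W) \<xi>, adj (dual W) \<eta>) |\<xi> \<eta>. (\<xi>, \<eta>) \<in> graph_tens Q Q'} = graph_tens Q Q'"
  proof (intro set_eqI iffI)
    fix p assume "p \<in> {(adj (dual W) \<xi>, adj (dual W) \<eta>) |\<xi> \<eta>. (\<xi>, \<eta>) \<in> graph_tens Q Q'}"
    then show "p \<in> graph_tens Q Q'"
      by (auto simp: adj_dual flip_alg_def intro!: flip_graph_tens inv_W)
  next
    fix p assume p: "p \<in> graph_tens Q Q'"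
    obtain \<xi> \<eta> where [simp]: "p = (\<xi>, \<eta>)" by (cases p)
    have "(dual W \<xi>, dual W \<eta>) \<in> graph_tens Q Q'"
      using flip_graph_tens[OF inv_adj[OF flip_graph_tens]] p by (simp add: dual_def)
    moreover have "p = (adj (dual W) (dual W \<xi>), adj (dual W) (dual W \<eta>))"
      by (simp add: unitary_opD[OF unitary_op_dual[OF W]])
    ultimately show "p \<in> {(adj (dual W) \<xi>, adj (dual W) \<eta>) |\<xi> \<eta>. (\<xi>, \<eta>) \<in> graph_tens Q Q'}"
      by blast
  qed
  moreover have "cinner (x \<otimes> y) (dual W (z \<otimes> u))
      = cinner (conj z \<otimes> y') ((conj_flip o\<^sub>L Wt o\<^sub>L conj_flip) (conj x \<otimes> u'))"
    if y: "(y, y') \<in> Q'" and u: "(u', u) \<in> Q'" for x z y y' u u'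
  proof -
    have "cinner (x \<otimes> y) (dual W (z \<otimes> u)) = cinner (flip (x \<otimes> y)) (adj W (flip (z \<otimes> u)))"
      using cinner_adj_left[OF complex_op_flip, of "x \<otimes> y" "adj W (flip (z \<otimes> u))"] by (simp add: dual_def)
    also have "\<dots> = cnj (cinner (u \<otimes> z) (W (y \<otimes> x)))"
      by (simp add: cinner_adj_right cW cinner_commute[symmetric])
    also have "\<dots> = cnj (cinner (conj y' \<otimes> z) (Wt (conj u' \<otimes> x)))"
      using modular_transpose[OF W cWt Q'(1) Q inv_W mod[rule_format] y u] by simp
    also have "\<dots> = cnj (cinner (conj_flip (Wt (conj u' \<otimes> x))) (conj z \<otimes> y'))"
      by (simp add: cinner_conj_flip[of "Wt _"])
    also have "\<dots> = cinner (conj z \<otimes> y') ((conj_flip o\<^sub>L Wt o\<^sub>L conj_flip) (conj x \<otimes> u'))"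
      by (simp add: cinner_commute[symmetric])
    finally show ?thesis .
  qed
  ultimately show ?thesis
    unfolding modular_multiplicative_unitary_def
    using multiplicative_unitary_dual[OF mult] Q' Q unitary_op_conj_flip[OF Wt]
    by (intro conjI exI[of _ Q] exI[of _ Q'] exI[of _ "conj_flip o\<^sub>L Wt o\<^sub>L conj_flip"] allI impI) blast+
qed

text \<open>Quantum groups are represented by their fixed unitaries, so identification with the
  double dual is an equality of unitaries. Functoriality consists of the last two conjuncts:
  identities go to identities, and composites to composites in the opposite order.\<close>

theorem proposition3p14:
  fixes WC :: "'c::chilbert_space op2" and WA :: "'a::chilbert_space op2"
    and WB :: "'b::chilbert_space op2"
  assumes C: "modular_multiplicative_unitary WC"
    and A: "modular_multiplicative_unitary WA"
    and B: "modular_multiplicative_unitary WB"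
  shows
    "(\<forall>V. bicharacter WC WA V \<longrightarrow>
       dual_bicharacter WC WA V \<in> unitary_multipliers (alg_tens (qg_algebra WA) (qg_algebra (dual WC))) \<and>
       unitary_op (flip o\<^sub>L adj (concrete_bicharacter WC WA V) o\<^sub>L flip) \<and>
       bicharacter (dual WA) (dual WC) (dual_bicharacter WC WA V) \<and>
       concrete_bicharacter (dual WA) (dual WC) (dual_bicharacter WC WA V) =
         flip o\<^sub>L adj (concrete_bicharacter WC WA V) o\<^sub>L flip) \<and>
     dual (dual WA) = WA \<and>
     modular_multiplicative_unitary (dual WC) \<and>
     modular_multiplicative_unitary (dual WA) \<and>
     (\<forall>V. reduced_bicharacter WC V \<longrightarrow> reduced_bicharacter (dual WC) (dual_bicharacter WC WC V)) \<and>
     (\<forall>V_CA V_AB V_CB. bicharacter WC WA V_CA \<longrightarrow> bicharacter WA WB V_AB \<longrightarrow>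
       composite WC WA WB V_AB V_CA V_CB \<longrightarrow>
       composite (dual WB) (dual WA) (dual WC)
         (dual_bicharacter WC WA V_CA) (dual_bicharacter WA WB V_AB) (dual_bicharacter WC WB V_CB))"
proof -
  have W: "unitary_op WC" "unitary_op WA" "unitary_op WB"
    using C A B by (simp_all add: modular_multiplicative_unitary_def multiplicative_unitary_def)
  show ?thesis
  proof (intro conjI allI impI)
    fix V assume V: "bicharacter WC WA V"
    then have UM: "V \<in> unitary_multipliers (bichar_alg WC WA)"
      by (simp add: bicharacter_iff[OF W(1,2)])
    note dual = dual_bicharacter_multiplier[OF W(1,2) UM]
    show "dual_bicharacter WC WA V \<in> unitary_multipliers (alg_tens (qg_algebra WA) (qg_algebra (dual WC)))"
      using dual(1) by (simp add: bichar_alg_dual[OF W(1,2)])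
    show "unitary_op (flip o\<^sub>L adj (concrete_bicharacter WC WA V) o\<^sub>L flip)"
      using unitary_multiplier_concrete(1)[OF W(1,2) UM] by (intro unitary_op_compose unitary_op_adj) simp_all
    show "bicharacter (dual WA) (dual WC) (dual_bicharacter WC WA V)"
      by (rule bicharacter_dual[OF W(1,2) V])
    show "concrete_bicharacter (dual WA) (dual WC) (dual_bicharacter WC WA V) =
        flip o\<^sub>L adj (concrete_bicharacter WC WA V) o\<^sub>L flip"
      using dual(2) by (simp add: flip_alg_def)
  next
    show "dual (dual WA) = WA"
      by (rule dual_dual[OF unitary_opD(1)[OF W(2)]])
    show "modular_multiplicative_unitary (dual WC)" "modular_multiplicative_unitary (dual WA)"
      by (intro modular_multiplicative_unitary_dual C A)+
  next
    fix V assume "reduced_bicharacter WC V"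
    \<comment> \<open>The concrete form of \<open>V\<close> is \<open>WC\<close>, so that of its
      dual is \<open>flip_alg (adj WC)\<close>, which is \<open>dual WC\<close>.\<close>
    then show "reduced_bicharacter (dual WC) (dual_bicharacter WC WC V)"
      using dual_bicharacter_multiplier[OF W(1,1), of V]
      by (simp add: reduced_bicharacter_def dual_eq_flip_alg)
  next
    fix V_CA V_AB V_CB
    assume "bicharacter WC WA V_CA" "bicharacter WA WB V_AB" "composite WC WA WB V_AB V_CA V_CB"
    then show "composite (dual WB) (dual WA) (dual WC)
        (dual_bicharacter WC WA V_CA) (dual_bicharacter WA WB V_AB) (dual_bicharacter WC WB V_CB)"
      by (rule composite_dual[OF W])
  qed
qed

end
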